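(* Let $\mathcal{C}$ be either $\mathrm{Ab}^{\mathrm{A}}$ (Banach Abelian groups) or $\mathrm{Ab}^{\mathrm{nA}}$ (non-Archimedean Banach Abelian groups), let $R$ be a commutative monoid object of $\mathcal{C}$, let $X$ be a topological space, and let $M_0, M_1$ be objects of $\mathrm{Mod}_{\mathcal{C}}(R)$ isolated at $0$. Let $A_{M_0,M_1} \colon \mathrm{C}_{\mathrm{fin}}(X,M_0) \widehat{\otimes}_R M_1 \to \mathrm{C}_{\mathrm{fin}}(X, M_0 \widehat{\otimes}_R M_1)$ be the natural morphism, induced by $f \otimes m \mapsto (x \mapsto f(x) \otimes m)$. Then the following hold: (i) The natural $R$-linear homomorphism $\mathrm{C}_{\mathrm{fin}}(X,M_0) \otimes_R M_1 \to \mathrm{C}_{\mathrm{fin}}(X,M_0 \widehat{\otimes}_R M_1)$ (from the algebraic tensor product) is bijective. (ii) If $\mathcal{C} = \mathrm{Ab}^{\mathrm{nA}}$, then $A_{M_0,M_1}$ is an isometric isomorphism. (iii) If $R$ is isolated at $0$ and there exists a finite subset $S \subset M_1$ such that the natural morphism $\ell^{\mathcal{C}}(S,R) \to M_1$ is a strict epimorphism, then $A_{M_0,M_1}$ is an isomorphism (in the category of objects of $\mathrm{Mod}_{\mathcal{C}}(R)$ isolated at $0$). (iv) If $\mathcal{C} = \mathrm{Ab}^{\mathrm{A}}$, $X$ is $\mathbb{Z}$ equipped with the discrete topology, $R \neq \{0\}$, and $R$ is isolated at $0$, then $A_{R,\ell^{\mathcal{C}}((\mathbb{Z},1_{\mathbb{Z}}),R)}$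 is not an isomorphism.
   Context: A complete norm on an Abelian group $M$ is a map $\|\cdot\|_M \colon M \to [0,\infty)$ such that $(m_0,m_1) \mapsto \|m_0-m_1\|_M$ is a complete metric. A Banach Abelian group is an Abelian group with a complete norm; it is non-Archimedean if the metric is an ultrametric. Morphisms are bounded group homomorphisms. Both categories are symmetric monoidal for the completed tensor product. A commutative monoid object $R$ is a commutative unital ring with a complete (resp. complete ultrametric) norm and bounded multiplication; $\mathrm{Mod}_{\mathcal{C}}(R)$ is the category of $R$-module objects of $\mathcal{C}$ (bounded scalar multiplication) and bounded $R$-linear maps; an isomorphism is a bijective morphism with bounded inverse. $M_0\widehat{\otimes}_R M_1$ is the completion of $M_0\otimes_R M_1$ for the tensor seminorm, the infimum over presentations $\sum_j m_{0,j}\otimes m_{1,j}$ of $\sum_j\|m_{0,j}\|\|m_{1,j}\|$ if $\mathcal{C}=\mathrm{Ab}^{\mathrm{A}}$, and of $\max_j\|m_{0,j}\|\|m_{1,j}\|$ if $\mathcal{C}=\mathrm{Ab}^{\mathrm{nA}}$. An object is isolated at $0$ if $\{0\}$ is open in it; $M_0\widehat{\otimes}_RM_1$ is then isolated at $0$ when $M_0,M_1$ are. $\mathrm{C}_{\mathrm{fin}}(X,M)$ is the $R$-module of continuous maps $X\to M$ with finite image, with the supremum norm (complete if $M$ is isolated at $0$). A normed set is a set $S$ with a map $|\cdot|_S\colon S\to[0,\infty)$; a subset of $M_1$ is a normed set via $\|\cdot\|_{M_1}$, and $(\mathbb{Z},1_{\mathbb{Z}})$ is the set $\mathbb{Z}$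 with the constant map $1$. $\ell^{\mathcal{C}}(S,R)$ is the completion of $R^{\oplus S}$ for the seminorm $(r_s)_s\mapsto\sum_s\|r_s\|_R|s|_S$ if $\mathcal{C}=\mathrm{Ab}^{\mathrm{A}}$, and $\max_s\|r_s\|_R|s|_S$ if $\mathcal{C}=\mathrm{Ab}^{\mathrm{nA}}$; for $S\subset M_1$ the natural morphism $\ell^{\mathcal{C}}(S,R)\to M_1$ sends the basis vector of $s$ to $s$. A morphism $f\colon M\to N$ is a strict epimorphism if it is surjective and there is $C>0$ such that every $n\in N$ has a preimage $m$ with $\|m\|\le C\|n\|$. *)

theory Defs
  imports
    "HOL-Analysis.Abstract_Metric_Spaces"
    "HOL-Algebra.Module"
    "HOL-Algebra.Coset"
    "HOL-Algebra.Generated_Groups"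
    "HOL-Algebra.Free_Abelian_Groups"
begin

section \<open>Banach Abelian groups, rings and modules\<close>

datatype base_category = Ab_A | Ab_nA

record 'r normed_ring = "'r ring" +
  ring_norm :: "'r \<Rightarrow> real"

record ('r, 'm) normed_module = "('r, 'm) module" +
  mod_norm :: "'m \<Rightarrow> real"

text \<open>\<^const>\<open>Metric_space\<close> wants a distance that is nonnegative and symmetric on the whole type,
  so the distance is cut off to \<open>0\<close> outside the carrier.\<close>

definition norm_dist :: "('a, 'z) ring_scheme \<Rightarrow> ('a \<Rightarrow> real) \<Rightarrow> 'a \<Rightarrow> 'a \<Rightarrow> real" where
  "norm_dist G N x y = (if x \<in> carrier G \<and> y \<in> carrier G then N (x \<ominus>\<^bsub>G\<^esub> y) else 0)"

definition norm_topology :: "('a, 'z) ring_scheme \<Rightarrow> ('a \<Rightarrow> real) \<Rightarrow> 'a topology" where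
  "norm_topology G N = Metric_space.mtopology (carrier G) (norm_dist G N)"

definition complete_norm :: "('a, 'z) ring_scheme \<Rightarrow> ('a \<Rightarrow> real) \<Rightarrow> bool" where
  "complete_norm G N \<longleftrightarrow>
     (\<forall>x\<in>carrier G. 0 \<le> N x) \<and>
     Metric_space (carrier G) (norm_dist G N) \<and>
     Metric_space.mcomplete (carrier G) (norm_dist G N)"

definition ultrametric_norm :: "('a, 'z) ring_scheme \<Rightarrow> ('a \<Rightarrow> real) \<Rightarrow> bool" where
  "ultrametric_norm G N \<longleftrightarrow>
     (\<forall>x\<in>carrier G. \<forall>y\<in>carrier G. \<forall>z\<in>carrier G.
        norm_dist G N x z \<le> max (norm_dist G N x y) (norm_dist G N y z))"

definition banach_abelian_group ::
    "base_category \<Rightarrow> ('a, 'z) ring_scheme \<Rightarrow> ('a \<Rightarrow> real) \<Rightarrow> bool" where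
  "banach_abelian_group C G N \<longleftrightarrow>
     abelian_group G \<and> complete_norm G N \<and> (C = Ab_nA \<longrightarrow> ultrametric_norm G N)"

definition isolated_at_zero :: "('a, 'z) ring_scheme \<Rightarrow> ('a \<Rightarrow> real) \<Rightarrow> bool" where
  "isolated_at_zero G N \<longleftrightarrow> openin (norm_topology G N) {\<zero>\<^bsub>G\<^esub>}"

definition banach_ring :: "base_category \<Rightarrow> 'r normed_ring \<Rightarrow> bool" where
  "banach_ring C R \<longleftrightarrow>
     cring R \<and> banach_abelian_group C R (ring_norm R) \<and>
     (\<exists>K. \<forall>a\<in>carrier R. \<forall>b\<in>carrier R.
        ring_norm R (a \<otimes>\<^bsub>R\<^esub> b) \<le> K * ring_norm R a * ring_norm R b)"

definition banach_module ::
    "base_category \<Rightarrow> 'r normed_ring \<Rightarrow> ('r, 'm) normed_module \<Rightarrow> bool" where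
  "banach_module C R M \<longleftrightarrow>
     Module.module R M \<and> banach_abelian_group C M (mod_norm M) \<and>
     (\<exists>K. \<forall>a\<in>carrier R. \<forall>x\<in>carrier M.
        mod_norm M (a \<odot>\<^bsub>M\<^esub> x) \<le> K * ring_norm R a * mod_norm M x)"

abbreviation isolated_module :: "('r, 'm) normed_module \<Rightarrow> bool" where
  "isolated_module M \<equiv> isolated_at_zero M (mod_norm M)"

text \<open>The fields \<^const>\<open>mult\<close> and \<^const>\<open>one\<close> that the module records inherit from the ring
  records have no meaning for a module; in the constructions below they are undefined.\<close>

definition regular_module :: "'r normed_ring \<Rightarrow> ('r, 'r) normed_module" where
  "regular_module R =
     \<lparr>carrier = carrier R, monoid.mult = undefined, one = undefined, ring.zero = \<zero>\<^bsub>R\<^esub>,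
      ring.add = (\<lambda>x y. x \<oplus>\<^bsub>R\<^esub> y), smult = (\<lambda>a x. a \<otimes>\<^bsub>R\<^esub> x), mod_norm = ring_norm R\<rparr>"


section \<open>Morphisms\<close>

definition R_linear ::
    "'r normed_ring \<Rightarrow> ('r, 'm) normed_module \<Rightarrow> ('r, 'n) normed_module \<Rightarrow> ('m \<Rightarrow> 'n) \<Rightarrow> bool" where
  "R_linear R M N f \<longleftrightarrow>
     f \<in> carrier M \<rightarrow> carrier N \<and>
     (\<forall>x\<in>carrier M. \<forall>y\<in>carrier M. f (x \<oplus>\<^bsub>M\<^esub> y) = f x \<oplus>\<^bsub>N\<^esub> f y) \<and>
     (\<forall>a\<in>carrier R. \<forall>x\<in>carrier M. f (a \<odot>\<^bsub>M\<^esub> x) = a \<odot>\<^bsub>N\<^esub> f x)"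

definition Mod_hom ::
    "base_category \<Rightarrow> 'r normed_ring \<Rightarrow> ('r, 'm) normed_module \<Rightarrow> ('r, 'n) normed_module \<Rightarrow>
     ('m \<Rightarrow> 'n) \<Rightarrow> bool" where
  "Mod_hom C R M N f \<longleftrightarrow>
     banach_module C R M \<and> banach_module C R N \<and> R_linear R M N f \<and>
     (\<exists>K. \<forall>x\<in>carrier M. mod_norm N (f x) \<le> K * mod_norm M x)"

definition Mod_iso ::
    "base_category \<Rightarrow> 'r normed_ring \<Rightarrow> ('r, 'm) normed_module \<Rightarrow> ('r, 'n) normed_module \<Rightarrow>
     ('m \<Rightarrow> 'n) \<Rightarrow> bool" where
  "Mod_iso C R M N f \<longleftrightarrow>
     Mod_hom C R M N f \<and> bij_betw f (carrier M) (carrier N) \<and>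
     (\<exists>K. \<forall>y\<in>carrier N. mod_norm M (inv_into (carrier M) f y) \<le> K * mod_norm N y)"

definition isometric :: "('r, 'm) normed_module \<Rightarrow> ('r, 'n) normed_module \<Rightarrow> ('m \<Rightarrow> 'n) \<Rightarrow> bool" where
  "isometric M N f \<longleftrightarrow> (\<forall>x\<in>carrier M. mod_norm N (f x) = mod_norm M x)"

definition strict_epi ::
    "base_category \<Rightarrow> 'r normed_ring \<Rightarrow> ('r, 'm) normed_module \<Rightarrow> ('r, 'n) normed_module \<Rightarrow>
     ('m \<Rightarrow> 'n) \<Rightarrow> bool" where
  "strict_epi C R M N f \<longleftrightarrow>
     Mod_hom C R M N f \<and> f ` carrier M = carrier N \<and>
     (\<exists>K>0. \<forall>y\<in>carrier N. \<exists>x\<in>carrier M. f x = y \<and> mod_norm M x \<le> K * mod_norm N y)"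


section \<open>Completion of a seminormed module\<close>

text \<open>Here \<^const>\<open>mod_norm\<close> need only be a seminorm. The elements of the completion are the
  classes of Cauchy sequences modulo sequences tending to \<open>0\<close>.\<close>

definition cauchy_seqs :: "('r, 'm) normed_module \<Rightarrow> (nat \<Rightarrow> 'm) set" where
  "cauchy_seqs V =
     {s. (\<forall>n. s n \<in> carrier V) \<and>
         (\<forall>e>0. \<exists>n0. \<forall>m\<ge>n0. \<forall>n\<ge>n0. mod_norm V (s m \<ominus>\<^bsub>V\<^esub> s n) < e)}"

definition cauchy_class :: "('r, 'm) normed_module \<Rightarrow> (nat \<Rightarrow> 'm) \<Rightarrow> (nat \<Rightarrow> 'm) set" where
  "cauchy_class V s = {t \<in> cauchy_seqs V. (\<lambda>n. mod_norm V (t n \<ominus>\<^bsub>V\<^esub> s n)) \<longlonglongrightarrow> 0}"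

definition completion :: "('r, 'm) normed_module \<Rightarrow> ('r, (nat \<Rightarrow> 'm) set) normed_module" where
  "completion V =
     \<lparr>carrier = cauchy_class V ` cauchy_seqs V, monoid.mult = undefined, one = undefined,
      ring.zero = cauchy_class V (\<lambda>_. \<zero>\<^bsub>V\<^esub>),
      ring.add = (\<lambda>S T. \<Union>s\<in>S. \<Union>t\<in>T. cauchy_class V (\<lambda>n. s n \<oplus>\<^bsub>V\<^esub> t n)),
      smult = (\<lambda>a S. \<Union>s\<in>S. cauchy_class V (\<lambda>n. a \<odot>\<^bsub>V\<^esub> s n)),
      mod_norm = (\<lambda>S. THE l. \<exists>s\<in>S. (\<lambda>n. mod_norm V (s n)) \<longlonglongrightarrow> l)\<rparr>"

definition to_completion :: "('r, 'm) normed_module \<Rightarrow> 'm \<Rightarrow> (nat \<Rightarrow> 'm) set" where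
  "to_completion V x = cauchy_class V (\<lambda>_. x)"

text \<open>The extension by continuity of a bounded homomorphism from \<open>V\<close> to a complete \<open>W\<close>.\<close>

definition completion_extend ::
    "('r, 'n) normed_module \<Rightarrow> ('m \<Rightarrow> 'n) \<Rightarrow> (nat \<Rightarrow> 'm) set \<Rightarrow> 'n" where
  "completion_extend W f S =
     (THE w. \<exists>s\<in>S. limitin (norm_topology W (mod_norm W)) (\<lambda>n. f (s n)) w sequentially)"


section \<open>Tensor products\<close>

text \<open>The aggregation of the norms of the terms of a finite sum: \<open>\<Sum>\<close> or \<open>max\<close>.\<close>

fun aggregate :: "base_category \<Rightarrow> real list \<Rightarrow> real" where
  "aggregate Ab_A ts = sum_list ts"
| "aggregate Ab_nA ts = Max (insert 0 (set ts))"

text \<open>The algebraic tensor product is the quotient of the free Abelian group on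
  \<open>carrier M \<times> carrier N\<close> by the subgroup generated by the usual relations.\<close>

definition tensor_relations ::
    "'r normed_ring \<Rightarrow> ('r, 'm) normed_module \<Rightarrow> ('r, 'n) normed_module \<Rightarrow>
     (('m \<times> 'n) \<Rightarrow>\<^sub>0 int) set" where
  "tensor_relations R M N =
     {frag_of (x \<oplus>\<^bsub>M\<^esub> x', y) - frag_of (x, y) - frag_of (x', y) | x x' y.
        x \<in> carrier M \<and> x' \<in> carrier M \<and> y \<in> carrier N} \<union>
     {frag_of (x, y \<oplus>\<^bsub>N\<^esub> y') - frag_of (x, y) - frag_of (x, y') | x y y'.
        x \<in> carrier M \<and> y \<in> carrier N \<and> y' \<in> carrier N} \<union>
     {frag_of (a \<odot>\<^bsub>M\<^esub> x, y) - frag_of (x, a \<odot>\<^bsub>N\<^esub> y) | a x y.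
        a \<in> carrier R \<and> x \<in> carrier M \<and> y \<in> carrier N}"

definition tensor_free ::
    "('r, 'm) normed_module \<Rightarrow> ('r, 'n) normed_module \<Rightarrow> (('m \<times> 'n) \<Rightarrow>\<^sub>0 int) monoid" where
  "tensor_free M N = free_Abelian_group (carrier M \<times> carrier N)"

definition tensor_kernel ::
    "'r normed_ring \<Rightarrow> ('r, 'm) normed_module \<Rightarrow> ('r, 'n) normed_module \<Rightarrow>
     (('m \<times> 'n) \<Rightarrow>\<^sub>0 int) set" where
  "tensor_kernel R M N = generate (tensor_free M N) (tensor_relations R M N)"

definition tensor_class ::
    "'r normed_ring \<Rightarrow> ('r, 'm) normed_module \<Rightarrow> ('r, 'n) normed_module \<Rightarrow>
     (('m \<times> 'n) \<Rightarrow>\<^sub>0 int) \<Rightarrow> (('m \<times> 'n) \<Rightarrow>\<^sub>0 int) set" where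
  "tensor_class R M N c = tensor_kernel R M N #>\<^bsub>tensor_free M N\<^esub> c"

definition pure_tensor ::
    "'r normed_ring \<Rightarrow> ('r, 'm) normed_module \<Rightarrow> ('r, 'n) normed_module \<Rightarrow>
     'm \<Rightarrow> 'n \<Rightarrow> (('m \<times> 'n) \<Rightarrow>\<^sub>0 int) set" where
  "pure_tensor R M N x y = tensor_class R M N (frag_of (x, y))"

text \<open>The list \<open>[(x\<^sub>1, y\<^sub>1), \<dots>]\<close> presents the element \<open>\<Sum>\<^sub>j x\<^sub>j \<otimes> y\<^sub>j\<close>.\<close>

definition presents ::
    "'r normed_ring \<Rightarrow> ('r, 'm) normed_module \<Rightarrow> ('r, 'n) normed_module \<Rightarrow>
     ('m \<times> 'n) list \<Rightarrow> (('m \<times> 'n) \<Rightarrow>\<^sub>0 int) set \<Rightarrow> bool" where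
  "presents R M N ps T \<longleftrightarrow>
     set ps \<subseteq> carrier M \<times> carrier N \<and> T = tensor_class R M N (sum_list (map frag_of ps))"

definition tensor ::
    "base_category \<Rightarrow> 'r normed_ring \<Rightarrow> ('r, 'm) normed_module \<Rightarrow> ('r, 'n) normed_module \<Rightarrow>
     ('r, (('m \<times> 'n) \<Rightarrow>\<^sub>0 int) set) normed_module" where
  "tensor C R M N =
     \<lparr>carrier = carrier (tensor_free M N Mod tensor_kernel R M N),
      monoid.mult = undefined, one = undefined,
      ring.zero = \<one>\<^bsub>tensor_free M N Mod tensor_kernel R M N\<^esub>,
      ring.add = (\<lambda>S T. S \<otimes>\<^bsub>tensor_free M N Mod tensor_kernel R M N\<^esub> T),
      smult = (\<lambda>a T. \<Union>c\<in>T.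
         tensor_class R M N (frag_extend (\<lambda>(x, y). frag_of (a \<odot>\<^bsub>M\<^esub> x, y)) c)),
      mod_norm = (\<lambda>T. Inf {aggregate C (map (\<lambda>(x, y). mod_norm M x * mod_norm N y) ps) | ps.
         presents R M N ps T})\<rparr>"

text \<open>The homomorphism \<open>\<Sum>\<^sub>j x\<^sub>j \<otimes> y\<^sub>j \<mapsto> \<Sum>\<^sub>j B x\<^sub>j y\<^sub>j\<close> induced by a balanced biadditive map \<open>B\<close>.\<close>

definition tensor_lift ::
    "'r normed_ring \<Rightarrow> ('r, 'm) normed_module \<Rightarrow> ('r, 'n) normed_module \<Rightarrow>
     ('r, 'w) normed_module \<Rightarrow> ('m \<Rightarrow> 'n \<Rightarrow> 'w) \<Rightarrow> (('m \<times> 'n) \<Rightarrow>\<^sub>0 int) set \<Rightarrow> 'w" where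
  "tensor_lift R M N W B T =
     (THE w. \<exists>ps. presents R M N ps T \<and>
        w = foldr (\<lambda>(x, y) v. B x y \<oplus>\<^bsub>W\<^esub> v) ps \<zero>\<^bsub>W\<^esub>)"

definition completed_tensor ::
    "base_category \<Rightarrow> 'r normed_ring \<Rightarrow> ('r, 'm) normed_module \<Rightarrow> ('r, 'n) normed_module \<Rightarrow>
     ('r, (nat \<Rightarrow> (('m \<times> 'n) \<Rightarrow>\<^sub>0 int) set) set) normed_module" where
  "completed_tensor C R M N = completion (tensor C R M N)"

definition completed_pure_tensor ::
    "base_category \<Rightarrow> 'r normed_ring \<Rightarrow> ('r, 'm) normed_module \<Rightarrow> ('r, 'n) normed_module \<Rightarrow>
     'm \<Rightarrow> 'n \<Rightarrow> (nat \<Rightarrow> (('m \<times> 'n) \<Rightarrow>\<^sub>0 int) set) set" where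
  "completed_pure_tensor C R M N x y = to_completion (tensor C R M N) (pure_tensor R M N x y)"


section \<open>Continuous maps with finite image\<close>

text \<open>Maps on \<open>X\<close> are represented by functions that are undefined outside \<open>topspace X\<close>. The
  inserted \<open>0\<close> only matters for empty \<open>X\<close>: the supremum is taken in \<open>[0, \<infinity>)\<close>.\<close>

definition C_fin :: "'x topology \<Rightarrow> ('r, 'm) normed_module \<Rightarrow> ('r, 'x \<Rightarrow> 'm) normed_module" where
  "C_fin X M =
     \<lparr>carrier = {f \<in> topspace X \<rightarrow>\<^sub>E carrier M.
         continuous_map X (norm_topology M (mod_norm M)) f \<and> finite (f ` topspace X)},
      monoid.mult = undefined, one = undefined,
      ring.zero = (\<lambda>x\<in>topspace X. \<zero>\<^bsub>M\<^esub>),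
      ring.add = (\<lambda>f g. \<lambda>x\<in>topspace X. f x \<oplus>\<^bsub>M\<^esub> g x),
      smult = (\<lambda>a f. \<lambda>x\<in>topspace X. a \<odot>\<^bsub>M\<^esub> f x),
      mod_norm = (\<lambda>f. Sup (insert 0 ((\<lambda>x. mod_norm M (f x)) ` topspace X)))\<rparr>"

text \<open>The natural maps with values in \<open>C_fin X (completed_tensor C R M N)\<close>, from the algebraic
  and from the completed tensor product.\<close>

definition alg_nat_map ::
    "base_category \<Rightarrow> 'r normed_ring \<Rightarrow> 'x topology \<Rightarrow> ('r, 'm) normed_module \<Rightarrow>
     ('r, 'n) normed_module \<Rightarrow> ((('x \<Rightarrow> 'm) \<times> 'n) \<Rightarrow>\<^sub>0 int) set \<Rightarrow>
     'x \<Rightarrow> (nat \<Rightarrow> (('m \<times> 'n) \<Rightarrow>\<^sub>0 int) set) set" where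
  "alg_nat_map C R X M N =
     tensor_lift R (C_fin X M) N (C_fin X (completed_tensor C R M N))
       (\<lambda>f y. \<lambda>x\<in>topspace X. completed_pure_tensor C R M N (f x) y)"

definition A_map ::
    "base_category \<Rightarrow> 'r normed_ring \<Rightarrow> 'x topology \<Rightarrow> ('r, 'm) normed_module \<Rightarrow>
     ('r, 'n) normed_module \<Rightarrow> (nat \<Rightarrow> ((('x \<Rightarrow> 'm) \<times> 'n) \<Rightarrow>\<^sub>0 int) set) set \<Rightarrow>
     'x \<Rightarrow> (nat \<Rightarrow> (('m \<times> 'n) \<Rightarrow>\<^sub>0 int) set) set" where
  "A_map C R X M N =
     completion_extend (C_fin X (completed_tensor C R M N)) (alg_nat_map C R X M N)"


section \<open>The modules of summable families\<close>

text \<open>A normed set is given by a set \<open>S\<close> and a weight \<open>w\<close> on it. The sums and maxima over \<open>S\<close> are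
  taken over the support of the family.\<close>

definition support :: "'r normed_ring \<Rightarrow> 's set \<Rightarrow> ('s \<Rightarrow> 'r) \<Rightarrow> 's set" where
  "support R S r = {s \<in> S. r s \<noteq> \<zero>\<^bsub>R\<^esub>}"

definition free_module ::
    "base_category \<Rightarrow> 's set \<Rightarrow> ('s \<Rightarrow> real) \<Rightarrow> 'r normed_ring \<Rightarrow> ('r, 's \<Rightarrow> 'r) normed_module" where
  "free_module C S w R =
     \<lparr>carrier = {r \<in> S \<rightarrow>\<^sub>E carrier R. finite (support R S r)},
      monoid.mult = undefined, one = undefined,
      ring.zero = (\<lambda>s\<in>S. \<zero>\<^bsub>R\<^esub>),
      ring.add = (\<lambda>r r'. \<lambda>s\<in>S. r s \<oplus>\<^bsub>R\<^esub> r' s),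
      smult = (\<lambda>a r. \<lambda>s\<in>S. a \<otimes>\<^bsub>R\<^esub> r s),
      mod_norm = (\<lambda>r. case C of
          Ab_A \<Rightarrow> (\<Sum>s\<in>support R S r. ring_norm R (r s) * w s)
        | Ab_nA \<Rightarrow> Max (insert 0 ((\<lambda>s. ring_norm R (r s) * w s) ` support R S r)))\<rparr>"

definition ell ::
    "base_category \<Rightarrow> 's set \<Rightarrow> ('s \<Rightarrow> real) \<Rightarrow> 'r normed_ring \<Rightarrow>
     ('r, (nat \<Rightarrow> 's \<Rightarrow> 'r) set) normed_module" where
  "ell C S w R = completion (free_module C S w R)"

definition ell_nat_map ::
    "'r normed_ring \<Rightarrow> 'm set \<Rightarrow> ('r, 'm) normed_module \<Rightarrow> (nat \<Rightarrow> 'm \<Rightarrow> 'r) set \<Rightarrow> 'm" where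
  "ell_nat_map R S M =
     completion_extend M (\<lambda>r. \<Oplus>\<^bsub>M\<^esub>s\<in>support R S r. r s \<odot>\<^bsub>M\<^esub> s)"

end

theory Submission
  imports Defs
begin

text \<open>In a module isolated at \<open>0\<close> every nonzero element has norm at least some \<open>\<delta> > 0\<close>. A presentation
  whose weight is smaller than the product of the two bounds presents \<open>0\<close>, so the tensor product of isolated modules is
  itself isolated, and all completions are trivial: Cauchy sequences are eventually constant. Everything thus reduces to the
  algebraic tensor product. Bijectivity of the natural map follows by decomposing \<open>X\<close> into the level sets of the
  finitely many functions involved. Lifting presentations of each of the finitely many values gives the isometry
  in the non-Archimedean case, since a maximum does not see the number of level sets. In the Archimedean case the number of
  terms is instead controlled by collecting them along finitely many generators of \<open>M1\<close>; without such generators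
  the tensors \<open>\<Sum>\<^sub>k\<^sub><\<^sub>n \<delta>\<^sub>k \<otimes> e\<^sub>k\<close> show that the inverse is unbounded.\<close>

section \<open>Isolated normed modules\<close>

text \<open>The natural map never increases norms, so once it is bijective everything comes down to
  one uniform inequality: the tensor norm against a constant multiple of the supremum norm of the
  image. Spreading a presentation of each value over its level set adds, under \<open>Ab_A\<close>,
  the weights for all values, while the image only remembers the largest. Generators help because
  they are the same at every point: the coefficients of the values along one generator form a single
  function, so a constant proportional to the number of generators suffices. They are, however,
  given by a strict epimorphism from a completion whose underlying free module carries only a
  seminorm; the discreteness of \<open>M1\<close> turns a late term of a Cauchy sequence into a
  finite combination with almost the same bound. On the diagonal, one coordinate functional yields
  an estimate independent of \<open>n\<close>. Linear growth comes from adding the norms of the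
  functionals, and this sum stays controlled on each term because the \<open>ell\<close> norm is
  itself a sum over coordinates.\<close>

lemma aggregate_append_le:
  assumes "\<And>t. t \<in> set ts \<Longrightarrow> 0 \<le> t" "\<And>t. t \<in> set us \<Longrightarrow> 0 \<le> t"
  shows "aggregate C (ts @ us) \<le> aggregate C [aggregate C ts, aggregate C us]"
proof (cases C)
  case Ab_nA
  have "Max (insert 0 (set (ts @ us))) \<le> max (Max (insert 0 (set ts))) (Max (insert 0 (set us)))"
    by (intro Max.boundedI) (auto intro: max.coboundedI1 max.coboundedI2)
  then show ?thesis
    by (simp add: Ab_nA max.coboundedI2)
qed simp

text \<open>A maximum of nonnegative terms is at most their sum; this recovers the ordinary triangle
  inequality in either category.\<close>

lemma aggregate_le_sum_list:
  assumes "\<And>t. t \<in> set ts \<Longrightarrow> 0 \<le> t"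
  shows "aggregate C ts \<le> sum_list ts"
  using assms by (cases C) (auto intro: member_le_sum_list sum_list_nonneg)

text \<open>Turns a lower bound on one term of a presentation into a lower bound on its
  weight.\<close>

lemma aggregate_ge_member:
  assumes "\<And>t. t \<in> set ts \<Longrightarrow> 0 \<le> t" "t \<in> set ts"
  shows "t \<le> aggregate C ts"
  using assms by (cases C) (auto intro: member_le_sum_list)

lemma aggregate_nonneg:
  assumes "\<And>t. t \<in> set ts \<Longrightarrow> 0 \<le> t"
  shows "0 \<le> aggregate C ts"
  using assms by (cases C) (auto intro: sum_list_nonneg)

lemma aggregate_mono:
  assumes "\<And>p. p \<in> set ps \<Longrightarrow> f p \<le> g p"
  shows "aggregate C (map f ps) \<le> aggregate C (map g ps)"
proof (cases C)
  case Ab_nA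
  have "Max (insert 0 (f ` set ps)) \<le> Max (insert 0 (g ` set ps))"
    by (rule Max.boundedI) (use assms in \<open>auto intro: Max.coboundedI order_trans[OF _ Max.coboundedI]\<close>)
  then show ?thesis
    by (simp add: Ab_nA)
qed (use assms in \<open>auto intro: sum_list_mono\<close>)

text \<open>Multiplication by a nonnegative \<open>c\<close> is monotone and fixes the inserted 0,
  so it commutes with the maximum.\<close>

lemma aggregate_scale:
  assumes "0 \<le> c"
  shows "aggregate C (map (\<lambda>p. c * f p) ps) = c * aggregate C (map f ps)"
proof (cases C)
  case Ab_nA
  have "mono ((*) c)"
    using assms by (simp add: mono_def mult_left_mono)
  then have "c * Max (insert 0 (f ` set ps)) = Max ((*) c ` insert 0 (f ` set ps))"
    by (rule mono_Max_commute) auto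
  then show ?thesis
    by (simp add: Ab_nA image_image)
qed (simp add: sum_list_const_mult)

lemma aggregate_pair_mono:
  "a \<le> a' \<Longrightarrow> b \<le> b' \<Longrightarrow> aggregate C [a, b] \<le> aggregate C [a', b']"
  by (cases C) (auto simp: max_def)

text \<open>Near-optimal presentations of two tensors each come with a slack \<open>e\<close>; this
  removes both slacks at once.\<close>

lemma aggregate_pair_lim:
  assumes "\<And>e. e > 0 \<Longrightarrow> c \<le> aggregate C [a + e, b + e]"
  shows "c \<le> aggregate C [a, b]"
proof (rule field_le_epsilon)
  fix e :: real assume "e > 0"
  \<comment> \<open>Halves, because a sum collects the slack twice; a maximum collects it only
    once.\<close>
  then have "c \<le> aggregate C [a + e/2, b + e/2]"
    by (intro assms) auto
  also have "\<dots> \<le> aggregate C [a, b] + e"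
    using \<open>e > 0\<close> by (cases C) (auto simp: max_def)
  finally show "c \<le> aggregate C [a, b] + e" .
qed

section \<open>Norms on modules and the gap at zero\<close>

context abelian_group
begin

lemma a_inv_zero: "\<ominus> \<zero> = \<zero>"
  using add.inv_one by simp

lemma minus_eq_zero_iff: "x \<in> carrier G \<Longrightarrow> y \<in> carrier G \<Longrightarrow> x \<ominus> y = \<zero> \<longleftrightarrow> x = y"
  by (metis a_inv_closed add.inv_inv minus_equality minus_eq r_neg)

end

text \<open>Definiteness is left out because a free module whose weights may vanish, as the weight
  of 0 does, carries only a seminorm. Phrasing the triangle inequality through
  \<open>aggregate\<close> treats both categories at once.\<close>

locale seminormed_module = module R M
  for C :: base_category and R :: "'r normed_ring" (structure)
    and M :: "('r, 'm) normed_module" (structure) +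
  assumes ring_norm_nonneg: "a \<in> carrier R \<Longrightarrow> 0 \<le> ring_norm R a"
    and norm_zero [simp]: "mod_norm M \<zero>\<^bsub>M\<^esub> = 0"
    and norm_nonneg: "x \<in> carrier M \<Longrightarrow> 0 \<le> mod_norm M x"
    and norm_minus: "x \<in> carrier M \<Longrightarrow> mod_norm M (\<ominus>\<^bsub>M\<^esub> x) = mod_norm M x"
    and norm_add_le: "x \<in> carrier M \<Longrightarrow> y \<in> carrier M \<Longrightarrow>
      mod_norm M (x \<oplus>\<^bsub>M\<^esub> y) \<le> aggregate C [mod_norm M x, mod_norm M y]"
    and norm_smult_le: "\<exists>K\<ge>0. \<forall>a\<in>carrier R. \<forall>x\<in>carrier M.
      mod_norm M (a \<odot>\<^bsub>M\<^esub> x) \<le> K * ring_norm R a * mod_norm M x"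
begin

lemma norm_triangle:
  assumes "x \<in> carrier M" "y \<in> carrier M"
  shows "mod_norm M (x \<oplus>\<^bsub>M\<^esub> y) \<le> mod_norm M x + mod_norm M y"
proof -
  have "mod_norm M (x \<oplus>\<^bsub>M\<^esub> y) \<le> aggregate C [mod_norm M x, mod_norm M y]"
    using assms by (rule norm_add_le)
  also have "\<dots> \<le> mod_norm M x + mod_norm M y"
    using aggregate_le_sum_list[of "[mod_norm M x, mod_norm M y]"] assms norm_nonneg by force
  finally show ?thesis .
qed

lemma minus_via:
  assumes "x \<in> carrier M" "y \<in> carrier M" "z \<in> carrier M"
  shows "x \<ominus>\<^bsub>M\<^esub> z = (x \<ominus>\<^bsub>M\<^esub> y) \<oplus>\<^bsub>M\<^esub> (y \<ominus>\<^bsub>M\<^esub> z)"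
proof -
  have "(x \<ominus>\<^bsub>M\<^esub> y) \<oplus>\<^bsub>M\<^esub> (y \<ominus>\<^bsub>M\<^esub> z) = x \<oplus>\<^bsub>M\<^esub> ((\<ominus>\<^bsub>M\<^esub> y \<oplus>\<^bsub>M\<^esub> y) \<oplus>\<^bsub>M\<^esub> \<ominus>\<^bsub>M\<^esub> z)"
    unfolding M.minus_eq using assms by (simp only: M.a_assoc M.a_closed M.a_inv_closed)
  then show ?thesis
    using assms by (simp add: M.l_neg M.minus_eq)
qed

lemma norm_minus_commute:
  assumes "x \<in> carrier M" "y \<in> carrier M"
  shows "mod_norm M (x \<ominus>\<^bsub>M\<^esub> y) = mod_norm M (y \<ominus>\<^bsub>M\<^esub> x)"
proof -
  have "y \<ominus>\<^bsub>M\<^esub> x = \<ominus>\<^bsub>M\<^esub> (x \<ominus>\<^bsub>M\<^esub> y)"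
    using assms by (simp add: M.minus_eq M.minus_add M.a_comm)
  then show ?thesis
    using assms by (simp add: norm_minus)
qed

end

text \<open>The uniform gap contains definiteness, since a nonzero element has positive norm, and it
  makes completeness automatic.\<close>

locale isolated_normed_module = seminormed_module +
  assumes norm_isolated: "\<exists>\<delta>>0. \<forall>x\<in>carrier M. x \<noteq> \<zero>\<^bsub>M\<^esub> \<longrightarrow> \<delta> \<le> mod_norm M x"
begin

lemma norm_eq_0_iff: "x \<in> carrier M \<Longrightarrow> mod_norm M x = 0 \<longleftrightarrow> x = \<zero>\<^bsub>M\<^esub>"
  using norm_isolated by fastforce

lemma eventually_equalI:
  assumes "\<And>n. s n \<in> carrier M" "\<And>n. t n \<in> carrier M"
    and "(\<lambda>n. mod_norm M (s n \<ominus>\<^bsub>M\<^esub> t n)) \<longlonglongrightarrow> 0"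
  shows "\<forall>\<^sub>F n in sequentially. s n = t n"
proof -
  obtain \<delta> where \<delta>: "\<delta> > 0" "\<And>x. x \<in> carrier M \<Longrightarrow> x \<noteq> \<zero>\<^bsub>M\<^esub> \<Longrightarrow> \<delta> \<le> mod_norm M x"
    using norm_isolated by blast
  have "\<forall>\<^sub>F n in sequentially. mod_norm M (s n \<ominus>\<^bsub>M\<^esub> t n) < \<delta>"
    using assms(3) \<delta>(1) by (rule order_tendstoD)
  then show ?thesis
    by (rule eventually_mono) (metis \<delta>(2) assms(1,2) M.minus_closed M.minus_eq_zero_iff not_less)
qed

lemma Cauchy_eventually_constant:
  assumes "\<And>n. s n \<in> carrier M"
    and "\<And>e. e > 0 \<Longrightarrow> \<exists>n0. \<forall>m\<ge>n0. \<forall>n\<ge>n0. mod_norm M (s m \<ominus>\<^bsub>M\<^esub> s n) < e"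
  shows "\<exists>x\<in>carrier M. \<forall>\<^sub>F n in sequentially. s n = x"
proof -
  obtain \<delta> where \<delta>: "\<delta> > 0" "\<And>x. x \<in> carrier M \<Longrightarrow> x \<noteq> \<zero>\<^bsub>M\<^esub> \<Longrightarrow> \<delta> \<le> mod_norm M x"
    using norm_isolated by blast
  \<comment> \<open>The gap itself is the tolerance: beyond \<open>n0\<close> all differences fall
    below it and hence vanish.\<close>
  obtain n0 where n0: "\<And>m n. m \<ge> n0 \<Longrightarrow> n \<ge> n0 \<Longrightarrow> mod_norm M (s m \<ominus>\<^bsub>M\<^esub> s n) < \<delta>"
    using assms(2)[OF \<delta>(1)] by blast
  have "s n = s n0" if "n \<ge> n0" for n
    using n0[OF that le_refl] \<delta>(2)[of "s n \<ominus>\<^bsub>M\<^esub> s n0"] assms(1)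
    by (metis M.minus_closed M.minus_eq_zero_iff not_less)
  then show ?thesis
    using assms(1) eventually_sequentially by blast
qed

lemma Metric_space_norm_dist: "Metric_space (carrier M) (norm_dist M (mod_norm M))"
proof
  fix x y z
  show "0 \<le> norm_dist M (mod_norm M) x y"
    by (simp add: norm_dist_def norm_nonneg)
  show "norm_dist M (mod_norm M) x y = norm_dist M (mod_norm M) y x"
    by (simp add: norm_dist_def norm_minus_commute)
  assume xyz: "x \<in> carrier M" "y \<in> carrier M"
  then show "norm_dist M (mod_norm M) x y = 0 \<longleftrightarrow> x = y"
    by (simp add: norm_dist_def norm_eq_0_iff M.minus_eq_zero_iff)
  assume z: "z \<in> carrier M"
  show "norm_dist M (mod_norm M) x z \<le> norm_dist M (mod_norm M) x y + norm_dist M (mod_norm M) y z"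
    using xyz z minus_via[of x y z] norm_triangle[of "x \<ominus>\<^bsub>M\<^esub> y" "y \<ominus>\<^bsub>M\<^esub> z"] by (simp add: norm_dist_def)
qed

text \<open>The gap is translation invariant, so every ball of radius \<open>\<delta>\<close> is a
  singleton. Continuity into the module thereby becomes local constancy.\<close>

lemma norm_topology_discrete: "norm_topology M (mod_norm M) = discrete_topology (carrier M)"
proof -
  interpret Metric_space "carrier M" "norm_dist M (mod_norm M)"
    by (rule Metric_space_norm_dist)
  obtain \<delta> where \<delta>: "\<delta> > 0" "\<And>x. x \<in> carrier M \<Longrightarrow> x \<noteq> \<zero>\<^bsub>M\<^esub> \<Longrightarrow> \<delta> \<le> mod_norm M x"
    using norm_isolated by blast
  have "mball x \<delta> \<subseteq> {x}" if "x \<in> carrier M" for x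
  proof
    fix y assume "y \<in> mball x \<delta>"
    then have "y \<in> carrier M" "mod_norm M (x \<ominus>\<^bsub>M\<^esub> y) < \<delta>"
      using that by (auto simp: norm_dist_def)
    then show "y \<in> {x}"
      using \<delta>(2)[of "x \<ominus>\<^bsub>M\<^esub> y"] that
      by (metis M.minus_closed M.minus_eq_zero_iff not_less singletonI)
  qed
  then have "openin mtopology {x}" if "x \<in> carrier M" for x
    using that \<delta>(1) by (auto simp: openin_mtopology)
  then show ?thesis
    unfolding norm_topology_def by (metis discrete_topology_unique topspace_mtopology)
qed

lemma banach: "banach_module C R M" and isolated: "isolated_module M"
proof -
  interpret Metric_space "carrier M" "norm_dist M (mod_norm M)"
    by (rule Metric_space_norm_dist)
  show "isolated_module M"
    by (simp add: isolated_at_zero_def norm_topology_discrete)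
  have mcomplete
    unfolding mcomplete_def
  proof safe
    fix s assume s: "MCauchy s"
    then have car: "s n \<in> carrier M" for n
      by (auto simp: MCauchy_def)
    have "\<exists>n0. \<forall>m\<ge>n0. \<forall>n\<ge>n0. mod_norm M (s m \<ominus>\<^bsub>M\<^esub> s n) < e" if "e > 0" for e
      using s that car unfolding MCauchy_def norm_dist_def by auto
    with Cauchy_eventually_constant[of s] car
    obtain x where "x \<in> carrier M" "\<forall>\<^sub>F n in sequentially. s n = x"
      by blast
    then have "limitin mtopology s x sequentially"
      by (intro limitin_eventually) auto
    then show "\<exists>x. limitin mtopology s x sequentially" ..
  qed
  moreover have "ultrametric_norm M (mod_norm M)" if "C = Ab_nA"
    unfolding ultrametric_norm_def
  proof safe
    fix x y z assume *: "x \<in> carrier M" "y \<in> carrier M" "z \<in> carrier M"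
    \<comment> \<open>The 0 comes from \<open>aggregate\<close>, where it covers the empty list;
      nonnegativity of the norms removes it below.\<close>
    then have "mod_norm M (x \<ominus>\<^bsub>M\<^esub> z) \<le> max 0 (max (mod_norm M (x \<ominus>\<^bsub>M\<^esub> y)) (mod_norm M (y \<ominus>\<^bsub>M\<^esub> z)))"
      using minus_via[of x y z] norm_add_le[of "x \<ominus>\<^bsub>M\<^esub> y" "y \<ominus>\<^bsub>M\<^esub> z"] that by simp
    then show "norm_dist M (mod_norm M) x z
        \<le> max (norm_dist M (mod_norm M) x y) (norm_dist M (mod_norm M) y z)"
      using * norm_nonneg[of "x \<ominus>\<^bsub>M\<^esub> y"] by (simp add: norm_dist_def max_absorb2 max.coboundedI1)
  qed
  ultimately have "banach_abelian_group C M (mod_norm M)"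
    unfolding banach_abelian_group_def complete_norm_def
    using M.abelian_group_axioms norm_nonneg Metric_space_norm_dist by blast
  then show "banach_module C R M"
    unfolding banach_module_def using norm_smult_le module_axioms by blast
qed

end

text \<open>An open set around 0 contains a ball, whose radius serves as the gap because the
  distance from 0 is the norm.\<close>

lemma isolated_ball:
  assumes "complete_norm G N" "isolated_at_zero G N" "abelian_group G"
  shows "\<exists>\<delta>>0. \<forall>x\<in>carrier G. x \<noteq> \<zero>\<^bsub>G\<^esub> \<longrightarrow> \<delta> \<le> N x"
proof -
  interpret abelian_group G by fact
  interpret Metric_space "carrier G" "norm_dist G N"
    using assms(1) by (simp add: complete_norm_def)
  obtain \<delta> where \<delta>: "\<delta> > 0" "mball \<zero>\<^bsub>G\<^esub> \<delta> \<subseteq> {\<zero>\<^bsub>G\<^esub>}"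
    using assms(2) by (force simp: isolated_at_zero_def norm_topology_def openin_mtopology)
  have "\<delta> \<le> N x" if x: "x \<in> carrier G" "x \<noteq> \<zero>\<^bsub>G\<^esub>" for x
  proof -
    \<comment> \<open>Literally this distance is the norm of the negative of \<open>x\<close>;
      symmetry of the metric exchanges the two.\<close>
    have "norm_dist G N \<zero>\<^bsub>G\<^esub> x = N x"
      using commute[of "\<zero>\<^bsub>G\<^esub>" x] x(1) by (simp add: norm_dist_def minus_eq a_inv_zero)
    then show ?thesis
      using \<delta>(2) x by (force simp: not_less[symmetric])
  qed
  then show ?thesis
    using \<delta>(1) by blast
qed

text \<open>Only the metric is given, so the norm axioms are read off from it: the norm of 0 is the
  distance from 0 to itself, negation is symmetry of the distance to 0, and the norm of
  \<open>x + y\<close> is the distance from \<open>x\<close> to \<open>- y\<close>, estimated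
  through 0.\<close>

lemma complete_norm_props:
  assumes "banach_abelian_group C G N"
  shows "N \<zero>\<^bsub>G\<^esub> = 0"
    and "x \<in> carrier G \<Longrightarrow> N (\<ominus>\<^bsub>G\<^esub> x) = N x"
    and "x \<in> carrier G \<Longrightarrow> y \<in> carrier G \<Longrightarrow> N (x \<oplus>\<^bsub>G\<^esub> y) \<le> aggregate C [N x, N y]"
    and "x \<in> carrier G \<Longrightarrow> 0 \<le> N x"
proof -
  interpret abelian_group G
    using assms by (simp add: banach_abelian_group_def)
  interpret Metric_space "carrier G" "norm_dist G N"
    using assms by (simp add: banach_abelian_group_def complete_norm_def)
  show "N \<zero>\<^bsub>G\<^esub> = 0"
    using mdist_zero[of "\<zero>\<^bsub>G\<^esub>"] by (simp add: norm_dist_def minus_eq a_inv_zero)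
  show minus: "N (\<ominus>\<^bsub>G\<^esub> x) = N x" if "x \<in> carrier G" for x
    using commute[of "\<zero>\<^bsub>G\<^esub>" x] that by (simp add: norm_dist_def minus_eq a_inv_zero)
  show "N (x \<oplus>\<^bsub>G\<^esub> y) \<le> aggregate C [N x, N y]" if "x \<in> carrier G" "y \<in> carrier G"
  proof (cases C)
    case Ab_A
    then show ?thesis
      using triangle[of x "\<zero>\<^bsub>G\<^esub>" "\<ominus>\<^bsub>G\<^esub> y"] that minus by (simp add: norm_dist_def minus_eq a_inv_zero)
  next
    case Ab_nA
    then have "norm_dist G N x (\<ominus>\<^bsub>G\<^esub> y)
        \<le> max (norm_dist G N x \<zero>\<^bsub>G\<^esub>) (norm_dist G N \<zero>\<^bsub>G\<^esub> (\<ominus>\<^bsub>G\<^esub> y))"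
      using assms that by (simp add: banach_abelian_group_def ultrametric_norm_def)
    then show ?thesis
      using that Ab_nA minus by (simp add: norm_dist_def minus_eq a_inv_zero max.coboundedI2)
  qed
  show "x \<in> carrier G \<Longrightarrow> 0 \<le> N x"
    using assms by (simp add: banach_abelian_group_def complete_norm_def)
qed

lemma isolated_normed_moduleI:
  assumes "banach_ring C R" "banach_module C R M" "isolated_module M"
  shows "isolated_normed_module C R M"
proof -
  have gM: "banach_abelian_group C M (mod_norm M)" and gR: "banach_abelian_group C R (ring_norm R)"
    using assms by (auto simp: banach_module_def banach_ring_def)
  interpret module R M
    using assms by (simp add: banach_module_def)
  obtain K where K: "\<And>a x. a \<in> carrier R \<Longrightarrow> x \<in> carrier M \<Longrightarrow>
      mod_norm M (a \<odot>\<^bsub>M\<^esub> x) \<le> K * ring_norm R a * mod_norm M x"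
    using assms(2) unfolding banach_module_def by blast
  \<comment> \<open>The constant in \<open>banach_module\<close> may be negative, whereas the locale
    asks for a nonnegative one.\<close>
  have "mod_norm M (a \<odot>\<^bsub>M\<^esub> x) \<le> max K 0 * ring_norm R a * mod_norm M x"
    if "a \<in> carrier R" "x \<in> carrier M" for a x
    using K[OF that] complete_norm_props(4)[OF gM that(2)] complete_norm_props(4)[OF gR that(1)]
    by (meson max.cobounded1 mult_right_mono order_trans)
  then have "\<exists>K\<ge>0. \<forall>a\<in>carrier R. \<forall>x\<in>carrier M.
      mod_norm M (a \<odot>\<^bsub>M\<^esub> x) \<le> K * ring_norm R a * mod_norm M x"
    by (meson max.cobounded2)
  then show ?thesis
    using complete_norm_props[OF gM] complete_norm_props(4)[OF gR] isolated_ball[OF _ assms(3)] gM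
    by unfold_locales (auto simp: banach_abelian_group_def)
qed

section \<open>Completion\<close>

context seminormed_module
begin

lemma norm_diff_le:
  assumes "x \<in> carrier M" "y \<in> carrier M"
  shows "\<bar>mod_norm M x - mod_norm M y\<bar> \<le> mod_norm M (x \<ominus>\<^bsub>M\<^esub> y)"
proof -
  have *: "mod_norm M x \<le> mod_norm M (x \<ominus>\<^bsub>M\<^esub> y) + mod_norm M y"
    if "x \<in> carrier M" "y \<in> carrier M" for x y
    using norm_triangle[of "x \<ominus>\<^bsub>M\<^esub> y" y] that by (simp add: M.minus_eq M.a_assoc M.l_neg)
  show ?thesis
    using *[OF assms] *[OF assms(2,1)] norm_minus_commute[OF assms] by linarith
qed

lemma const_cauchy_seqs: "x \<in> carrier M \<Longrightarrow> (\<lambda>_. x) \<in> cauchy_seqs M"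
  by (simp add: cauchy_seqs_def M.minus_eq M.r_neg)

lemma cauchy_class_self: "s \<in> cauchy_seqs M \<Longrightarrow> s \<in> cauchy_class M s"
  by (simp add: cauchy_class_def cauchy_seqs_def M.minus_eq M.r_neg)

lemma completion_norm_tendsto:
  assumes s: "s \<in> cauchy_seqs M"
  shows "(\<lambda>n. mod_norm M (s n)) \<longlonglongrightarrow> mod_norm (completion M) (cauchy_class M s)"
proof -
  have car: "s n \<in> carrier M" for n
    using s by (simp add: cauchy_seqs_def)
  have "Cauchy (\<lambda>n. mod_norm M (s n))"
  proof (rule metric_CauchyI)
    fix e :: real assume "e > 0"
    then obtain n0 where n0: "\<And>m n. m \<ge> n0 \<Longrightarrow> n \<ge> n0 \<Longrightarrow> mod_norm M (s m \<ominus>\<^bsub>M\<^esub> s n) < e"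
      using s unfolding cauchy_seqs_def by blast
    have "dist (mod_norm M (s m)) (mod_norm M (s n)) < e" if "m \<ge> n0" "n \<ge> n0" for m n
      using n0[OF that] norm_diff_le[OF car car, of m n] by (simp add: dist_real_def)
    then show "\<exists>M'. \<forall>m\<ge>M'. \<forall>n\<ge>M'. dist (mod_norm M (s m)) (mod_norm M (s n)) < e"
      by blast
  qed
  then obtain l where l: "(\<lambda>n. mod_norm M (s n)) \<longlonglongrightarrow> l"
    using Cauchy_convergent convergent_def by blast
  have "l' = l" if "t \<in> cauchy_class M s" "(\<lambda>n. mod_norm M (t n)) \<longlonglongrightarrow> l'" for t l'
  proof -
    have t: "t n \<in> carrier M" for n
      using that(1) by (simp add: cauchy_class_def cauchy_seqs_def)
    have "(\<lambda>n. mod_norm M (t n \<ominus>\<^bsub>M\<^esub> s n)) \<longlonglongrightarrow> 0"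
      using that(1) by (simp add: cauchy_class_def)
    then have "(\<lambda>n. mod_norm M (t n) - mod_norm M (s n)) \<longlonglongrightarrow> 0"
      by (rule Lim_null_comparison[rotated]) (simp add: norm_diff_le t car)
    moreover have "(\<lambda>n. mod_norm M (t n) - mod_norm M (s n)) \<longlonglongrightarrow> l' - l"
      by (rule tendsto_diff[OF that(2) l])
    ultimately show ?thesis
      using LIMSEQ_unique by fastforce
  qed
  then have "(THE l. \<exists>t\<in>cauchy_class M s. (\<lambda>n. mod_norm M (t n)) \<longlonglongrightarrow> l) = l"
    using l cauchy_class_self[OF s] by (intro the_equality) blast+
  then show ?thesis
    using l by (simp add: completion_def)
qed

end

text \<open>Since the target is discrete, the image of a Cauchy sequence is eventually constant.\<close>

lemma completion_extend_eventually:
  assumes V: "seminormed_module C R V" and W: "isolated_normed_module C R W"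
    and closed: "\<And>x. x \<in> carrier V \<Longrightarrow> f x \<in> carrier W"
    and add: "\<And>x y. x \<in> carrier V \<Longrightarrow> y \<in> carrier V \<Longrightarrow> f (x \<oplus>\<^bsub>V\<^esub> y) = f x \<oplus>\<^bsub>W\<^esub> f y"
    and bounded: "\<And>x. x \<in> carrier V \<Longrightarrow> mod_norm W (f x) \<le> K * mod_norm V x"
    and s: "s \<in> cauchy_seqs V"
  shows "\<forall>\<^sub>F n in sequentially. f (s n) = completion_extend W f (cauchy_class V s)"
proof -
  interpret V: seminormed_module C R V by fact
  interpret W: isolated_normed_module C R W by fact
  have car: "s n \<in> carrier V" for n
    using s by (simp add: cauchy_seqs_def)
  have zero: "f \<zero>\<^bsub>V\<^esub> = \<zero>\<^bsub>W\<^esub>"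
    using add[of "\<zero>\<^bsub>V\<^esub>" "\<zero>\<^bsub>V\<^esub>"] closed[of "\<zero>\<^bsub>V\<^esub>"] by (metis V.M.l_zero V.M.zero_closed W.M.add.l_cancel_one')
  have diff: "f (x \<ominus>\<^bsub>V\<^esub> y) = f x \<ominus>\<^bsub>W\<^esub> f y" if "x \<in> carrier V" "y \<in> carrier V" for x y
  proof -
    have "f (\<ominus>\<^bsub>V\<^esub> y) \<oplus>\<^bsub>W\<^esub> f y = \<zero>\<^bsub>W\<^esub>"
      using add[of "\<ominus>\<^bsub>V\<^esub> y" y] that zero by (simp add: V.M.l_neg)
    then have "\<ominus>\<^bsub>W\<^esub> f y = f (\<ominus>\<^bsub>V\<^esub> y)"
      using that closed by (intro W.M.minus_equality) auto
    then show ?thesis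
      using that add[of x "\<ominus>\<^bsub>V\<^esub> y"] by (simp add: V.M.minus_eq W.M.minus_eq)
  qed
  have "\<exists>w\<in>carrier W. \<forall>\<^sub>F n in sequentially. f (s n) = w"
  proof (rule W.Cauchy_eventually_constant)
    fix e :: real assume "e > 0"
    \<comment> \<open>The denominator has to be positive whatever the sign of
      \<open>K\<close>.\<close>
    then have "e / (\<bar>K\<bar> + 1) > 0"
      by (intro divide_pos_pos) auto
    then obtain n0 where n0: "\<And>m n. m \<ge> n0 \<Longrightarrow> n \<ge> n0 \<Longrightarrow> mod_norm V (s m \<ominus>\<^bsub>V\<^esub> s n) < e / (\<bar>K\<bar> + 1)"
      using s unfolding cauchy_seqs_def by blast
    have "mod_norm W (f (s m) \<ominus>\<^bsub>W\<^esub> f (s n)) < e" if "m \<ge> n0" "n \<ge> n0" for m n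
    proof -
      have nn: "0 \<le> mod_norm V (s m \<ominus>\<^bsub>V\<^esub> s n)"
        using car by (simp add: V.norm_nonneg)
      have "mod_norm W (f (s m) \<ominus>\<^bsub>W\<^esub> f (s n)) \<le> K * mod_norm V (s m \<ominus>\<^bsub>V\<^esub> s n)"
        using bounded[of "s m \<ominus>\<^bsub>V\<^esub> s n"] car diff by simp
      also have "\<dots> \<le> (\<bar>K\<bar> + 1) * mod_norm V (s m \<ominus>\<^bsub>V\<^esub> s n)"
        using nn by (intro mult_right_mono) auto
      also have "\<dots> < e"
        using n0[OF that] by (simp add: field_simps)
      finally show ?thesis .
    qed
    then show "\<exists>n0. \<forall>m\<ge>n0. \<forall>n\<ge>n0. mod_norm W (f (s m) \<ominus>\<^bsub>W\<^esub> f (s n)) < e"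
      by blast
  qed (simp add: closed car)
  then obtain w where w: "w \<in> carrier W" "\<forall>\<^sub>F n in sequentially. f (s n) = w"
    by blast
  let ?T = "norm_topology W (mod_norm W)"
  \<comment> \<open>Uniqueness over all representatives: a null difference is sent to a null
    sequence, so the two image sequences eventually coincide, and a limit in a discrete space is
    eventually attained.\<close>
  have "w' = w" if "t \<in> cauchy_class V s" "limitin ?T (\<lambda>n. f (t n)) w' sequentially" for t w'
  proof -
    have t: "t n \<in> carrier V" for n
      using that(1) by (simp add: cauchy_class_def cauchy_seqs_def)
    have "(\<lambda>n. mod_norm V (t n \<ominus>\<^bsub>V\<^esub> s n)) \<longlonglongrightarrow> 0"
      using that(1) by (simp add: cauchy_class_def)
    then have "(\<lambda>n. \<bar>K\<bar> * mod_norm V (t n \<ominus>\<^bsub>V\<^esub> s n)) \<longlonglongrightarrow> 0"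
      by (rule tendsto_mult_right_zero)
    moreover have "norm (mod_norm W (f (t n) \<ominus>\<^bsub>W\<^esub> f (s n))) \<le> \<bar>K\<bar> * mod_norm V (t n \<ominus>\<^bsub>V\<^esub> s n)" for n
    proof -
      have "mod_norm W (f (t n) \<ominus>\<^bsub>W\<^esub> f (s n)) \<le> K * mod_norm V (t n \<ominus>\<^bsub>V\<^esub> s n)"
        using bounded[of "t n \<ominus>\<^bsub>V\<^esub> s n"] car t diff by simp
      also have "\<dots> \<le> \<bar>K\<bar> * mod_norm V (t n \<ominus>\<^bsub>V\<^esub> s n)"
        using car t by (intro mult_right_mono) (auto simp: V.norm_nonneg)
      finally show ?thesis
        using W.norm_nonneg[of "f (t n) \<ominus>\<^bsub>W\<^esub> f (s n)"] closed car t by simp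
    qed
    ultimately have "(\<lambda>n. mod_norm W (f (t n) \<ominus>\<^bsub>W\<^esub> f (s n))) \<longlonglongrightarrow> 0"
      using Lim_null_comparison by (metis (no_types, lifting) always_eventually)
    then have "\<forall>\<^sub>F n in sequentially. f (t n) = f (s n)"
      by (intro W.eventually_equalI) (auto simp: closed car t)
    moreover have "\<forall>\<^sub>F n in sequentially. f (t n) \<in> {w'}"
      using that(2) limitin_topspace[OF that(2)] by (intro limitinD) (auto simp: W.norm_topology_discrete)
    ultimately have "\<forall>\<^sub>F n::nat in sequentially. w' = w"
      using w(2) by eventually_elim auto
    then show ?thesis
      by simp
  qed
  moreover have "limitin ?T (\<lambda>n. f (s n)) w sequentially"
    using w by (intro limitin_eventually) (auto simp: W.norm_topology_discrete)
  ultimately have "completion_extend W f (cauchy_class V s) = w"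
    unfolding completion_extend_def using V.cauchy_class_self[OF s] by (intro the_equality) blast+
  then show ?thesis
    using w(2) by simp
qed

text \<open>Serves to equip completions with their structure: their operations are unions over
  classes, and checking the module axioms on these directly is avoided.\<close>

lemma isolated_normed_module_transport:
  fixes V :: "('r, 'm) normed_module" and W :: "('r, 'n) normed_module"
  assumes V: "isolated_normed_module C R V"
    and bij: "bij_betw \<tau> (carrier V) (carrier W)"
    and zero: "\<tau> \<zero>\<^bsub>V\<^esub> = \<zero>\<^bsub>W\<^esub>"
    and add: "\<And>x y. x \<in> carrier V \<Longrightarrow> y \<in> carrier V \<Longrightarrow> \<tau> (x \<oplus>\<^bsub>V\<^esub> y) = \<tau> x \<oplus>\<^bsub>W\<^esub> \<tau> y"
    and smult: "\<And>a x. a \<in> carrier R \<Longrightarrow> x \<in> carrier V \<Longrightarrow> \<tau> (a \<odot>\<^bsub>V\<^esub> x) = a \<odot>\<^bsub>W\<^esub> \<tau> x"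
    and norm: "\<And>x. x \<in> carrier V \<Longrightarrow> mod_norm W (\<tau> x) = mod_norm V x"
  shows "isolated_normed_module C R W"
proof -
  interpret V: isolated_normed_module C R V by fact
  have img: "carrier W = \<tau> ` carrier V"
    using bij by (simp add: bij_betw_def)
  have inj: "\<tau> x = \<tau> y \<longleftrightarrow> x = y" if "x \<in> carrier V" "y \<in> carrier V" for x y
    using bij that by (auto simp: bij_betw_def inj_on_def)
  \<comment> \<open>Read backwards, the homomorphism laws pull every identity between images of
    \<open>\<tau>\<close> back to \<open>V\<close>.\<close>
  note t = zero[symmetric] add[symmetric] smult[symmetric]
  interpret W: abelian_group W
  proof (rule abelian_groupI)
    fix x assume "x \<in> carrier W"
    then obtain u where u: "u \<in> carrier V" "x = \<tau> u" by (auto simp: img)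
    then show "\<exists>y\<in>carrier W. y \<oplus>\<^bsub>W\<^esub> x = \<zero>\<^bsub>W\<^esub>"
      by (intro bexI[of _ "\<tau> (\<ominus>\<^bsub>V\<^esub> u)"]) (auto simp: img t V.M.l_neg)
  qed (auto simp: img t V.M.a_ac)
  have module: "Module.module R W"
  proof (rule moduleI)
    show "cring R" by (rule V.is_cring)
    show "abelian_group W" by (rule W.abelian_group_axioms)
  qed (auto simp: img t V.smult_l_distr V.smult_r_distr V.smult_assoc1)
  interpret W: module R W by fact
  have minus: "\<ominus>\<^bsub>W\<^esub> \<tau> u = \<tau> (\<ominus>\<^bsub>V\<^esub> u)" if "u \<in> carrier V" for u
    using that by (intro W.minus_equality) (auto simp: img t V.M.l_neg)
  obtain K where K: "K \<ge> 0" "\<And>a x. a \<in> carrier R \<Longrightarrow> x \<in> carrier V \<Longrightarrow>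
      mod_norm V (a \<odot>\<^bsub>V\<^esub> x) \<le> K * ring_norm R a * mod_norm V x"
    using V.norm_smult_le by blast
  obtain \<delta> where \<delta>: "\<delta> > 0" "\<And>x. x \<in> carrier V \<Longrightarrow> x \<noteq> \<zero>\<^bsub>V\<^esub> \<Longrightarrow> \<delta> \<le> mod_norm V x"
    using V.norm_isolated by blast
  show ?thesis
  proof
    show "\<exists>K\<ge>0. \<forall>a\<in>carrier R. \<forall>x\<in>carrier W. mod_norm W (a \<odot>\<^bsub>W\<^esub> x) \<le> K * ring_norm R a * mod_norm W x"
      using K by (intro exI[of _ K]) (auto simp: img t norm)
    show "\<exists>\<delta>>0. \<forall>x\<in>carrier W. x \<noteq> \<zero>\<^bsub>W\<^esub> \<longrightarrow> \<delta> \<le> mod_norm W x"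
      using \<delta> by (intro exI[of _ \<delta>]) (auto simp: img t norm inj)
  next
    fix x y assume "x \<in> carrier W" "y \<in> carrier W"
    then obtain u v where "u \<in> carrier V" "x = \<tau> u" "v \<in> carrier V" "y = \<tau> v"
      by (auto simp: img)
    then show "mod_norm W (x \<oplus>\<^bsub>W\<^esub> y) \<le> aggregate C [mod_norm W x, mod_norm W y]"
      using V.norm_add_le[of u v] by (simp del: aggregate.simps add: t norm)
  qed (auto simp: img t norm minus V.norm_nonneg V.norm_minus V.ring_norm_nonneg)
qed

section \<open>The completion of an isolated module is the module itself\<close>

context isolated_normed_module
begin

lemma cauchy_seqs_iff:
  "s \<in> cauchy_seqs M \<longleftrightarrow> (\<forall>n. s n \<in> carrier M) \<and> (\<exists>x\<in>carrier M. \<forall>\<^sub>F n in sequentially. s n = x)"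
proof
  assume "s \<in> cauchy_seqs M"
  then show "(\<forall>n. s n \<in> carrier M) \<and> (\<exists>x\<in>carrier M. \<forall>\<^sub>F n in sequentially. s n = x)"
    using Cauchy_eventually_constant[of s] unfolding cauchy_seqs_def by blast
next
  assume *: "(\<forall>n. s n \<in> carrier M) \<and> (\<exists>x\<in>carrier M. \<forall>\<^sub>F n in sequentially. s n = x)"
  then obtain x n0 where "x \<in> carrier M" "\<And>n. n \<ge> n0 \<Longrightarrow> s n = x"
    by (auto simp: eventually_sequentially)
  then have "\<forall>e>0. \<exists>n0. \<forall>m\<ge>n0. \<forall>n\<ge>n0. mod_norm M (s m \<ominus>\<^bsub>M\<^esub> s n) < e"
    by (intro allI impI exI[of _ n0]) (simp add: M.minus_eq M.r_neg)
  then show "s \<in> cauchy_seqs M"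
    using * by (simp add: cauchy_seqs_def)
qed

text \<open>By the gap, a null difference means eventual equality, so a class depends on the
  eventual value alone.\<close>

lemma cauchy_class_eq:
  assumes x: "x \<in> carrier M" and s: "s \<in> cauchy_seqs M" "\<forall>\<^sub>F n in sequentially. s n = x"
  shows "cauchy_class M s = {t. (\<forall>n. t n \<in> carrier M) \<and> (\<forall>\<^sub>F n in sequentially. t n = x)}"
proof (intro equalityI subsetI CollectI conjI)
  fix t assume t: "t \<in> cauchy_class M s"
  then show "\<forall>n. t n \<in> carrier M"
    by (simp add: cauchy_class_def cauchy_seqs_def)
  then have "\<forall>\<^sub>F n in sequentially. t n = s n"
    using s(1) t by (intro eventually_equalI) (auto simp: cauchy_class_def cauchy_seqs_def)
  then show "\<forall>\<^sub>F n in sequentially. t n = x"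
    using s(2) by eventually_elim auto
next
  fix t assume "t \<in> {t. (\<forall>n. t n \<in> carrier M) \<and> (\<forall>\<^sub>F n in sequentially. t n = x)}"
  then have t: "\<And>n. t n \<in> carrier M" "\<forall>\<^sub>F n in sequentially. t n = x"
    by auto
  have "\<forall>\<^sub>F n in sequentially. mod_norm M (t n \<ominus>\<^bsub>M\<^esub> s n) = 0"
    using t(2) s(2) by eventually_elim (use x in \<open>simp add: M.minus_eq M.r_neg\<close>)
  then have "(\<lambda>n. mod_norm M (t n \<ominus>\<^bsub>M\<^esub> s n)) \<longlonglongrightarrow> 0"
    by (rule tendsto_eventually)
  then show "t \<in> cauchy_class M s"
    using t x by (auto simp: cauchy_class_def cauchy_seqs_iff)
qed

lemma to_completion_eq:
  assumes "x \<in> carrier M"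
  shows "to_completion M x = {t. (\<forall>n. t n \<in> carrier M) \<and> (\<forall>\<^sub>F n in sequentially. t n = x)}"
  unfolding to_completion_def by (rule cauchy_class_eq) (use assms const_cauchy_seqs in auto)

lemma cauchy_class_to_completion:
  assumes "x \<in> carrier M" "\<And>n. s n \<in> carrier M" "\<forall>\<^sub>F n in sequentially. s n = x"
  shows "cauchy_class M s = to_completion M x"
  using assms by (subst cauchy_class_eq[of x]) (auto simp: cauchy_seqs_iff to_completion_eq)

text \<open>Surjective because every Cauchy sequence is eventually constant, injective because the
  constant sequence inside a class recovers the eventual value.\<close>

lemma to_completion_bij: "bij_betw (to_completion M) (carrier M) (carrier (completion M))"
  unfolding bij_betw_def
proof
  show "inj_on (to_completion M) (carrier M)"
  proof (rule inj_onI)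
    fix x y assume xy: "x \<in> carrier M" "y \<in> carrier M" "to_completion M x = to_completion M y"
    have "(\<lambda>_. x) \<in> to_completion M x"
      using xy(1) by (simp add: to_completion_eq)
    then have "(\<lambda>_. x) \<in> to_completion M y"
      using xy(3) by simp
    then show "x = y"
      using xy(2) by (simp add: to_completion_eq)
  qed
  show "to_completion M ` carrier M = carrier (completion M)"
  proof (intro equalityI subsetI)
    fix S assume "S \<in> carrier (completion M)"
    then obtain s where s: "s \<in> cauchy_seqs M" "S = cauchy_class M s"
      by (auto simp: completion_def)
    then obtain x where "x \<in> carrier M" "\<forall>\<^sub>F n in sequentially. s n = x"
      by (auto simp: cauchy_seqs_iff)
    then show "S \<in> to_completion M ` carrier M"
      using s cauchy_class_to_completion[of x s] by (auto simp: cauchy_seqs_iff)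
  qed (auto simp: completion_def to_completion_def const_cauchy_seqs)
qed

lemma const_in_to_completion: "x \<in> carrier M \<Longrightarrow> (\<lambda>_. x) \<in> to_completion M x"
  by (simp add: to_completion_eq)

lemma to_completion_add:
  assumes "x \<in> carrier M" "y \<in> carrier M"
  shows "to_completion M (x \<oplus>\<^bsub>M\<^esub> y) = to_completion M x \<oplus>\<^bsub>completion M\<^esub> to_completion M y"
proof -
  have "cauchy_class M (\<lambda>n. s n \<oplus>\<^bsub>M\<^esub> t n) = to_completion M (x \<oplus>\<^bsub>M\<^esub> y)"
    if st: "s \<in> to_completion M x" "t \<in> to_completion M y" for s t
  proof (rule cauchy_class_to_completion)
    have "\<forall>\<^sub>F n in sequentially. s n = x" "\<forall>\<^sub>F n in sequentially. t n = y"
      using st assms by (auto simp: to_completion_eq)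
    then show "\<forall>\<^sub>F n in sequentially. s n \<oplus>\<^bsub>M\<^esub> t n = x \<oplus>\<^bsub>M\<^esub> y"
      by eventually_elim auto
  qed (use st assms in \<open>auto simp: to_completion_eq\<close>)
  \<comment> \<open>All sets in the union coincide; the constant representatives show that the index
    sets are inhabited.\<close>
  then have "(\<Union>s\<in>to_completion M x. \<Union>t\<in>to_completion M y. cauchy_class M (\<lambda>n. s n \<oplus>\<^bsub>M\<^esub> t n))
      = to_completion M (x \<oplus>\<^bsub>M\<^esub> y)"
    using const_in_to_completion[OF assms(1)] const_in_to_completion[OF assms(2)]
    by (intro SUP_eq_const) auto
  then show ?thesis
    by (simp add: completion_def)
qed

lemma to_completion_smult:
  assumes "a \<in> carrier R" "x \<in> carrier M"
  shows "to_completion M (a \<odot>\<^bsub>M\<^esub> x) = a \<odot>\<^bsub>completion M\<^esub> to_completion M x"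
proof -
  have "cauchy_class M (\<lambda>n. a \<odot>\<^bsub>M\<^esub> s n) = to_completion M (a \<odot>\<^bsub>M\<^esub> x)"
    if s: "s \<in> to_completion M x" for s
  proof (rule cauchy_class_to_completion)
    have "\<forall>\<^sub>F n in sequentially. s n = x"
      using s assms by (auto simp: to_completion_eq)
    then show "\<forall>\<^sub>F n in sequentially. a \<odot>\<^bsub>M\<^esub> s n = a \<odot>\<^bsub>M\<^esub> x"
      by eventually_elim auto
  qed (use s assms in \<open>auto simp: to_completion_eq\<close>)
  then have "(\<Union>s\<in>to_completion M x. cauchy_class M (\<lambda>n. a \<odot>\<^bsub>M\<^esub> s n)) = to_completion M (a \<odot>\<^bsub>M\<^esub> x)"
    using const_in_to_completion assms by (intro SUP_eq_const) auto
  then show ?thesis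
    by (simp add: completion_def)
qed

lemma to_completion_zero: "to_completion M \<zero>\<^bsub>M\<^esub> = \<zero>\<^bsub>completion M\<^esub>"
  by (simp add: completion_def to_completion_def)

lemma to_completion_norm:
  assumes "x \<in> carrier M"
  shows "mod_norm (completion M) (to_completion M x) = mod_norm M x"
  using completion_norm_tendsto[OF const_cauchy_seqs[OF assms]]
  by (simp add: to_completion_def LIMSEQ_const_iff)

lemma completion_isolated_normed: "isolated_normed_module C R (completion M)"
  by (rule isolated_normed_module_transport[OF isolated_normed_module_axioms to_completion_bij])
    (simp_all add: to_completion_zero to_completion_add to_completion_smult to_completion_norm)

end

text \<open>The extension by continuity is thus \<open>f\<close> transported along the bijection
  \<open>to_completion\<close>; this is how \<open>A_map\<close> reduces to
  \<open>alg_nat_map\<close>.\<close>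

lemma completion_extend_to_completion:
  assumes V: "isolated_normed_module C R V" and W: "isolated_normed_module C R W"
    and lin: "R_linear R V W f"
    and bounded: "\<And>x. x \<in> carrier V \<Longrightarrow> mod_norm W (f x) \<le> K * mod_norm V x"
    and x: "x \<in> carrier V"
  shows "completion_extend W f (to_completion V x) = f x"
proof -
  interpret V: isolated_normed_module C R V by fact
  have "\<forall>\<^sub>F n in sequentially. f x = completion_extend W f (cauchy_class V (\<lambda>_. x))"
    by (rule completion_extend_eventually[OF V.seminormed_module_axioms W])
      (use lin bounded V.const_cauchy_seqs x in \<open>auto simp: R_linear_def\<close>)
  then show ?thesis
    by (simp add: to_completion_def)
qed

section \<open>The algebraic tensor product\<close>

text \<open>Lists rather than elements of the free group, because both the tensor norm and
  \<open>tensor_lift\<close> are defined through presentations.\<close>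

definition tensor_sum ::
    "'r normed_ring \<Rightarrow> ('r, 'm) normed_module \<Rightarrow> ('r, 'n) normed_module \<Rightarrow>
     ('m \<times> 'n) list \<Rightarrow> (('m \<times> 'n) \<Rightarrow>\<^sub>0 int) set" where
  "tensor_sum R M N ps = tensor_class R M N (sum_list (map frag_of ps))"

text \<open>Only the additive structure of the target enters. It can therefore be a module, such as
  another tensor product or a space of maps, or the ring itself as for the coordinate functionals on
  the diagonal.\<close>

definition balanced ::
    "'r normed_ring \<Rightarrow> ('r, 'm) normed_module \<Rightarrow> ('r, 'n) normed_module \<Rightarrow>
     ('w, 'z) ring_scheme \<Rightarrow> ('m \<Rightarrow> 'n \<Rightarrow> 'w) \<Rightarrow> bool" where
  "balanced R M N W B \<longleftrightarrow>
     (\<forall>x\<in>carrier M. \<forall>y\<in>carrier N. B x y \<in> carrier W) \<and>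
     (\<forall>x\<in>carrier M. \<forall>x'\<in>carrier M. \<forall>y\<in>carrier N. B (x \<oplus>\<^bsub>M\<^esub> x') y = B x y \<oplus>\<^bsub>W\<^esub> B x' y) \<and>
     (\<forall>x\<in>carrier M. \<forall>y\<in>carrier N. \<forall>y'\<in>carrier N. B x (y \<oplus>\<^bsub>N\<^esub> y') = B x y \<oplus>\<^bsub>W\<^esub> B x y') \<and>
     (\<forall>a\<in>carrier R. \<forall>x\<in>carrier M. \<forall>y\<in>carrier N. B (a \<odot>\<^bsub>M\<^esub> x) y = B x (a \<odot>\<^bsub>N\<^esub> y))"

lemma presents_iff:
  "presents R M N ps T \<longleftrightarrow> set ps \<subseteq> carrier M \<times> carrier N \<and> T = tensor_sum R M N ps"
  by (simp add: presents_def tensor_sum_def)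

locale module_pair =
  fixes R :: "'r normed_ring" and M :: "('r, 'm) normed_module" and N :: "('r, 'n) normed_module"
  assumes module_left: "Module.module R M" and module_right: "Module.module R N"
begin

sublocale M: module R M by (rule module_left)
sublocale N: module R N by (rule module_right)

abbreviation "ten \<equiv> tensor_sum R M N"

lemma comm_group_tensor_free: "comm_group (tensor_free M N)"
  by (simp add: tensor_free_def abelian_free_Abelian_group)

sublocale F: comm_group "tensor_free M N"
  by (rule comm_group_tensor_free)

lemma tensor_free_simps [simp]:
  "c \<in> carrier (tensor_free M N) \<longleftrightarrow> Poly_Mapping.keys c \<subseteq> carrier M \<times> carrier N"
  "c \<otimes>\<^bsub>tensor_free M N\<^esub> d = c + d"
  "\<one>\<^bsub>tensor_free M N\<^esub> = 0"
  by (simp_all add: tensor_free_def)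

lemma tensor_relations_carrier: "tensor_relations R M N \<subseteq> carrier (tensor_free M N)"
proof -
  have "Poly_Mapping.keys (frag_of p - frag_of q - frag_of r) \<subseteq> {p, q, r}"
    "Poly_Mapping.keys (frag_of p - frag_of q) \<subseteq> {p, q}" for p q r :: "'m \<times> 'n"
    using keys_diff[of "frag_of p - frag_of q" "frag_of r"] keys_diff[of "frag_of p" "frag_of q"] by auto
  note this[THEN subsetD, dest!]
  show ?thesis
    unfolding tensor_relations_def by auto
qed

lemma relation_keys: "c \<in> tensor_relations R M N \<Longrightarrow> Poly_Mapping.keys c \<subseteq> carrier M \<times> carrier N"
  using tensor_relations_carrier tensor_free_simps(1) by blast

lemma kernel_subgroup: "subgroup (tensor_kernel R M N) (tensor_free M N)"
  unfolding tensor_kernel_def by (rule F.generate_is_subgroup[OF tensor_relations_carrier])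

lemma kernel_normal: "tensor_kernel R M N \<lhd> tensor_free M N"
  by (rule F.subgroup_imp_normal[OF kernel_subgroup])

lemma kernel_carrier: "c \<in> tensor_kernel R M N \<Longrightarrow> Poly_Mapping.keys c \<subseteq> carrier M \<times> carrier N"
  using subgroup.subset[OF kernel_subgroup] tensor_free_simps(1) by blast

lemma kernel_zero: "0 \<in> tensor_kernel R M N"
  using subgroup.one_closed[OF kernel_subgroup] by simp

lemma kernel_add: "c \<in> tensor_kernel R M N \<Longrightarrow> d \<in> tensor_kernel R M N \<Longrightarrow> c + d \<in> tensor_kernel R M N"
  using subgroup.m_closed[OF kernel_subgroup] by simp

lemma kernel_minus: "c \<in> tensor_kernel R M N \<Longrightarrow> - c \<in> tensor_kernel R M N"
  using subgroup.m_inv_closed[OF kernel_subgroup, of c] kernel_carrier[of c] by (simp add: tensor_free_def)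

lemma kernel_diff: "c \<in> tensor_kernel R M N \<Longrightarrow> d \<in> tensor_kernel R M N \<Longrightarrow> c - d \<in> tensor_kernel R M N"
  using kernel_add[of c "- d"] kernel_minus[of d] by simp

lemma relation_in_kernel: "c \<in> tensor_relations R M N \<Longrightarrow> c \<in> tensor_kernel R M N"
  unfolding tensor_kernel_def by (rule generate.incl)

text \<open>The inverses that occur in \<open>generate\<close> are group inverses of relations; they
  are plain negatives because relations lie in the carrier of the free group.\<close>

lemma kernel_induct [consumes 1, case_names relation zero add minus]:
  assumes "c \<in> tensor_kernel R M N"
    and "\<And>c. c \<in> tensor_relations R M N \<Longrightarrow> P c" "P 0"
    and "\<And>c d. P c \<Longrightarrow> P d \<Longrightarrow> P (c + d)" "\<And>c. P c \<Longrightarrow> P (- c)"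
  shows "P c"
proof -
  have "c \<in> generate (tensor_free M N) (tensor_relations R M N)"
    using assms(1) by (simp add: tensor_kernel_def)
  then show ?thesis
  proof induction
    case (inv h)
    then show ?case
      using assms(2,5) tensor_relations_carrier by (auto simp: tensor_free_def)
  qed (use assms in auto)
qed

lemma mem_tensor_class: "d \<in> tensor_class R M N c \<longleftrightarrow> d - c \<in> tensor_kernel R M N"
proof -
  have "d \<in> tensor_class R M N c \<longleftrightarrow> (\<exists>k\<in>tensor_kernel R M N. d = k + c)"
    by (simp add: tensor_class_def r_coset_def)
  then show ?thesis
    by (metis add_diff_cancel_right' diff_add_cancel)
qed

text \<open>Equality of tensors becomes membership of a difference in the kernel, where it can be
  treated by adding relations.\<close>

lemma tensor_class_eq_iff: "tensor_class R M N c = tensor_class R M N d \<longleftrightarrow> c - d \<in> tensor_kernel R M N"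
proof
  assume "tensor_class R M N c = tensor_class R M N d"
  then show "c - d \<in> tensor_kernel R M N"
    using mem_tensor_class[of c c] mem_tensor_class[of c d] kernel_zero by simp
next
  assume *: "c - d \<in> tensor_kernel R M N"
  have "e - c \<in> tensor_kernel R M N \<longleftrightarrow> e - d \<in> tensor_kernel R M N" for e
  proof -
    have "e - d = (e - c) + (c - d)" "e - c = (e - d) - (c - d)"
      by simp_all
    then show ?thesis
      using kernel_add[OF _ *, of "e - c"] kernel_diff[OF _ *, of "e - d"] by metis
  qed
  then show "tensor_class R M N c = tensor_class R M N d"
    by (auto simp: mem_tensor_class)
qed

lemma keys_sum_list_frag_of:
  "Poly_Mapping.keys (sum_list (map frag_of ps)) \<subseteq> set ps"
proof (induction ps)
  case (Cons p ps)
  then show ?case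
    using keys_add[of "frag_of p" "sum_list (map frag_of ps)"] by auto
qed simp

lemma keys_sum_list_frag_of_subset:
  "set ps \<subseteq> A \<Longrightarrow> Poly_Mapping.keys (sum_list (map frag_of ps)) \<subseteq> A"
  using keys_sum_list_frag_of by (rule order_trans)

lemma tensor_sum_eq_iff:
  "ten ps = ten qs \<longleftrightarrow>
    sum_list (map frag_of ps) - sum_list (map frag_of qs) \<in> tensor_kernel R M N"
  by (simp add: tensor_sum_def tensor_class_eq_iff)

lemma relation_add_left:
  "x \<in> carrier M \<Longrightarrow> x' \<in> carrier M \<Longrightarrow> y \<in> carrier N \<Longrightarrow>
    frag_of (x \<oplus>\<^bsub>M\<^esub> x', y) - frag_of (x, y) - frag_of (x', y) \<in> tensor_kernel R M N"
  by (rule relation_in_kernel) (auto simp: tensor_relations_def)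

lemma relation_add_right:
  "x \<in> carrier M \<Longrightarrow> y \<in> carrier N \<Longrightarrow> y' \<in> carrier N \<Longrightarrow>
    frag_of (x, y \<oplus>\<^bsub>N\<^esub> y') - frag_of (x, y) - frag_of (x, y') \<in> tensor_kernel R M N"
  by (rule relation_in_kernel) (auto simp: tensor_relations_def)

lemma relation_smult:
  "a \<in> carrier R \<Longrightarrow> x \<in> carrier M \<Longrightarrow> y \<in> carrier N \<Longrightarrow>
    frag_of (a \<odot>\<^bsub>M\<^esub> x, y) - frag_of (x, a \<odot>\<^bsub>N\<^esub> y) \<in> tensor_kernel R M N"
  by (rule relation_in_kernel) (auto simp: tensor_relations_def)

text \<open>The additivity relation at 0 + 0 is the negative of this generator.\<close>

lemma frag_of_zero_left: "y \<in> carrier N \<Longrightarrow> frag_of (\<zero>\<^bsub>M\<^esub>, y) \<in> tensor_kernel R M N"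
  using kernel_minus[OF relation_add_left[of "\<zero>\<^bsub>M\<^esub>" "\<zero>\<^bsub>M\<^esub>" y]] by simp

lemma frag_of_zero_right: "x \<in> carrier M \<Longrightarrow> frag_of (x, \<zero>\<^bsub>N\<^esub>) \<in> tensor_kernel R M N"
  using kernel_minus[OF relation_add_right[of x "\<zero>\<^bsub>N\<^esub>" "\<zero>\<^bsub>N\<^esub>"]] by simp

lemma frag_of_minus:
  assumes "x \<in> carrier M" "y \<in> carrier N"
  shows "frag_of (\<ominus>\<^bsub>M\<^esub> x, y) + frag_of (x, y) \<in> tensor_kernel R M N"
  using kernel_diff[OF frag_of_zero_left[OF assms(2)] relation_add_left[of "\<ominus>\<^bsub>M\<^esub> x" x y]] assms
  by (simp add: M.M.l_neg add.commute)

lemma sum_list_frag_of_minus: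
  assumes "set ps \<subseteq> carrier M \<times> carrier N"
  shows "sum_list (map frag_of (map (\<lambda>(x, y). (\<ominus>\<^bsub>M\<^esub> x, y)) ps)) + sum_list (map frag_of ps)
    \<in> tensor_kernel R M N"
  using assms
proof (induction ps)
  case (Cons p ps)
  obtain x y where p: "p = (x, y)" by fastforce
  with Cons show ?case
    using kernel_add[OF frag_of_minus[of x y], of "sum_list (map frag_of (map (\<lambda>(x, y). (\<ominus>\<^bsub>M\<^esub> x, y)) ps)) + sum_list (map frag_of ps)"]
    by (simp add: algebra_simps)
qed (simp add: kernel_zero)

text \<open>Negative coefficients are absorbed by negating left factors, so that a list without
  signs or multiplicities presents every class.\<close>

lemma tensor_class_tensor_sum:
  assumes "Poly_Mapping.keys c \<subseteq> carrier M \<times> carrier N"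
  shows "\<exists>ps. set ps \<subseteq> carrier M \<times> carrier N \<and> tensor_class R M N c = ten ps"
  using assms
proof (induction rule: free_Abelian_group_induct[consumes 1, case_names zero diff of])
  case zero
  then show ?case
    by (intro exI[of _ "[]"]) (simp add: tensor_sum_def)
next
  case (diff c d)
  then obtain ps qs where ps: "set ps \<subseteq> carrier M \<times> carrier N" "c - sum_list (map frag_of ps) \<in> tensor_kernel R M N"
    and qs: "set qs \<subseteq> carrier M \<times> carrier N" "d - sum_list (map frag_of qs) \<in> tensor_kernel R M N"
    by (auto simp: tensor_sum_def tensor_class_eq_iff)
  let ?rs = "map (\<lambda>(x, y). (\<ominus>\<^bsub>M\<^esub> x, y)) qs"
  have "c - d - sum_list (map frag_of (ps @ ?rs)) \<in> tensor_kernel R M N"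
    using kernel_diff[OF kernel_diff[OF ps(2) qs(2)] sum_list_frag_of_minus[OF qs(1)]]
    by (simp add: algebra_simps)
  moreover have "set (ps @ ?rs) \<subseteq> carrier M \<times> carrier N"
    using ps(1) qs(1) by auto
  ultimately show ?case
    unfolding tensor_sum_def tensor_class_eq_iff by blast
next
  case (of p)
  then show ?case
    by (intro exI[of _ "[p]"]) (simp add: tensor_sum_def)
qed

section \<open>Universal property of the tensor product\<close>

text \<open>The free group supplies an additive extension \<open>h\<close> of \<open>B\<close>;
  being balanced makes \<open>h\<close> vanish on the relations, hence on the subgroup that they
  generate.\<close>

lemma balanced_hom:
  assumes W: "abelian_group W" and B: "balanced R M N W B"
  obtains h where "h 0 = \<zero>\<^bsub>W\<^esub>"
    "\<And>c. Poly_Mapping.keys c \<subseteq> carrier M \<times> carrier N \<Longrightarrow> h c \<in> carrier W"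
    "\<And>c d. Poly_Mapping.keys c \<subseteq> carrier M \<times> carrier N \<Longrightarrow> Poly_Mapping.keys d \<subseteq> carrier M \<times> carrier N \<Longrightarrow>
      h (c + d) = h c \<oplus>\<^bsub>W\<^esub> h d"
    "\<And>x y. x \<in> carrier M \<Longrightarrow> y \<in> carrier N \<Longrightarrow> h (frag_of (x, y)) = B x y"
    "\<And>c. c \<in> tensor_kernel R M N \<Longrightarrow> h c = \<zero>\<^bsub>W\<^esub>"
proof -
  interpret W: abelian_group W by fact
  have "(\<lambda>(x, y). B x y) ` (carrier M \<times> carrier N) \<subseteq> carrier (add_monoid W)"
    using B by (auto simp: balanced_def)
  then obtain h where h: "h \<in> hom (tensor_free M N) (add_monoid W)"
      and h_of: "\<And>p. p \<in> carrier M \<times> carrier N \<Longrightarrow> h (frag_of p) = (\<lambda>(x, y). B x y) p"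
    using comm_group.free_Abelian_group_universal[OF W.a_comm_group] unfolding tensor_free_def by blast
  have closed: "h c \<in> carrier W" if "Poly_Mapping.keys c \<subseteq> carrier M \<times> carrier N" for c
    using hom_in_carrier[OF h, of c] that by simp
  have h_add: "h (c + d) = h c \<oplus>\<^bsub>W\<^esub> h d"
    if "Poly_Mapping.keys c \<subseteq> carrier M \<times> carrier N" "Poly_Mapping.keys d \<subseteq> carrier M \<times> carrier N" for c d
    using hom_mult[OF h, of c d] that by simp
  have h_zero: "h 0 = \<zero>\<^bsub>W\<^esub>"
    using h_add[of 0 0] closed[of 0] by simp
  \<comment> \<open>Additivity is available for sums only, so each relation \<open>c\<close> is
    treated by moving its negative terms \<open>e\<close> to the other side and cancelling
    \<open>h e\<close>.\<close>
  have move: "h c = \<zero>\<^bsub>W\<^esub>"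
    if "d = c + e" "h d = h e" "Poly_Mapping.keys c \<subseteq> carrier M \<times> carrier N"
      "Poly_Mapping.keys e \<subseteq> carrier M \<times> carrier N" for c d e
    using h_add[of c e] closed[of c] closed[of e] that by simp
  have add_of: "h (frag_of p + frag_of q) = h (frag_of p) \<oplus>\<^bsub>W\<^esub> h (frag_of q)"
    if "p \<in> carrier M \<times> carrier N" "q \<in> carrier M \<times> carrier N" for p q
    using that by (intro h_add) auto
  have keys2: "Poly_Mapping.keys (frag_of p + frag_of q) \<subseteq> carrier M \<times> carrier N"
    if "p \<in> carrier M \<times> carrier N" "q \<in> carrier M \<times> carrier N" for p q
    using that keys_add[of "frag_of p" "frag_of q"] by auto
  have rel: "h c = \<zero>\<^bsub>W\<^esub>" if c: "c \<in> tensor_relations R M N" for c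
  proof -
    have car: "Poly_Mapping.keys d \<subseteq> carrier M \<times> carrier N" if "d = c" for d
      using relation_keys[OF c] that by simp
    from c consider
      (1) x x' y where "c = frag_of (x \<oplus>\<^bsub>M\<^esub> x', y) - frag_of (x, y) - frag_of (x', y)"
        "x \<in> carrier M" "x' \<in> carrier M" "y \<in> carrier N"
      | (2) x y y' where "c = frag_of (x, y \<oplus>\<^bsub>N\<^esub> y') - frag_of (x, y) - frag_of (x, y')"
        "x \<in> carrier M" "y \<in> carrier N" "y' \<in> carrier N"
      | (3) a x y where "c = frag_of (a \<odot>\<^bsub>M\<^esub> x, y) - frag_of (x, a \<odot>\<^bsub>N\<^esub> y)"
        "a \<in> carrier R" "x \<in> carrier M" "y \<in> carrier N"
      by (auto simp: tensor_relations_def)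
    then show ?thesis
    proof cases
      case 1
      then show ?thesis
        using B by (intro move[of "frag_of (x \<oplus>\<^bsub>M\<^esub> x', y)" c "frag_of (x, y) + frag_of (x', y)"])
          (simp_all add: add_of h_of balanced_def keys2 car)
    next
      case 2
      then show ?thesis
        using B by (intro move[of "frag_of (x, y \<oplus>\<^bsub>N\<^esub> y')" c "frag_of (x, y) + frag_of (x, y')"])
          (simp_all add: add_of h_of balanced_def keys2 car)
    next
      case 3
      then show ?thesis
        using B by (intro move[of "frag_of (a \<odot>\<^bsub>M\<^esub> x, y)" c "frag_of (x, a \<odot>\<^bsub>N\<^esub> y)"])
          (simp_all add: h_of balanced_def car)
    qed
  qed
  \<comment> \<open>The support condition is carried through the induction because \<open>h\<close>
    is known to be additive only on it.\<close>
  have "Poly_Mapping.keys c \<subseteq> carrier M \<times> carrier N \<and> h c = \<zero>\<^bsub>W\<^esub>" if "c \<in> tensor_kernel R M N" for c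
    using that
  proof (induction rule: kernel_induct)
    case (relation c)
    then show ?case
      using rel relation_keys by blast
  next
    case zero
    then show ?case by (simp add: h_zero)
  next
    case (add c d)
    then show ?case
      using h_add[of c d] keys_add[of c d] by auto
  next
    case (minus c)
    then show ?case
      using h_add[of "- c" c] closed[of "- c"] by (simp add: h_zero)
  qed
  then show thesis
    using that closed h_add h_zero h_of by auto
qed

abbreviation (input) eval_pairs :: "('w, 'z) ring_scheme \<Rightarrow> ('m \<Rightarrow> 'n \<Rightarrow> 'w) \<Rightarrow> ('m \<times> 'n) list \<Rightarrow> 'w" where
  "eval_pairs W B ps \<equiv> foldr (\<lambda>(x, y) v. B x y \<oplus>\<^bsub>W\<^esub> v) ps \<zero>\<^bsub>W\<^esub>"

text \<open>This is the well-definedness of \<open>tensor_lift\<close>. It also gives lower bounds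
  for tensor norms, since any balanced map takes the same value on all presentations of a
  tensor.\<close>

lemma tensor_sum_eqD:
  assumes W: "abelian_group W" and B: "balanced R M N W B"
    and ps: "set ps \<subseteq> carrier M \<times> carrier N" and qs: "set qs \<subseteq> carrier M \<times> carrier N"
    and eq: "ten ps = ten qs"
  shows "eval_pairs W B ps = eval_pairs W B qs"
proof -
  interpret W: abelian_group W by fact
  obtain h where h: "h 0 = \<zero>\<^bsub>W\<^esub>"
    "\<And>c. Poly_Mapping.keys c \<subseteq> carrier M \<times> carrier N \<Longrightarrow> h c \<in> carrier W"
    "\<And>c d. Poly_Mapping.keys c \<subseteq> carrier M \<times> carrier N \<Longrightarrow> Poly_Mapping.keys d \<subseteq> carrier M \<times> carrier N \<Longrightarrow>
      h (c + d) = h c \<oplus>\<^bsub>W\<^esub> h d"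
    "\<And>x y. x \<in> carrier M \<Longrightarrow> y \<in> carrier N \<Longrightarrow> h (frag_of (x, y)) = B x y"
    "\<And>c. c \<in> tensor_kernel R M N \<Longrightarrow> h c = \<zero>\<^bsub>W\<^esub>"
    by (rule balanced_hom[OF W B], rule that)
  have eval: "h (sum_list (map frag_of rs)) = eval_pairs W B rs" if "set rs \<subseteq> carrier M \<times> carrier N" for rs
    using that
  proof (induction rs)
    case (Cons p rs)
    obtain x y where p: "p = (x, y)" by fastforce
    have "h (frag_of p + sum_list (map frag_of rs)) = h (frag_of p) \<oplus>\<^bsub>W\<^esub> h (sum_list (map frag_of rs))"
      using Cons.prems keys_sum_list_frag_of[of rs] by (intro h(3)) auto
    then show ?case
      using Cons p h(4) by simp
  qed (simp add: h)
  have *: "sum_list (map frag_of ps) - sum_list (map frag_of qs) \<in> tensor_kernel R M N"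
    using eq by (simp add: tensor_sum_eq_iff)
  have "h (sum_list (map frag_of ps)) =
      h (sum_list (map frag_of ps) - sum_list (map frag_of qs)) \<oplus>\<^bsub>W\<^esub> h (sum_list (map frag_of qs))"
    using h(3)[OF kernel_carrier[OF *] keys_sum_list_frag_of_subset[OF qs]] by simp
  then show ?thesis
    using h(2)[OF keys_sum_list_frag_of_subset[OF qs]] h(5)[OF *] eval[OF ps] eval[OF qs] by simp
qed

lemma tensor_lift_tensor_sum:
  assumes "abelian_group W" "balanced R M N W B" "set ps \<subseteq> carrier M \<times> carrier N"
  shows "tensor_lift R M N W B (ten ps) = eval_pairs W B ps"
  unfolding tensor_lift_def presents_iff
  by (rule the_equality) (use assms tensor_sum_eqD[OF assms(1,2)] in blast)+

section \<open>Operations on tensors in terms of presentations\<close>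

lemma tensor_carrier:
  "carrier (tensor C R M N) = ten ` {ps. set ps \<subseteq> carrier M \<times> carrier N}"
proof -
  have "carrier (tensor C R M N) = tensor_class R M N ` carrier (tensor_free M N)"
    by (auto simp: tensor_def FactGroup_def RCOSETS_def tensor_class_def)
  also have "\<dots> = ten ` {ps. set ps \<subseteq> carrier M \<times> carrier N}"
  proof (intro equalityI subsetI)
    fix T assume "T \<in> ten ` {ps. set ps \<subseteq> carrier M \<times> carrier N}"
    then obtain ps where "set ps \<subseteq> carrier M \<times> carrier N" "T = tensor_class R M N (sum_list (map frag_of ps))"
      by (auto simp: tensor_sum_def)
    moreover from this have "sum_list (map frag_of ps) \<in> carrier (tensor_free M N)"
      by (simp only: tensor_free_simps keys_sum_list_frag_of_subset)
    ultimately show "T \<in> tensor_class R M N ` carrier (tensor_free M N)"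
      by blast
  next
    fix T assume "T \<in> tensor_class R M N ` carrier (tensor_free M N)"
    then obtain c where T: "T = tensor_class R M N c" and "c \<in> carrier (tensor_free M N)"
      by (rule imageE)
    then obtain ps where "set ps \<subseteq> carrier M \<times> carrier N" "tensor_class R M N c = ten ps"
      using tensor_class_tensor_sum tensor_free_simps(1) by metis
    then show "T \<in> ten ` {ps. set ps \<subseteq> carrier M \<times> carrier N}"
      by (simp add: T)
  qed
  finally show ?thesis .
qed

lemma tensor_sum_closed: "set ps \<subseteq> carrier M \<times> carrier N \<Longrightarrow> ten ps \<in> carrier (tensor C R M N)"
  by (auto simp: tensor_carrier)

lemma tensor_zero: "\<zero>\<^bsub>tensor C R M N\<^esub> = ten []"
proof -
  have "tensor_kernel R M N = tensor_class R M N 0"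
    by (auto simp: mem_tensor_class)
  then show ?thesis
    by (simp add: tensor_def FactGroup_def tensor_sum_def)
qed

lemma tensor_add:
  assumes "set ps \<subseteq> carrier M \<times> carrier N" "set qs \<subseteq> carrier M \<times> carrier N"
  shows "ten ps \<oplus>\<^bsub>tensor C R M N\<^esub> ten qs = ten (ps @ qs)"
  using normal.rcos_sum[OF kernel_normal, of "sum_list (map frag_of ps)" "sum_list (map frag_of qs)"]
    keys_sum_list_frag_of_subset[OF assms(1)] keys_sum_list_frag_of_subset[OF assms(2)]
  by (simp add: tensor_def FactGroup_def tensor_sum_def tensor_class_def)

text \<open>The definition forms a union over all representatives; it collapses to one class because
  scaling the left factors preserves the kernel.\<close>

lemma tensor_smult:
  assumes a: "a \<in> carrier R" and ps: "set ps \<subseteq> carrier M \<times> carrier N"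
  shows "a \<odot>\<^bsub>tensor C R M N\<^esub> ten ps = ten (map (\<lambda>(x, y). (a \<odot>\<^bsub>M\<^esub> x, y)) ps)"
proof -
  define E where "E = frag_extend (\<lambda>(x :: 'm, y :: 'n). frag_of (a \<odot>\<^bsub>M\<^esub> x, y))"
  have E_of: "E (frag_of (x, y)) = frag_of (a \<odot>\<^bsub>M\<^esub> x, y)" for x y
    by (simp add: E_def)
  have E_diff: "E (c - d) = E c - E d" for c d
    by (simp add: E_def frag_extend_diff)
  have E_kernel: "E c \<in> tensor_kernel R M N" if "c \<in> tensor_kernel R M N" for c
    using that
  proof (induction rule: kernel_induct)
    case (relation c)
    then consider
      (1) x x' y where "c = frag_of (x \<oplus>\<^bsub>M\<^esub> x', y) - frag_of (x, y) - frag_of (x', y)"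
        "x \<in> carrier M" "x' \<in> carrier M" "y \<in> carrier N"
      | (2) x y y' where "c = frag_of (x, y \<oplus>\<^bsub>N\<^esub> y') - frag_of (x, y) - frag_of (x, y')"
        "x \<in> carrier M" "y \<in> carrier N" "y' \<in> carrier N"
      | (3) b x y where "c = frag_of (b \<odot>\<^bsub>M\<^esub> x, y) - frag_of (x, b \<odot>\<^bsub>N\<^esub> y)"
        "b \<in> carrier R" "x \<in> carrier M" "y \<in> carrier N"
      by (auto simp: tensor_relations_def)
    then show ?case
    proof cases
      case 1
      then show ?thesis
        using relation_add_left[of "a \<odot>\<^bsub>M\<^esub> x" "a \<odot>\<^bsub>M\<^esub> x'" y] a by (simp add: E_diff E_of M.smult_r_distr)
    next
      case 2
      then show ?thesis
        using relation_add_right[of "a \<odot>\<^bsub>M\<^esub> x" y y'] a by (simp add: E_diff E_of)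
    next
      case 3
      \<comment> \<open>Commutativity of \<open>R\<close> lets \<open>b\<close> pass in front of
        \<open>a\<close>, after which it can cross the tensor sign.\<close>
      then have "a \<odot>\<^bsub>M\<^esub> (b \<odot>\<^bsub>M\<^esub> x) = b \<odot>\<^bsub>M\<^esub> (a \<odot>\<^bsub>M\<^esub> x)"
        using a by (simp add: M.smult_assoc1[symmetric] M.R.m_comm)
      then show ?thesis
        using relation_smult[of b "a \<odot>\<^bsub>M\<^esub> x" y] a 3 by (simp add: E_diff E_of)
    qed
  next
    case zero
    then show ?case by (simp add: E_def kernel_zero)
  next
    case (add c d)
    then show ?case
      using kernel_add by (simp add: E_def frag_extend_add)
  next
    case (minus c)
    then show ?case
      using kernel_minus by (simp add: E_def frag_extend_minus)
  qed
  have E_sum: "E (sum_list (map frag_of ps)) = sum_list (map frag_of (map (\<lambda>(x, y). (a \<odot>\<^bsub>M\<^esub> x, y)) ps))"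
    by (induction ps) (auto simp: E_def frag_extend_add)
  have "(\<Union>c\<in>ten ps. tensor_class R M N (E c)) =
      ten (map (\<lambda>(x, y). (a \<odot>\<^bsub>M\<^esub> x, y)) ps)"
  proof (rule SUP_eq_const)
    have "sum_list (map frag_of ps) \<in> ten ps"
      by (simp add: tensor_sum_def mem_tensor_class kernel_zero)
    then show "ten ps \<noteq> {}"
      by blast
  next
    fix c assume "c \<in> ten ps"
    then show "tensor_class R M N (E c) = ten (map (\<lambda>(x, y). (a \<odot>\<^bsub>M\<^esub> x, y)) ps)"
      using E_kernel[of "c - sum_list (map frag_of ps)"] E_sum
      by (simp add: tensor_sum_def mem_tensor_class tensor_class_eq_iff E_diff)
  qed
  then show ?thesis
    by (simp add: tensor_def E_def)
qed

end

section \<open>Module structure of the algebraic tensor product\<close>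

context module_pair
begin

lemma tensor_sum_append_commute: "ten (ps @ qs) = ten (qs @ ps)"
  by (simp add: tensor_sum_def add.commute)

lemma tensor_sum_minus_append:
  assumes "set ps \<subseteq> carrier M \<times> carrier N"
  shows "ten (map (\<lambda>(x, y). (\<ominus>\<^bsub>M\<^esub> x, y)) ps @ ps) = ten []"
  using sum_list_frag_of_minus[OF assms] by (simp add: tensor_sum_eq_iff)

lemma tensor_sum_add_left:
  assumes "\<And>p. p \<in> set ps \<Longrightarrow> f p \<in> carrier M \<and> g p \<in> carrier M \<and> h p \<in> carrier N"
  shows "ten (map (\<lambda>p. (f p \<oplus>\<^bsub>M\<^esub> g p, h p)) ps) =
    ten (map (\<lambda>p. (f p, h p)) ps @ map (\<lambda>p. (g p, h p)) ps)"
  unfolding tensor_sum_eq_iff using assms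
proof (induction ps)
  case (Cons p ps)
  let ?S = "\<lambda>ps. sum_list (map frag_of (map (\<lambda>p. (f p \<oplus>\<^bsub>M\<^esub> g p, h p)) ps)) -
    sum_list (map frag_of (map (\<lambda>p. (f p, h p)) ps @ map (\<lambda>p. (g p, h p)) ps))"
  have eq: "?S (p # ps) = (frag_of (f p \<oplus>\<^bsub>M\<^esub> g p, h p) - frag_of (f p, h p) - frag_of (g p, h p)) + ?S ps"
    by simp
  show ?case
    unfolding eq using Cons by (intro kernel_add relation_add_left) auto
qed (simp add: kernel_zero)

text \<open>Contrapositively, every presentation of a nonzero tensor has a term with both factors
  nonzero, which is where the gap of a tensor product comes from.\<close>

lemma tensor_sum_zero:
  assumes "\<And>x y. (x, y) \<in> set ps \<Longrightarrow> x \<in> carrier M \<and> y \<in> carrier N \<and> (x = \<zero>\<^bsub>M\<^esub> \<or> y = \<zero>\<^bsub>N\<^esub>)"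
  shows "ten ps = ten []"
  unfolding tensor_sum_eq_iff using assms
proof (induction ps)
  case (Cons p ps)
  obtain x y where p: "p = (x, y)" by fastforce
  have "frag_of p \<in> tensor_kernel R M N"
    using Cons.prems[of x y] frag_of_zero_left frag_of_zero_right by (auto simp: p)
  moreover have "sum_list (map frag_of ps) - sum_list (map frag_of []) \<in> tensor_kernel R M N"
    by (rule Cons.IH) (rule Cons.prems, simp)
  ultimately show ?case
    using kernel_add[of "frag_of p" "sum_list (map frag_of ps)"] by simp
qed (simp add: kernel_zero)

lemma tensor_cases:
  assumes "T \<in> carrier (tensor C R M N)"
  obtains ps where "set ps \<subseteq> carrier M \<times> carrier N" "T = ten ps"
  using assms by (auto simp: tensor_carrier)

lemma map_left_subset:
  "set ps \<subseteq> carrier M \<times> carrier N \<Longrightarrow> (\<And>x. x \<in> carrier M \<Longrightarrow> f x \<in> carrier M) \<Longrightarrow>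
    set (map (\<lambda>(x, y). (f x, y)) ps) \<subseteq> carrier M \<times> carrier N"
  by auto

lemma tensor_abelian_group: "abelian_group (tensor C R M N)"
proof (rule abelian_groupI)
  fix S assume "S \<in> carrier (tensor C R M N)"
  then obtain ps where ps: "set ps \<subseteq> carrier M \<times> carrier N" "S = ten ps"
    by (rule tensor_cases)
  then show "\<zero>\<^bsub>tensor C R M N\<^esub> \<oplus>\<^bsub>tensor C R M N\<^esub> S = S"
    by (simp add: tensor_zero tensor_add)
  let ?qs = "map (\<lambda>(x, y). (\<ominus>\<^bsub>M\<^esub> x, y)) ps"
  have "set ?qs \<subseteq> carrier M \<times> carrier N"
    using ps(1) by (rule map_left_subset) simp
  then show "\<exists>y\<in>carrier (tensor C R M N). y \<oplus>\<^bsub>tensor C R M N\<^esub> S = \<zero>\<^bsub>tensor C R M N\<^esub>"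
    by (intro bexI[of _ "ten ?qs"])
      (simp_all only: ps(2) tensor_add[OF _ ps(1)] tensor_sum_minus_append[OF ps(1)] tensor_zero tensor_sum_closed)
next
  show "\<zero>\<^bsub>tensor C R M N\<^esub> \<in> carrier (tensor C R M N)"
    by (simp add: tensor_zero tensor_sum_closed)
next
  fix S T assume "S \<in> carrier (tensor C R M N)" "T \<in> carrier (tensor C R M N)"
  then obtain ps qs where *: "set ps \<subseteq> carrier M \<times> carrier N" "S = ten ps"
      "set qs \<subseteq> carrier M \<times> carrier N" "T = ten qs"
    by (metis tensor_cases)
  then show "S \<oplus>\<^bsub>tensor C R M N\<^esub> T \<in> carrier (tensor C R M N)"
    by (simp add: tensor_add tensor_sum_closed)
  show "S \<oplus>\<^bsub>tensor C R M N\<^esub> T = T \<oplus>\<^bsub>tensor C R M N\<^esub> S"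
    using * by (simp add: tensor_add tensor_sum_append_commute)
  fix U assume "U \<in> carrier (tensor C R M N)"
  then obtain rs where "set rs \<subseteq> carrier M \<times> carrier N" "U = ten rs"
    by (rule tensor_cases)
  then show "S \<oplus>\<^bsub>tensor C R M N\<^esub> T \<oplus>\<^bsub>tensor C R M N\<^esub> U = S \<oplus>\<^bsub>tensor C R M N\<^esub> (T \<oplus>\<^bsub>tensor C R M N\<^esub> U)"
    using * by (simp add: tensor_add)
qed

lemma tensor_minus:
  assumes "set ps \<subseteq> carrier M \<times> carrier N"
  shows "\<ominus>\<^bsub>tensor C R M N\<^esub> ten ps = ten (map (\<lambda>(x, y). (\<ominus>\<^bsub>M\<^esub> x, y)) ps)"
proof -
  interpret T: abelian_group "tensor C R M N"
    by (rule tensor_abelian_group)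
  have qs: "set (map (\<lambda>(x, y). (\<ominus>\<^bsub>M\<^esub> x, y)) ps) \<subseteq> carrier M \<times> carrier N"
    using assms by (rule map_left_subset) simp
  show ?thesis
    by (rule T.minus_equality)
      (simp_all only: tensor_add[OF qs assms] tensor_sum_minus_append[OF assms] tensor_zero
        tensor_sum_closed[OF assms] tensor_sum_closed[OF qs])
qed

lemma tensor_module: "Module.module R (tensor C R M N)"
proof (rule moduleI)
  show "cring R" by (rule M.is_cring)
  show "abelian_group (tensor C R M N)" by (rule tensor_abelian_group)
next
  fix a S assume a: "a \<in> carrier R" and "S \<in> carrier (tensor C R M N)"
  then obtain ps where ps: "set ps \<subseteq> carrier M \<times> carrier N" "S = ten ps"
    by (metis tensor_cases)
  have aps: "set (map (\<lambda>(x, y). (a \<odot>\<^bsub>M\<^esub> x, y)) ps) \<subseteq> carrier M \<times> carrier N" if "a \<in> carrier R" for a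
    using ps(1) that by (intro map_left_subset) auto
  then show "a \<odot>\<^bsub>tensor C R M N\<^esub> S \<in> carrier (tensor C R M N)"
    using a ps by (simp add: tensor_smult tensor_sum_closed del: set_map)
  have pc: "fst p \<in> carrier M \<and> snd p \<in> carrier N" if "p \<in> set ps" for p
    using that ps(1) by auto
  fix b assume b: "b \<in> carrier R"
  have eq: "map (\<lambda>p. ((a \<oplus>\<^bsub>R\<^esub> b) \<odot>\<^bsub>M\<^esub> fst p, snd p)) ps =
      map (\<lambda>p. (a \<odot>\<^bsub>M\<^esub> fst p \<oplus>\<^bsub>M\<^esub> b \<odot>\<^bsub>M\<^esub> fst p, snd p)) ps"
    using a b pc by (intro map_cong) (auto simp: M.smult_l_distr)
  show "(a \<oplus>\<^bsub>R\<^esub> b) \<odot>\<^bsub>tensor C R M N\<^esub> S =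
      a \<odot>\<^bsub>tensor C R M N\<^esub> S \<oplus>\<^bsub>tensor C R M N\<^esub> b \<odot>\<^bsub>tensor C R M N\<^esub> S"
    using a b ps pc tensor_add[OF aps[OF a] aps[OF b]]
      tensor_sum_add_left[of ps "\<lambda>p. a \<odot>\<^bsub>M\<^esub> fst p" "\<lambda>p. b \<odot>\<^bsub>M\<^esub> fst p" snd]
    by (simp add: tensor_smult case_prod_unfold eq)
  have "map (\<lambda>(x, y). ((a \<otimes>\<^bsub>R\<^esub> b) \<odot>\<^bsub>M\<^esub> x, y)) ps =
      map (\<lambda>(x, y). (a \<odot>\<^bsub>M\<^esub> x, y)) (map (\<lambda>(x, y). (b \<odot>\<^bsub>M\<^esub> x, y)) ps)"
    using a b pc by (auto simp: M.smult_assoc1)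
  then show "(a \<otimes>\<^bsub>R\<^esub> b) \<odot>\<^bsub>tensor C R M N\<^esub> S = a \<odot>\<^bsub>tensor C R M N\<^esub> (b \<odot>\<^bsub>tensor C R M N\<^esub> S)"
    using a b ps aps[OF b] by (simp add: tensor_smult del: set_map map_map)
next
  fix S assume "S \<in> carrier (tensor C R M N)"
  then obtain ps where ps: "set ps \<subseteq> carrier M \<times> carrier N" "S = ten ps"
    by (rule tensor_cases)
  then have "map (\<lambda>(x, y). (\<one>\<^bsub>R\<^esub> \<odot>\<^bsub>M\<^esub> x, y)) ps = ps"
    by (intro map_idI) auto
  then show "\<one>\<^bsub>R\<^esub> \<odot>\<^bsub>tensor C R M N\<^esub> S = S"
    using ps by (simp add: tensor_smult)
next
  fix a S T assume a: "a \<in> carrier R" and "S \<in> carrier (tensor C R M N)"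
  then obtain ps where ps: "set ps \<subseteq> carrier M \<times> carrier N" "S = ten ps"
    by (metis tensor_cases)
  have aps: "set (map (\<lambda>(x, y). (a \<odot>\<^bsub>M\<^esub> x, y)) ps) \<subseteq> carrier M \<times> carrier N"
    using ps(1) a by (intro map_left_subset) auto
  assume "T \<in> carrier (tensor C R M N)"
  then obtain qs where qs: "set qs \<subseteq> carrier M \<times> carrier N" "T = ten qs"
    by (rule tensor_cases)
  have aqs: "set (map (\<lambda>(x, y). (a \<odot>\<^bsub>M\<^esub> x, y)) qs) \<subseteq> carrier M \<times> carrier N"
    using qs(1) a by (intro map_left_subset) auto
  show "a \<odot>\<^bsub>tensor C R M N\<^esub> (S \<oplus>\<^bsub>tensor C R M N\<^esub> T) =
      a \<odot>\<^bsub>tensor C R M N\<^esub> S \<oplus>\<^bsub>tensor C R M N\<^esub> a \<odot>\<^bsub>tensor C R M N\<^esub> T"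
    using a ps qs aps aqs by (simp add: tensor_add tensor_smult del: set_map)
qed

lemma pure_tensor_balanced:
  "balanced R M N (tensor C R M N) (\<lambda>x y. ten [(x, y)])"
  unfolding balanced_def
proof (intro conjI ballI)
  fix x x' y assume *: "x \<in> carrier M" "x' \<in> carrier M" "y \<in> carrier N"
  then show "ten [(x \<oplus>\<^bsub>M\<^esub> x', y)] =
      ten [(x, y)] \<oplus>\<^bsub>tensor C R M N\<^esub> ten [(x', y)]"
    using relation_add_left[OF *] by (simp add: tensor_add tensor_sum_eq_iff diff_diff_add)
next
  fix x y y' assume *: "x \<in> carrier M" "y \<in> carrier N" "y' \<in> carrier N"
  then show "ten [(x, y \<oplus>\<^bsub>N\<^esub> y')] =
      ten [(x, y)] \<oplus>\<^bsub>tensor C R M N\<^esub> ten [(x, y')]"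
    using relation_add_right[OF *] by (simp add: tensor_add tensor_sum_eq_iff diff_diff_add)
qed (auto simp: tensor_sum_eq_iff relation_smult intro!: tensor_sum_closed)

end

text \<open>Functoriality in the left factor: sending \<open>(x, y)\<close> to the pure tensor of
  \<open>\<phi> x\<close> and \<open>y\<close> is balanced, so it respects equality of presented
  tensors.\<close>

lemma tensor_sum_map_left:
  assumes MN: "module_pair R M N" and MN': "module_pair R M' N" and lin: "R_linear R M M' \<phi>"
    and ps: "set ps \<subseteq> carrier M \<times> carrier N" and qs: "set qs \<subseteq> carrier M \<times> carrier N"
    and eq: "tensor_sum R M N ps = tensor_sum R M N qs"
  shows "tensor_sum R M' N (map (\<lambda>(x, y). (\<phi> x, y)) ps) = tensor_sum R M' N (map (\<lambda>(x, y). (\<phi> x, y)) qs)"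
proof -
  interpret MN: module_pair R M N by fact
  interpret MN': module_pair R M' N by fact
  \<comment> \<open>The category affects only the norm, and only the group structure is used here,
    so either value would serve.\<close>
  let ?T = "tensor Ab_A R M' N" and ?B = "\<lambda>x y. tensor_sum R M' N [(\<phi> x, y)]"
  have B: "balanced R M N ?T ?B"
    using MN'.pure_tensor_balanced[of Ab_A] lin unfolding balanced_def R_linear_def by (auto simp: Pi_iff)
  have "foldr (\<lambda>(x, y) v. ?B x y \<oplus>\<^bsub>?T\<^esub> v) rs \<zero>\<^bsub>?T\<^esub> = tensor_sum R M' N (map (\<lambda>(x, y). (\<phi> x, y)) rs)"
    if "set rs \<subseteq> carrier M \<times> carrier N" for rs
    using that
  proof (induction rs)
    case (Cons p rs)
    obtain x y where p: "p = (x, y)" by fastforce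
    have "set (map (\<lambda>(x, y). (\<phi> x, y)) rs) \<subseteq> carrier M' \<times> carrier N" "set [(\<phi> x, y)] \<subseteq> carrier M' \<times> carrier N"
      using Cons.prems lin by (auto simp: p R_linear_def)
    then show ?case
      using Cons p MN'.tensor_add[of "[(\<phi> x, y)]" "map (\<lambda>(x, y). (\<phi> x, y)) rs" Ab_A] by simp
  qed (simp add: MN'.tensor_zero)
  then show ?thesis
    using MN.tensor_sum_eqD[OF MN'.tensor_abelian_group B ps qs eq] ps qs by simp
qed

section \<open>The tensor norm and its gap\<close>

definition pair_norm :: "('r, 'm) normed_module \<Rightarrow> ('r, 'n) normed_module \<Rightarrow> 'm \<times> 'n \<Rightarrow> real" where
  "pair_norm M N = (\<lambda>(x, y). mod_norm M x * mod_norm N y)"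

locale isolated_pair =
  fixes C :: base_category and R :: "'r normed_ring"
    and M :: "('r, 'm) normed_module" and N :: "('r, 'n) normed_module"
  assumes isolated_left: "isolated_normed_module C R M" and isolated_right: "isolated_normed_module C R N"
begin

sublocale M: isolated_normed_module C R M by (rule isolated_left)
sublocale N: isolated_normed_module C R N by (rule isolated_right)
sublocale module_pair R M N
  by unfold_locales

abbreviation "MN \<equiv> tensor C R M N"

lemma pair_norm_nonneg: "p \<in> carrier M \<times> carrier N \<Longrightarrow> 0 \<le> pair_norm M N p"
  by (auto simp: pair_norm_def M.norm_nonneg N.norm_nonneg)

lemma aggregate_pair_norm_nonneg:
  "set ps \<subseteq> carrier M \<times> carrier N \<Longrightarrow> 0 \<le> aggregate C (map (pair_norm M N) ps)"
  by (rule aggregate_nonneg) (auto intro!: pair_norm_nonneg)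

lemma tensor_norm_eq:
  "mod_norm MN T =
    Inf {aggregate C (map (pair_norm M N) ps) | ps. set ps \<subseteq> carrier M \<times> carrier N \<and> T = ten ps}"
  by (simp add: tensor_def presents_iff pair_norm_def)

lemma tensor_norm_le:
  assumes "set ps \<subseteq> carrier M \<times> carrier N"
  shows "mod_norm MN (ten ps) \<le> aggregate C (map (pair_norm M N) ps)"
  unfolding tensor_norm_eq
  by (rule cInf_lower) (use assms in \<open>auto intro!: bdd_belowI[of _ 0] aggregate_pair_norm_nonneg\<close>)

lemma tensor_norm_ge:
  assumes "T \<in> carrier MN"
    and "\<And>ps. set ps \<subseteq> carrier M \<times> carrier N \<Longrightarrow> T = ten ps \<Longrightarrow>
      l \<le> aggregate C (map (pair_norm M N) ps)"
  shows "l \<le> mod_norm MN T"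
  unfolding tensor_norm_eq
proof (rule cInf_greatest)
  show "{aggregate C (map (pair_norm M N) ps) | ps. set ps \<subseteq> carrier M \<times> carrier N \<and> T = ten ps} \<noteq> {}"
    using assms(1) by (auto simp: tensor_carrier)
qed (use assms(2) in blast)

lemma tensor_norm_approx:
  assumes "T \<in> carrier MN" "e > 0"
  obtains ps where "set ps \<subseteq> carrier M \<times> carrier N" "T = ten ps"
    "aggregate C (map (pair_norm M N) ps) < mod_norm MN T + e"
proof -
  have "\<not> mod_norm MN T + e \<le> mod_norm MN T"
    using assms(2) by simp
  then show thesis
    using tensor_norm_ge[OF assms(1), of "mod_norm MN T + e"] that by (meson not_le)
qed

text \<open>Each norm axiom is an operation on presentations: concatenation for sums, and negation
  or scaling of the left factors. The infimum need not be attained, whence the slacks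
  \<open>e\<close>.\<close>

lemma tensor_isolated_normed: "isolated_normed_module C R MN"
proof -
  interpret T: module R "MN"
    by (rule tensor_module)
  \<comment> \<open>Kept opaque so that the argument does not split into the two categories.\<close>
  note [simp del] = aggregate.simps
  show ?thesis
  proof
    show "0 \<le> ring_norm R a" if "a \<in> carrier R" for a
      using that by (rule M.ring_norm_nonneg)
    show nonneg: "0 \<le> mod_norm MN S" if "S \<in> carrier MN" for S
      using that by (rule tensor_norm_ge) (rule aggregate_pair_norm_nonneg)
    \<comment> \<open>The empty list presents 0 and has weight 0.\<close>
    have "mod_norm MN \<zero>\<^bsub>MN\<^esub> \<le> 0"
      using tensor_norm_le[of "[]"] by (cases C) (auto simp: tensor_zero aggregate.simps)
    then show "mod_norm MN \<zero>\<^bsub>MN\<^esub> = 0"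
      using nonneg[OF T.zero_closed] by simp
    have minus_le: "mod_norm MN (\<ominus>\<^bsub>MN\<^esub> S) \<le> mod_norm MN S"
      if S: "S \<in> carrier MN" for S
    proof (rule tensor_norm_ge[OF S])
      fix ps assume ps: "set ps \<subseteq> carrier M \<times> carrier N" "S = ten ps"
      let ?qs = "map (\<lambda>(x, y). (\<ominus>\<^bsub>M\<^esub> x, y)) ps"
      have qs: "set ?qs \<subseteq> carrier M \<times> carrier N"
        using ps(1) by (rule map_left_subset) simp
      have "mod_norm MN (\<ominus>\<^bsub>MN\<^esub> S) \<le> aggregate C (map (pair_norm M N) ?qs)"
        using tensor_norm_le[OF qs] ps by (simp add: tensor_minus)
      also have "map (pair_norm M N) ?qs = map (pair_norm M N) ps"
        using ps(1) by (auto simp: pair_norm_def M.norm_minus)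
      finally show "mod_norm MN (\<ominus>\<^bsub>MN\<^esub> S) \<le> aggregate C (map (pair_norm M N) ps)" .
    qed
    \<comment> \<open>The reverse inequality is \<open>minus_le\<close> applied to the negative of
      \<open>S\<close>.\<close>
    show "mod_norm MN (\<ominus>\<^bsub>MN\<^esub> S) = mod_norm MN S"
      if "S \<in> carrier MN" for S
      using minus_le[OF that] minus_le[OF T.a_inv_closed[OF that]] that by simp
    show "mod_norm MN (S \<oplus>\<^bsub>MN\<^esub> T)
        \<le> aggregate C [mod_norm MN S, mod_norm MN T]"
      if S: "S \<in> carrier MN" and T: "T \<in> carrier MN" for S T
    proof (rule aggregate_pair_lim)
      fix e :: real assume e: "e > 0"
      obtain ps where ps: "set ps \<subseteq> carrier M \<times> carrier N" "S = ten ps"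
        "aggregate C (map (pair_norm M N) ps) < mod_norm MN S + e"
        using S e by (rule tensor_norm_approx)
      obtain qs where qs: "set qs \<subseteq> carrier M \<times> carrier N" "T = ten qs"
        "aggregate C (map (pair_norm M N) qs) < mod_norm MN T + e"
        using T e by (rule tensor_norm_approx)
      have "mod_norm MN (S \<oplus>\<^bsub>MN\<^esub> T) \<le> aggregate C (map (pair_norm M N) (ps @ qs))"
        using tensor_norm_le[of "ps @ qs"] ps qs by (simp add: tensor_add)
      also have "\<dots> \<le> aggregate C [aggregate C (map (pair_norm M N) ps), aggregate C (map (pair_norm M N) qs)]"
        unfolding map_append
        by (rule aggregate_append_le) (use ps(1) qs(1) in \<open>auto intro!: pair_norm_nonneg\<close>)
      also have "\<dots> \<le> aggregate C [mod_norm MN S + e, mod_norm MN T + e]"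
        using ps(3) qs(3) by (intro aggregate_pair_mono) auto
      finally show "mod_norm MN (S \<oplus>\<^bsub>MN\<^esub> T)
        \<le> aggregate C [mod_norm MN S + e, mod_norm MN T + e]" .
    qed
    obtain K where K: "K \<ge> 0" "\<And>a x. a \<in> carrier R \<Longrightarrow> x \<in> carrier M \<Longrightarrow>
        mod_norm M (a \<odot>\<^bsub>M\<^esub> x) \<le> K * ring_norm R a * mod_norm M x"
      using M.norm_smult_le by blast
    have "mod_norm MN (a \<odot>\<^bsub>MN\<^esub> S) \<le> K * ring_norm R a * mod_norm MN S"
      if a: "a \<in> carrier R" and S: "S \<in> carrier MN" for a S
    proof (rule field_le_epsilon)
      fix e :: real assume e: "e > 0"
      let ?c = "K * ring_norm R a"
      have c: "?c \<ge> 0"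
        using K(1) M.ring_norm_nonneg[OF a] by simp
      \<comment> \<open>The slack will be multiplied by \<open>?c\<close>, which may be 0; the
        summand 1 keeps the quotient meaningful and the product at most \<open>e\<close>.\<close>
      then have "e / (?c + 1) > 0"
        using e by simp
      with S obtain ps where ps: "set ps \<subseteq> carrier M \<times> carrier N" "S = ten ps"
        "aggregate C (map (pair_norm M N) ps) < mod_norm MN S + e / (?c + 1)"
        by (rule tensor_norm_approx)
      let ?qs = "map (\<lambda>(x, y). (a \<odot>\<^bsub>M\<^esub> x, y)) ps"
      have qs: "set ?qs \<subseteq> carrier M \<times> carrier N"
        using ps(1) a by (intro map_left_subset) auto
      have "mod_norm MN (a \<odot>\<^bsub>MN\<^esub> S) \<le> aggregate C (map (pair_norm M N) ?qs)"
        using tensor_norm_le[OF qs] ps a by (simp add: tensor_smult)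
      also have "\<dots> = aggregate C (map (\<lambda>p. pair_norm M N (a \<odot>\<^bsub>M\<^esub> fst p, snd p)) ps)"
        by (simp add: comp_def case_prod_unfold)
      also have "\<dots> \<le> aggregate C (map (\<lambda>p. ?c * pair_norm M N p) ps)"
      proof (rule aggregate_mono)
        fix p assume "p \<in> set ps"
        then have "fst p \<in> carrier M" "snd p \<in> carrier N"
          using ps(1) by auto
        then show "pair_norm M N (a \<odot>\<^bsub>M\<^esub> fst p, snd p) \<le> ?c * pair_norm M N p"
          using mult_right_mono[OF K(2)[OF a, of "fst p"] N.norm_nonneg[of "snd p"]]
          by (simp add: pair_norm_def case_prod_unfold mult.assoc)
      qed
      also have "\<dots> = ?c * aggregate C (map (pair_norm M N) ps)"
        by (rule aggregate_scale[OF c])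
      also have "\<dots> \<le> ?c * (mod_norm MN S + e / (?c + 1))"
        using ps(3) c by (intro mult_left_mono) auto
      also have "\<dots> \<le> ?c * mod_norm MN S + e"
        using c e by (simp add: distrib_left divide_le_eq mult.commute)
      finally show "mod_norm MN (a \<odot>\<^bsub>MN\<^esub> S) \<le> ?c * mod_norm MN S + e" .
    qed
    then show "\<exists>K\<ge>0. \<forall>a\<in>carrier R. \<forall>S\<in>carrier MN.
        mod_norm MN (a \<odot>\<^bsub>MN\<^esub> S) \<le> K * ring_norm R a * mod_norm MN S"
      using K(1) by blast
    obtain \<delta>1 where \<delta>1: "\<delta>1 > 0" "\<And>x. x \<in> carrier M \<Longrightarrow> x \<noteq> \<zero>\<^bsub>M\<^esub> \<Longrightarrow> \<delta>1 \<le> mod_norm M x"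
      using M.norm_isolated by blast
    obtain \<delta>2 where \<delta>2: "\<delta>2 > 0" "\<And>x. x \<in> carrier N \<Longrightarrow> x \<noteq> \<zero>\<^bsub>N\<^esub> \<Longrightarrow> \<delta>2 \<le> mod_norm N x"
      using N.norm_isolated by blast
    have "\<delta>1 * \<delta>2 \<le> mod_norm MN S"
      if S: "S \<in> carrier MN" "S \<noteq> \<zero>\<^bsub>MN\<^esub>" for S
    proof (rule tensor_norm_ge[OF S(1)])
      fix ps assume ps: "set ps \<subseteq> carrier M \<times> carrier N" "S = ten ps"
      then obtain x y where xy: "(x, y) \<in> set ps" "x \<noteq> \<zero>\<^bsub>M\<^esub>" "y \<noteq> \<zero>\<^bsub>N\<^esub>"
        using tensor_sum_zero[of ps] S(2) by (auto simp: tensor_zero)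
      then have car: "x \<in> carrier M" "y \<in> carrier N"
        using ps(1) by auto
      then have "\<delta>1 * \<delta>2 \<le> pair_norm M N (x, y)"
        using \<delta>1 \<delta>2 xy by (simp add: pair_norm_def mult_mono M.norm_nonneg)
      also have "\<dots> \<le> aggregate C (map (pair_norm M N) ps)"
        using ps(1) xy(1) by (intro aggregate_ge_member) (auto intro!: pair_norm_nonneg)
      finally show "\<delta>1 * \<delta>2 \<le> aggregate C (map (pair_norm M N) ps)" .
    qed
    then show "\<exists>\<delta>>0. \<forall>S\<in>carrier MN. S \<noteq> \<zero>\<^bsub>MN\<^esub> \<longrightarrow> \<delta> \<le> mod_norm MN S"
      using \<delta>1(1) \<delta>2(1) by (meson mult_pos_pos)
  qed
qed

end

section \<open>Continuous maps with finite image\<close>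

text \<open>Continuity into a discrete space without mention of the codomain, so that composition
  with arbitrary functions, including choice functions, raises no topological question.\<close>

definition locally_constant :: "'x topology \<Rightarrow> ('x \<Rightarrow> 'a) \<Rightarrow> bool" where
  "locally_constant X f \<longleftrightarrow>
     (\<forall>x\<in>topspace X. \<exists>U. openin X U \<and> x \<in> U \<and> (\<forall>y\<in>U. f x = f y))"

lemma locally_constantD:
  assumes "locally_constant X f" "x \<in> topspace X"
  shows "\<exists>U. openin X U \<and> x \<in> U \<and> U \<subseteq> topspace X \<and> (\<forall>y\<in>U. f x = f y)"
proof -
  have "\<exists>U. openin X U \<and> x \<in> U \<and> (\<forall>y\<in>U. f x = f y)"
    using assms by (simp add: locally_constant_def)
  then obtain U where "openin X U \<and> x \<in> U \<and> (\<forall>y\<in>U. f x = f y)" ..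
  then show ?thesis
    by (intro exI[of _ U]) (simp add: openin_subset)
qed

lemma locally_constantI:
  assumes "\<And>x. x \<in> topspace X \<Longrightarrow> \<exists>U. openin X U \<and> x \<in> U \<and> (\<forall>y\<in>U. f x = f y)"
  shows "locally_constant X f"
  using assms by (simp add: locally_constant_def)

lemma locally_constant_compose: "locally_constant X f \<Longrightarrow> locally_constant X (\<lambda>x. h (f x))"
proof (rule locally_constantI)
  fix x assume "locally_constant X f" "x \<in> topspace X"
  from locally_constantD[OF this]
  obtain U where "openin X U \<and> x \<in> U \<and> U \<subseteq> topspace X \<and> (\<forall>y\<in>U. f x = f y)" ..
  then show "\<exists>U. openin X U \<and> x \<in> U \<and> (\<forall>y\<in>U. h (f x) = h (f y))"
    by (intro exI[of _ U]) simp
qed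

lemma locally_constant_const: "locally_constant X (\<lambda>_. c)"
proof (rule locally_constantI)
  fix x assume "x \<in> topspace X"
  then show "\<exists>U. openin X U \<and> x \<in> U \<and> (\<forall>y\<in>U. c = c)"
    by (intro exI[of _ "topspace X"]) simp
qed

lemma locally_constant_Pair:
  assumes "locally_constant X f" "locally_constant X g"
  shows "locally_constant X (\<lambda>x. (f x, g x))"
proof (rule locally_constantI)
  fix x assume x: "x \<in> topspace X"
  obtain U where U: "openin X U \<and> x \<in> U \<and> U \<subseteq> topspace X \<and> (\<forall>y\<in>U. f x = f y)"
    using locally_constantD[OF assms(1) x] ..
  obtain V where "openin X V \<and> x \<in> V \<and> V \<subseteq> topspace X \<and> (\<forall>y\<in>V. g x = g y)"
    using locally_constantD[OF assms(2) x] ..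
  with U show "\<exists>U. openin X U \<and> x \<in> U \<and> (\<forall>y\<in>U. (f x, g x) = (f y, g y))"
    by (intro exI[of _ "U \<inter> V"]) auto
qed

lemma locally_constant_compose2:
  assumes "locally_constant X f" "locally_constant X g"
  shows "locally_constant X (\<lambda>x. h (f x) (g x))"
  using locally_constant_compose[OF locally_constant_Pair[OF assms], of "\<lambda>(a, b). h a b"] by simp

text \<open>Yields a common neighbourhood on which finitely many maps are simultaneously constant;
  the level sets used for injectivity are those of such a tuple.\<close>

lemma locally_constant_map:
  "(\<And>p. p \<in> set ps \<Longrightarrow> locally_constant X (F p)) \<Longrightarrow> locally_constant X (\<lambda>x. map (\<lambda>p. F p x) ps)"
proof (induction ps)
  case (Cons p ps)
  then show ?case
    using locally_constant_compose2[of X "F p" "\<lambda>x. map (\<lambda>p. F p x) ps" "(#)"] by simp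
qed (simp add: locally_constant_const)

lemma locally_constant_cong:
  assumes "\<And>x. x \<in> topspace X \<Longrightarrow> f x = g x" "locally_constant X f"
  shows "locally_constant X g"
proof (rule locally_constantI)
  fix x assume x: "x \<in> topspace X"
  obtain U where "openin X U \<and> x \<in> U \<and> U \<subseteq> topspace X \<and> (\<forall>y\<in>U. f x = f y)"
    using locally_constantD[OF assms(2) x] ..
  then show "\<exists>U. openin X U \<and> x \<in> U \<and> (\<forall>y\<in>U. g x = g y)"
    using assms(1) x by (intro exI[of _ U]) (auto simp: subset_iff)
qed

text \<open>The fibre through a point is the preimage of an open singleton; conversely, every
  preimage is a union of neighbourhoods on which \<open>f\<close> is constant.\<close>

lemma continuous_map_discrete_iff:
  "continuous_map X (discrete_topology A) f \<longleftrightarrow> f \<in> topspace X \<rightarrow> A \<and> locally_constant X f"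
proof safe
  assume f: "continuous_map X (discrete_topology A) f"
  then show *: "f x \<in> A" if "x \<in> topspace X" for x
    using that by (auto simp: continuous_map_def)
  show "locally_constant X f"
  proof (rule locally_constantI)
    fix x assume x: "x \<in> topspace X"
    then have "openin X {y \<in> topspace X. f y \<in> {f x}}"
      using f * by (intro openin_continuous_map_preimage) auto
    then show "\<exists>U. openin X U \<and> x \<in> U \<and> (\<forall>y\<in>U. f x = f y)"
      using x by (intro exI[of _ "{y \<in> topspace X. f y \<in> {f x}}"]) auto
  qed
next
  assume f: "f \<in> topspace X \<rightarrow> A" "locally_constant X f"
  have "openin X {x \<in> topspace X. f x \<in> V}" for V
  proof (subst openin_subopen, safe)
    fix x assume x: "x \<in> topspace X" "f x \<in> V"
    obtain U where "openin X U \<and> x \<in> U \<and> U \<subseteq> topspace X \<and> (\<forall>y\<in>U. f x = f y)"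
      using locally_constantD[OF f(2) x(1)] ..
    then show "\<exists>T. openin X T \<and> x \<in> T \<and> T \<subseteq> {x \<in> topspace X. f x \<in> V}"
      using x by (intro exI[of _ U]) auto
  qed
  then show "continuous_map X (discrete_topology A) f"
    using f(1) by (auto simp: continuous_map_def)
qed

section \<open>Maps with finite image as an isolated normed module\<close>

context isolated_normed_module
begin

lemma C_fin_carrier_iff:
  "f \<in> carrier (C_fin X M) \<longleftrightarrow>
    f \<in> topspace X \<rightarrow>\<^sub>E carrier M \<and> locally_constant X f \<and> finite (f ` topspace X)"
  by (auto simp: C_fin_def norm_topology_discrete continuous_map_discrete_iff PiE_iff)

lemma C_fin_app: "f \<in> carrier (C_fin X M) \<Longrightarrow> x \<in> topspace X \<Longrightarrow> f x \<in> carrier M"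
  by (auto simp: C_fin_carrier_iff)

lemma C_fin_ext:
  "f \<in> carrier (C_fin X M) \<Longrightarrow> g \<in> carrier (C_fin X M) \<Longrightarrow> (\<And>x. x \<in> topspace X \<Longrightarrow> f x = g x) \<Longrightarrow> f = g"
  unfolding C_fin_carrier_iff by (auto intro: PiE_ext)

text \<open>Composition with an arbitrary \<open>h\<close> preserves local constancy and finiteness
  of the image, so only membership of the values has to be checked.\<close>

lemma C_fin_restrictI:
  assumes "locally_constant X g" "finite (g ` topspace X)" "\<And>x. x \<in> topspace X \<Longrightarrow> h (g x) \<in> carrier M"
  shows "(\<lambda>x\<in>topspace X. h (g x)) \<in> carrier (C_fin X M)"
  unfolding C_fin_carrier_iff
proof (intro conjI)
  show "locally_constant X (\<lambda>x\<in>topspace X. h (g x))"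
    by (rule locally_constant_cong[OF _ locally_constant_compose[OF assms(1), of h]]) simp
  have "(\<lambda>x\<in>topspace X. h (g x)) ` topspace X = h ` g ` topspace X"
    by auto
  then show "finite ((\<lambda>x\<in>topspace X. h (g x)) ` topspace X)"
    using assms(2) by simp
qed (use assms(3) in auto)

lemma C_fin_restrict2I:
  assumes "locally_constant X f" "finite (f ` topspace X)" "locally_constant X g" "finite (g ` topspace X)"
    "\<And>x. x \<in> topspace X \<Longrightarrow> h (f x) (g x) \<in> carrier M"
  shows "(\<lambda>x\<in>topspace X. h (f x) (g x)) \<in> carrier (C_fin X M)"
proof -
  have "finite ((\<lambda>x. (f x, g x)) ` topspace X)"
    by (rule finite_subset[of _ "f ` topspace X \<times> g ` topspace X"]) (use assms in auto)
  then show ?thesis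
    using C_fin_restrictI[OF locally_constant_Pair[OF assms(1,3)], where h = "\<lambda>(a, b). h a b"] assms(5) by simp
qed

lemma C_fin_norm_finite:
  assumes "f \<in> carrier (C_fin X M)"
  shows "finite ((\<lambda>x. mod_norm M (f x)) ` topspace X)"
proof -
  have "(\<lambda>x. mod_norm M (f x)) ` topspace X = mod_norm M ` f ` topspace X"
    by auto
  then show ?thesis
    using assms by (simp add: C_fin_carrier_iff)
qed

lemma C_fin_norm_eq:
  "mod_norm (C_fin X M) f = Sup (insert 0 ((\<lambda>x. mod_norm M (f x)) ` topspace X))"
  by (simp add: C_fin_def)

lemma C_fin_norm_ge:
  assumes "f \<in> carrier (C_fin X M)" "x \<in> topspace X"
  shows "mod_norm M (f x) \<le> mod_norm (C_fin X M) f"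
  unfolding C_fin_norm_eq
  by (rule cSup_upper) (use assms C_fin_norm_finite[OF assms(1)] in \<open>auto intro!: bdd_above_finite\<close>)

lemma C_fin_norm_nonneg:
  assumes "f \<in> carrier (C_fin X M)"
  shows "0 \<le> mod_norm (C_fin X M) f"
  unfolding C_fin_norm_eq
  by (rule cSup_upper) (use C_fin_norm_finite[OF assms(1)] in \<open>auto intro!: bdd_above_finite\<close>)

text \<open>The bound has to be nonnegative because 0 is inserted into the supremum; for empty
  \<open>X\<close> this is the only condition.\<close>

lemma C_fin_norm_le:
  assumes "0 \<le> c" "\<And>x. x \<in> topspace X \<Longrightarrow> mod_norm M (f x) \<le> c"
  shows "mod_norm (C_fin X M) f \<le> c"
  unfolding C_fin_norm_eq by (rule cSup_least) (use assms in auto)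

lemma C_fin_zero_app: "x \<in> topspace X \<Longrightarrow> \<zero>\<^bsub>C_fin X M\<^esub> x = \<zero>\<^bsub>M\<^esub>"
  by (simp add: C_fin_def)

lemma C_fin_add_app: "x \<in> topspace X \<Longrightarrow> (f \<oplus>\<^bsub>C_fin X M\<^esub> g) x = f x \<oplus>\<^bsub>M\<^esub> g x"
  by (simp add: C_fin_def)

lemma C_fin_smult_app: "x \<in> topspace X \<Longrightarrow> (a \<odot>\<^bsub>C_fin X M\<^esub> f) x = a \<odot>\<^bsub>M\<^esub> f x"
  by (simp add: C_fin_def)

lemma C_fin_zero_closed: "\<zero>\<^bsub>C_fin X M\<^esub> \<in> carrier (C_fin X M)"
proof -
  have "(\<lambda>x\<in>topspace X. \<zero>\<^bsub>M\<^esub>) \<in> carrier (C_fin X M)"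
    by (rule C_fin_restrictI[OF locally_constant_const[of X undefined], where h = "\<lambda>_. \<zero>\<^bsub>M\<^esub>"])
      (simp_all add: image_constant_conv)
  then show ?thesis
    by (simp add: C_fin_def)
qed

lemma C_fin_add_closed:
  assumes "f \<in> carrier (C_fin X M)" "g \<in> carrier (C_fin X M)"
  shows "f \<oplus>\<^bsub>C_fin X M\<^esub> g \<in> carrier (C_fin X M)"
proof -
  have "(\<lambda>x\<in>topspace X. f x \<oplus>\<^bsub>M\<^esub> g x) \<in> carrier (C_fin X M)"
    by (rule C_fin_restrict2I) (use assms in \<open>auto simp: C_fin_carrier_iff\<close>)
  then show ?thesis
    by (simp add: C_fin_def)
qed

lemma C_fin_smult_closed:
  assumes "a \<in> carrier R" "f \<in> carrier (C_fin X M)"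
  shows "a \<odot>\<^bsub>C_fin X M\<^esub> f \<in> carrier (C_fin X M)"
proof -
  have "(\<lambda>x\<in>topspace X. a \<odot>\<^bsub>M\<^esub> f x) \<in> carrier (C_fin X M)"
    by (rule C_fin_restrictI) (use assms in \<open>auto simp: C_fin_carrier_iff\<close>)
  then show ?thesis
    by (simp add: C_fin_def)
qed

lemma C_fin_minus_closed:
  assumes "f \<in> carrier (C_fin X M)"
  shows "(\<lambda>x\<in>topspace X. \<ominus>\<^bsub>M\<^esub> f x) \<in> carrier (C_fin X M)"
  by (rule C_fin_restrictI) (use assms in \<open>auto simp: C_fin_carrier_iff\<close>)

lemmas C_fin_closed = C_fin_zero_closed C_fin_add_closed C_fin_smult_closed
lemmas C_fin_apps = C_fin_zero_app C_fin_add_app C_fin_smult_app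

lemma C_fin_abelian_group: "abelian_group (C_fin X M)"
proof (rule abelian_groupI)
  fix f assume f: "f \<in> carrier (C_fin X M)"
  show "\<exists>g\<in>carrier (C_fin X M). g \<oplus>\<^bsub>C_fin X M\<^esub> f = \<zero>\<^bsub>C_fin X M\<^esub>"
    by (intro bexI[of _ "\<lambda>x\<in>topspace X. \<ominus>\<^bsub>M\<^esub> f x"] C_fin_ext[where X = X])
      (use f in \<open>auto simp: C_fin_closed C_fin_minus_closed C_fin_apps C_fin_app[OF f] M.l_neg\<close>)
qed (auto simp: C_fin_closed C_fin_apps C_fin_app M.a_ac intro!: C_fin_ext[where X = X])

lemma C_fin_module: "Module.module R (C_fin X M)"
  by (rule moduleI)
    (auto simp: is_cring C_fin_abelian_group C_fin_closed C_fin_apps C_fin_app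
      smult_l_distr smult_r_distr smult_assoc1 intro!: C_fin_ext[where X = X])

lemma C_fin_a_inv:
  assumes "f \<in> carrier (C_fin X M)"
  shows "\<ominus>\<^bsub>C_fin X M\<^esub> f = (\<lambda>x\<in>topspace X. \<ominus>\<^bsub>M\<^esub> f x)"
proof -
  interpret P: abelian_group "C_fin X M"
    by (rule C_fin_abelian_group)
  show ?thesis
    by (rule P.minus_equality, rule C_fin_ext[where X = X])
      (use assms in \<open>auto simp: C_fin_closed C_fin_minus_closed C_fin_apps C_fin_app[OF assms] M.l_neg\<close>)
qed

text \<open>The inequalities hold pointwise and pass to the supremum. The gap of \<open>M\<close>
  persists unchanged, since a nonzero map has a nonzero value.\<close>

lemma C_fin_isolated_normed: "isolated_normed_module C R (C_fin X M)"
proof -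
  interpret P: module R "C_fin X M"
    by (rule C_fin_module)
  show ?thesis
  proof
    show "0 \<le> ring_norm R a" if "a \<in> carrier R" for a
      using that by (rule ring_norm_nonneg)
    show "0 \<le> mod_norm (C_fin X M) f" if "f \<in> carrier (C_fin X M)" for f
      using that by (rule C_fin_norm_nonneg)
    show "mod_norm (C_fin X M) \<zero>\<^bsub>C_fin X M\<^esub> = 0"
      using C_fin_norm_le[of 0 X "\<zero>\<^bsub>C_fin X M\<^esub>"] C_fin_norm_nonneg[OF C_fin_zero_closed, of X]
      by (simp add: C_fin_zero_app)
    show "mod_norm (C_fin X M) (\<ominus>\<^bsub>C_fin X M\<^esub> f) = mod_norm (C_fin X M) f"
      if f: "f \<in> carrier (C_fin X M)" for f
      unfolding C_fin_norm_eq C_fin_a_inv[OF f]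
      by (rule arg_cong[of _ _ "\<lambda>A. Sup (insert 0 A)"]) (use C_fin_app[OF f] in \<open>auto simp: norm_minus image_iff\<close>)
    show "mod_norm (C_fin X M) (f \<oplus>\<^bsub>C_fin X M\<^esub> g)
        \<le> aggregate C [mod_norm (C_fin X M) f, mod_norm (C_fin X M) g]"
      if f: "f \<in> carrier (C_fin X M)" and g: "g \<in> carrier (C_fin X M)" for f g
    proof (rule C_fin_norm_le)
      show "0 \<le> aggregate C [mod_norm (C_fin X M) f, mod_norm (C_fin X M) g]"
        using C_fin_norm_nonneg f g by (intro aggregate_nonneg) auto
      fix x assume x: "x \<in> topspace X"
      have "mod_norm M ((f \<oplus>\<^bsub>C_fin X M\<^esub> g) x) \<le> aggregate C [mod_norm M (f x), mod_norm M (g x)]"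
        using norm_add_le[OF C_fin_app[OF f x] C_fin_app[OF g x]] x by (simp only: C_fin_add_app)
      also have "\<dots> \<le> aggregate C [mod_norm (C_fin X M) f, mod_norm (C_fin X M) g]"
        by (intro aggregate_pair_mono C_fin_norm_ge f g x)
      finally show "mod_norm M ((f \<oplus>\<^bsub>C_fin X M\<^esub> g) x)
        \<le> aggregate C [mod_norm (C_fin X M) f, mod_norm (C_fin X M) g]" .
    qed
    obtain K where K: "K \<ge> 0" "\<And>a x. a \<in> carrier R \<Longrightarrow> x \<in> carrier M \<Longrightarrow>
        mod_norm M (a \<odot>\<^bsub>M\<^esub> x) \<le> K * ring_norm R a * mod_norm M x"
      using norm_smult_le by blast
    have "mod_norm (C_fin X M) (a \<odot>\<^bsub>C_fin X M\<^esub> f) \<le> K * ring_norm R a * mod_norm (C_fin X M) f"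
      if a: "a \<in> carrier R" and f: "f \<in> carrier (C_fin X M)" for a f
    proof (rule C_fin_norm_le)
      have c: "0 \<le> K * ring_norm R a"
        using K(1) ring_norm_nonneg[OF a] by simp
      then show "0 \<le> K * ring_norm R a * mod_norm (C_fin X M) f"
        using C_fin_norm_nonneg[OF f] by simp
      fix x assume x: "x \<in> topspace X"
      then show "mod_norm M ((a \<odot>\<^bsub>C_fin X M\<^esub> f) x) \<le> K * ring_norm R a * mod_norm (C_fin X M) f"
        using order_trans[OF K(2)[OF a C_fin_app[OF f x]] mult_left_mono[OF C_fin_norm_ge[OF f x] c]]
        by (simp only: C_fin_smult_app)
    qed
    then show "\<exists>K\<ge>0. \<forall>a\<in>carrier R. \<forall>f\<in>carrier (C_fin X M).
        mod_norm (C_fin X M) (a \<odot>\<^bsub>C_fin X M\<^esub> f) \<le> K * ring_norm R a * mod_norm (C_fin X M) f"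
      using K(1) by blast
    obtain \<delta> where \<delta>: "\<delta> > 0" "\<And>x. x \<in> carrier M \<Longrightarrow> x \<noteq> \<zero>\<^bsub>M\<^esub> \<Longrightarrow> \<delta> \<le> mod_norm M x"
      using norm_isolated by blast
    have "\<delta> \<le> mod_norm (C_fin X M) f" if f: "f \<in> carrier (C_fin X M)" "f \<noteq> \<zero>\<^bsub>C_fin X M\<^esub>" for f
    proof -
      obtain x where "x \<in> topspace X" "f x \<noteq> \<zero>\<^bsub>M\<^esub>"
        using C_fin_ext[OF f(1) C_fin_zero_closed] f(2) by (auto simp: C_fin_zero_app)
      then show ?thesis
        using order_trans[OF \<delta>(2) C_fin_norm_ge[OF f(1)]] C_fin_app[OF f(1)] by blast
    qed
    then show "\<exists>\<delta>>0. \<forall>f\<in>carrier (C_fin X M). f \<noteq> \<zero>\<^bsub>C_fin X M\<^esub> \<longrightarrow> \<delta> \<le> mod_norm (C_fin X M) f"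
      using \<delta>(1) by blast
  qed
qed

end

section \<open>The natural map\<close>

text \<open>Evaluation at \<open>x\<close> tensored with the identity, on the level of
  presentations.\<close>

definition eval_at :: "'x \<Rightarrow> (('x \<Rightarrow> 'm) \<times> 'n) list \<Rightarrow> ('m \<times> 'n) list" where
  "eval_at x ps = map (\<lambda>(f, y). (f x, y)) ps"

lemma completed_pure_tensor_eq:
  "completed_pure_tensor C R M N x y = to_completion (tensor C R M N) (tensor_sum R M N [(x, y)])"
  by (simp add: completed_pure_tensor_def pure_tensor_def tensor_sum_def)

locale C_fin_tensor =
  fixes C :: base_category and R :: "'r normed_ring" and X :: "'x topology"
    and M0 :: "('r, 'm) normed_module" and M1 :: "('r, 'n) normed_module"
  assumes isolated_M0: "isolated_normed_module C R M0" and isolated_M1: "isolated_normed_module C R M1"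
begin

abbreviation "P \<equiv> C_fin X M0"
abbreviation "T0 \<equiv> tensor C R M0 M1"
abbreviation "W \<equiv> C_fin X (completed_tensor C R M0 M1)"
abbreviation "alg \<equiv> alg_nat_map C R X M0 M1"
abbreviation "tc \<equiv> to_completion (tensor C R M0 M1)"
abbreviation "PT \<equiv> tensor C R (C_fin X M0) M1"
abbreviation "CT \<equiv> completed_tensor C R M0 M1"
abbreviation "ten0 \<equiv> tensor_sum R M0 M1"
abbreviation "ten \<equiv> tensor_sum R (C_fin X M0) M1"

sublocale M0: isolated_normed_module C R M0 by (rule isolated_M0)
sublocale M1: isolated_normed_module C R M1 by (rule isolated_M1)
sublocale P: isolated_normed_module C R "C_fin X M0" by (rule M0.C_fin_isolated_normed)
sublocale M0M1: isolated_pair C R M0 M1 by unfold_locales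
sublocale PM1: isolated_pair C R "C_fin X M0" M1 by unfold_locales
sublocale T0: isolated_normed_module C R "tensor C R M0 M1" by (rule M0M1.tensor_isolated_normed)
sublocale T: isolated_normed_module C R "tensor C R (C_fin X M0) M1" by (rule PM1.tensor_isolated_normed)
sublocale CT: isolated_normed_module C R "completed_tensor C R M0 M1"
  unfolding completed_tensor_def by (rule T0.completion_isolated_normed)
sublocale W: isolated_normed_module C R "C_fin X (completed_tensor C R M0 M1)"
  by (rule CT.C_fin_isolated_normed)

lemma eval_at_subset:
  "set ps \<subseteq> carrier P \<times> carrier M1 \<Longrightarrow> x \<in> topspace X \<Longrightarrow> set (eval_at x ps) \<subseteq> carrier M0 \<times> carrier M1"
  by (auto simp: eval_at_def M0.C_fin_app)

lemma tc_closed: "t \<in> carrier T0 \<Longrightarrow> tc t \<in> carrier CT"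
  using T0.to_completion_bij by (auto simp: bij_betw_def completed_tensor_def)

lemma tc_inj: "s \<in> carrier T0 \<Longrightarrow> t \<in> carrier T0 \<Longrightarrow> tc s = tc t \<longleftrightarrow> s = t"
  using T0.to_completion_bij by (auto simp: bij_betw_def inj_on_def)

lemma tc_norm: "t \<in> carrier T0 \<Longrightarrow> mod_norm CT (tc t) = mod_norm T0 t"
  by (simp add: completed_tensor_def T0.to_completion_norm)

lemmas tc_hom = T0.to_completion_add[folded completed_tensor_def]
  T0.to_completion_smult[folded completed_tensor_def]
  T0.to_completion_zero[folded completed_tensor_def]

section \<open>The natural homomorphism and its values\<close>

abbreviation "B \<equiv> (\<lambda>f y. \<lambda>x\<in>topspace X. completed_pure_tensor C R M0 M1 (f x) y)"

lemma B_app: "x \<in> topspace X \<Longrightarrow> B f y x = tc (ten0 [(f x, y)])"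
  by (simp add: completed_pure_tensor_eq)

lemma B_closed:
  assumes "f \<in> carrier P" "y \<in> carrier M1"
  shows "B f y \<in> carrier W"
  by (rule CT.C_fin_restrictI)
    (use assms M0.C_fin_app in \<open>auto simp: completed_pure_tensor_eq M0.C_fin_carrier_iff intro!: tc_closed M0M1.tensor_sum_closed\<close>)

lemma B_balanced: "balanced R P M1 W B"
  unfolding balanced_def
proof (intro conjI ballI)
  note bal = M0M1.pure_tensor_balanced[of C, unfolded balanced_def]
  fix f y assume fy: "f \<in> carrier P" "y \<in> carrier M1"
  show closed: "B f y \<in> carrier W"
    using fy by (rule B_closed)
  {
    fix g assume g: "g \<in> carrier P"
    show "B (f \<oplus>\<^bsub>P\<^esub> g) y = B f y \<oplus>\<^bsub>W\<^esub> B g y"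
      by (rule CT.C_fin_ext[where X = X])
        (use fy g bal in \<open>simp_all add: B_closed CT.C_fin_closed M0.C_fin_closed CT.C_fin_apps M0.C_fin_apps B_app
          M0.C_fin_app M0M1.tensor_sum_closed tc_hom del: restrict_apply restrict_apply'\<close>)
  }
  {
    fix z assume z: "z \<in> carrier M1"
    show "B f (y \<oplus>\<^bsub>M1\<^esub> z) = B f y \<oplus>\<^bsub>W\<^esub> B f z"
      by (rule CT.C_fin_ext[where X = X])
        (use fy z bal in \<open>simp_all add: B_closed CT.C_fin_closed CT.C_fin_apps B_app
          M0.C_fin_app M0M1.tensor_sum_closed tc_hom del: restrict_apply restrict_apply'\<close>)
  }
next
  note bal = M0M1.pure_tensor_balanced[of C, unfolded balanced_def]
  fix a f y assume fy: "a \<in> carrier R" "f \<in> carrier P" "y \<in> carrier M1"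
  show "B (a \<odot>\<^bsub>P\<^esub> f) y = B f (a \<odot>\<^bsub>M1\<^esub> y)"
    by (rule CT.C_fin_ext[where X = X])
      (use fy bal in \<open>simp_all add: B_closed M0.C_fin_closed M0.C_fin_apps B_app
        M0.C_fin_app del: restrict_apply restrict_apply'\<close>)
qed

text \<open>Reduces every question about \<open>alg\<close> to presentations over \<open>M0\<close>,
  one point at a time.\<close>

lemma alg_tensor_sum:
  assumes ps: "set ps \<subseteq> carrier P \<times> carrier M1"
  shows "alg (ten ps) = (\<lambda>x\<in>topspace X. tc (ten0 (eval_at x ps)))"
    and "alg (ten ps) \<in> carrier W"
proof -
  have alg: "alg (ten ps) = foldr (\<lambda>(f, y) v. B f y \<oplus>\<^bsub>W\<^esub> v) ps \<zero>\<^bsub>W\<^esub>"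
    unfolding alg_nat_map_def
    by (rule PM1.tensor_lift_tensor_sum[OF W.M.abelian_group_axioms B_balanced ps])
  have *: "foldr (\<lambda>(f, y) v. B f y \<oplus>\<^bsub>W\<^esub> v) ps \<zero>\<^bsub>W\<^esub> \<in> carrier W \<and>
      (\<forall>x\<in>topspace X. foldr (\<lambda>(f, y) v. B f y \<oplus>\<^bsub>W\<^esub> v) ps \<zero>\<^bsub>W\<^esub> x = tc (ten0 (eval_at x ps)))"
    using ps
  proof (induction ps)
    case Nil
    then show ?case
      by (simp add: eval_at_def CT.C_fin_zero_app tc_hom(3)[symmetric] M0M1.tensor_zero)
  next
    case (Cons p ps)
    obtain f y where p: "p = (f, y)" by fastforce
    have fy: "f \<in> carrier P" "y \<in> carrier M1" and ps: "set ps \<subseteq> carrier P \<times> carrier M1"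
      using Cons.prems by (auto simp: p)
    have "tc (ten0 (eval_at x (p # ps))) =
        tc (ten0 [(f x, y)]) \<oplus>\<^bsub>CT\<^esub> tc (ten0 (eval_at x ps))"
      if x: "x \<in> topspace X" for x
    proof -
      have "set [(f x, y)] \<subseteq> carrier M0 \<times> carrier M1" "set (eval_at x ps) \<subseteq> carrier M0 \<times> carrier M1"
        using fy x M0.C_fin_app eval_at_subset[OF ps x] by auto
      then show ?thesis
        using M0M1.tensor_add[of "[(f x, y)]" "eval_at x ps" C]
        by (simp add: tc_hom(1)[symmetric] M0M1.tensor_sum_closed eval_at_def p)
    qed
    then show ?case
      using Cons.IH[OF ps] B_closed[OF fy]
      by (simp add: p CT.C_fin_add_closed CT.C_fin_add_app B_app del: restrict_apply restrict_apply')
  qed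
  show "alg (ten ps) \<in> carrier W"
    using * alg by simp
  then show "alg (ten ps) = (\<lambda>x\<in>topspace X. tc (ten0 (eval_at x ps)))"
    using * alg by (intro extensionalityI[of _ "topspace X"]) (auto simp: CT.C_fin_carrier_iff PiE_iff)
qed

lemma alg_app:
  "set ps \<subseteq> carrier P \<times> carrier M1 \<Longrightarrow> x \<in> topspace X \<Longrightarrow>
    alg (ten ps) x = tc (ten0 (eval_at x ps))"
  by (simp add: alg_tensor_sum(1))

lemma alg_linear: "R_linear R PT W alg"
  unfolding R_linear_def
proof (intro conjI ballI funcsetI)
  fix S assume S: "S \<in> carrier PT"
  then show "alg S \<in> carrier W"
    using alg_tensor_sum(2) by (auto elim!: PM1.tensor_cases)
next
  fix S S' assume "S \<in> carrier PT" "S' \<in> carrier PT"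
  then obtain ps qs where S: "set ps \<subseteq> carrier P \<times> carrier M1" "S = ten ps"
    "set qs \<subseteq> carrier P \<times> carrier M1" "S' = ten qs"
    by (metis PM1.tensor_cases)
  then have pq: "set (ps @ qs) \<subseteq> carrier P \<times> carrier M1"
    by simp
  have "alg (ten (ps @ qs)) = alg S \<oplus>\<^bsub>W\<^esub> alg S'"
  proof (rule CT.C_fin_ext[where X = X])
    fix x assume x: "x \<in> topspace X"
    show "alg (ten (ps @ qs)) x = (alg S \<oplus>\<^bsub>W\<^esub> alg S') x"
      using x S M0M1.tensor_add[OF eval_at_subset[OF S(1) x] eval_at_subset[OF S(3) x], of C]
      by (simp add: alg_app[OF pq x] alg_app CT.C_fin_add_app tc_hom(1)[symmetric] M0M1.tensor_sum_closed
          eval_at_subset) (simp add: eval_at_def)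
  qed (use S pq alg_tensor_sum(2) CT.C_fin_add_closed in auto)
  then show "alg (S \<oplus>\<^bsub>PT\<^esub> S') = alg S \<oplus>\<^bsub>W\<^esub> alg S'"
    using S by (simp add: PM1.tensor_add)
next
  fix a S assume a: "a \<in> carrier R" and "S \<in> carrier PT"
  then obtain ps where S: "set ps \<subseteq> carrier P \<times> carrier M1" "S = ten ps"
    by (metis PM1.tensor_cases)
  let ?qs = "map (\<lambda>(f, y). (a \<odot>\<^bsub>P\<^esub> f, y)) ps"
  have qs: "set ?qs \<subseteq> carrier P \<times> carrier M1"
    using S(1) a by (intro PM1.map_left_subset) auto
  have "alg (ten ?qs) = a \<odot>\<^bsub>W\<^esub> alg S"
  proof (rule CT.C_fin_ext[where X = X])
    fix x assume x: "x \<in> topspace X"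
    have "eval_at x ?qs = map (\<lambda>(m, y). (a \<odot>\<^bsub>M0\<^esub> m, y)) (eval_at x ps)"
      using x by (auto simp: eval_at_def M0.C_fin_smult_app)
    then show "alg (ten ?qs) x = (a \<odot>\<^bsub>W\<^esub> alg S) x"
      using x S M0M1.tensor_smult[OF a eval_at_subset[OF S(1) x], of C]
      by (simp add: alg_app[OF qs x] alg_app CT.C_fin_smult_app tc_hom(2)[symmetric] a
          M0M1.tensor_sum_closed eval_at_subset del: map_map)
  qed (use S qs a alg_tensor_sum(2) CT.C_fin_smult_closed in auto)
  then show "alg (a \<odot>\<^bsub>PT\<^esub> S) = a \<odot>\<^bsub>W\<^esub> alg S"
    using S a by (simp add: PM1.tensor_smult)
qed

text \<open>Evaluating a presentation at a point only decreases the norms of its left factors. The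
  weight of one presentation thus bounds all values simultaneously.\<close>

lemma alg_norm_le:
  assumes "S \<in> carrier PT"
  shows "mod_norm W (alg S) \<le> mod_norm PT S"
proof (rule PM1.tensor_norm_ge[OF assms])
  fix ps assume ps: "set ps \<subseteq> carrier P \<times> carrier M1" "S = ten ps"
  show "mod_norm W (alg S) \<le> aggregate C (map (pair_norm P M1) ps)"
  proof (rule CT.C_fin_norm_le)
    show "0 \<le> aggregate C (map (pair_norm P M1) ps)"
      using ps(1) by (rule PM1.aggregate_pair_norm_nonneg)
    fix x assume x: "x \<in> topspace X"
    have "mod_norm CT (alg S x) = mod_norm T0 (ten0 (eval_at x ps))"
      using ps x by (simp add: alg_app tc_norm M0M1.tensor_sum_closed eval_at_subset)
    also have "\<dots> \<le> aggregate C (map (pair_norm M0 M1) (eval_at x ps))"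
      by (rule M0M1.tensor_norm_le[OF eval_at_subset[OF ps(1) x]])
    also have "\<dots> = aggregate C (map (\<lambda>p. pair_norm M0 M1 (fst p x, snd p)) ps)"
      by (simp add: eval_at_def comp_def case_prod_unfold)
    also have "\<dots> \<le> aggregate C (map (pair_norm P M1) ps)"
    proof (rule aggregate_mono)
      fix p assume "p \<in> set ps"
      then have "fst p \<in> carrier P" "snd p \<in> carrier M1"
        using ps(1) by auto
      then show "pair_norm M0 M1 (fst p x, snd p) \<le> pair_norm P M1 p"
        using x by (simp add: pair_norm_def case_prod_unfold mult_right_mono M0.C_fin_norm_ge M1.norm_nonneg)
    qed
    finally show "mod_norm CT (alg S x) \<le> aggregate C (map (pair_norm P M1) ps)" .
  qed
qed

section \<open>Injectivity by extension from level sets\<close>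

lemma single_value_closed:
  assumes "locally_constant X g" "m \<in> carrier M0"
  shows "(\<lambda>x\<in>topspace X. if g x = v then m else \<zero>\<^bsub>M0\<^esub>) \<in> carrier P"
proof (rule M0.C_fin_restrictI[where g = "\<lambda>x. g x = v" and h = "\<lambda>b. if b then m else \<zero>\<^bsub>M0\<^esub>"])
  show "locally_constant X (\<lambda>x. g x = v)"
    using assms(1) by (rule locally_constant_compose)
  show "finite ((\<lambda>x. g x = v) ` topspace X)"
    by (rule finite_subset[of _ UNIV]) auto
qed (use assms(2) in auto)

text \<open>Extension by zero from a level set is linear in the value; hence, by
  \<open>tensor_sum_map_left\<close>, relations over \<open>M0\<close> induce relations over the
  space of maps.\<close>

lemma single_value_linear:
  assumes "locally_constant X g"
  shows "R_linear R M0 P (\<lambda>m. \<lambda>x\<in>topspace X. if g x = v then m else \<zero>\<^bsub>M0\<^esub>)"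
  unfolding R_linear_def
  by (intro conjI ballI funcsetI M0.C_fin_ext[where X = X])
    (auto simp: single_value_closed assms M0.C_fin_closed M0.C_fin_apps simp del: restrict_apply' split: if_splits)

text \<open>The kernel of the natural map is trivial: cut the functions occurring in a presentation along the
  finitely many level sets of the tuple of all these functions; on each level set, the presentation
  comes from a presentation over \<open>M0\<close>.\<close>

lemma tensor_sum_eq_zeroI:
  assumes ps: "set ps \<subseteq> carrier P \<times> carrier M1"
    and zero: "\<And>x. x \<in> topspace X \<Longrightarrow> ten0 (eval_at x ps) = ten0 []"
  shows "ten ps = ten []"
proof -
  have car: "fst p \<in> carrier P" "snd p \<in> carrier M1" if "p \<in> set ps" for p
    using ps that by auto
  define \<rho> where "\<rho> x = map (\<lambda>p. fst p x) ps" for x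
  have lc: "locally_constant X \<rho>"
    unfolding \<rho>_def by (rule locally_constant_map) (use car in \<open>auto simp: M0.C_fin_carrier_iff\<close>)
  have fin: "finite (\<rho> ` topspace X)"
  proof (rule finite_subset)
    show "\<rho> ` topspace X \<subseteq> {xs. set xs \<subseteq> (\<Union>p\<in>set ps. fst p ` topspace X) \<and> length xs = length ps}"
      unfolding \<rho>_def by force
    show "finite {xs. set xs \<subseteq> (\<Union>p\<in>set ps. fst p ` topspace X) \<and> length xs = length ps}"
      by (rule finite_lists_length_eq) (use car in \<open>auto simp: M0.C_fin_carrier_iff\<close>)
  qed
  define cut where "cut A f = (\<lambda>x\<in>topspace X. if \<rho> x \<in> A then f x else \<zero>\<^bsub>M0\<^esub>)" for A and f :: "'x \<Rightarrow> 'm"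
  have cut_app: "cut A f x = (if \<rho> x \<in> A then f x else \<zero>\<^bsub>M0\<^esub>)" if "x \<in> topspace X" for A f x
    using that by (simp add: cut_def)
  have cut_closed: "cut A f \<in> carrier P" if f: "f \<in> carrier P" for A f
    unfolding cut_def
    by (rule M0.C_fin_restrict2I) (use lc fin f in \<open>auto simp: M0.C_fin_carrier_iff\<close>)
  have cut_list: "set (map (\<lambda>p. (cut A (fst p), snd p)) ps) \<subseteq> carrier P \<times> carrier M1" for A
    using car cut_closed by auto
  have single: "ten (map (\<lambda>p. (cut {\<rho> x} (fst p), snd p)) ps) = ten []"
    if x: "x \<in> topspace X" for x
  proof -
    \<comment> \<open>On the level set of \<open>x\<close> all functions are constant. The cut
      presentation is therefore obtained by applying \<open>?\<phi>\<close> to the left factors of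
      the presentation at \<open>x\<close>, which presents 0 by \<open>zero\<close>.\<close>
    let ?\<phi> = "\<lambda>m. \<lambda>y\<in>topspace X. if \<rho> y = \<rho> x then m else \<zero>\<^bsub>M0\<^esub>"
    have "cut {\<rho> x} (fst p) = ?\<phi> (fst p x)" if "p \<in> set ps" for p
      using that by (auto simp: cut_def \<rho>_def fun_eq_iff restrict_def)
    then have "map (\<lambda>p. (cut {\<rho> x} (fst p), snd p)) ps = map (\<lambda>(m, y). (?\<phi> m, y)) (eval_at x ps)"
      by (fastforce simp: eval_at_def)
    moreover have "ten (map (\<lambda>(m, y). (?\<phi> m, y)) (eval_at x ps)) =
        ten (map (\<lambda>(m, y). (?\<phi> m, y)) [])"
      by (rule tensor_sum_map_left[OF M0M1.module_pair_axioms PM1.module_pair_axioms single_value_linear[OF lc]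
            eval_at_subset[OF ps x] _ zero[OF x]]) simp
    ultimately show ?thesis
      by simp
  qed
  have "ten (map (\<lambda>p. (cut A (fst p), snd p)) ps) = ten []"
    if "finite A" "A \<subseteq> \<rho> ` topspace X" for A
    using that
  proof (induction A rule: finite_induct)
    case empty
    have "cut {} f = \<zero>\<^bsub>P\<^esub>" for f
      by (simp add: cut_def C_fin_def)
    then show ?case
      using car by (intro PM1.tensor_sum_zero) auto
  next
    case (insert l A)
    then obtain x where x: "x \<in> topspace X" "l = \<rho> x"
      by auto
    \<comment> \<open>Since \<open>l\<close> is not in \<open>A\<close>, at each point at most one
      of the two summands differs from 0.\<close>
    have "cut (insert l A) f = cut {l} f \<oplus>\<^bsub>P\<^esub> cut A f" if f: "f \<in> carrier P" for f
      by (rule M0.C_fin_ext[where X = X])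
        (use f insert(2) in \<open>auto simp: cut_closed cut_app M0.C_fin_closed M0.C_fin_apps M0.C_fin_app\<close>)
    then have eq: "map (\<lambda>p. (cut (insert l A) (fst p), snd p)) ps =
        map (\<lambda>p. (cut {l} (fst p) \<oplus>\<^bsub>P\<^esub> cut A (fst p), snd p)) ps"
      using car by simp
    have "ten (map (\<lambda>p. (cut (insert l A) (fst p), snd p)) ps) =
        ten (map (\<lambda>p. (cut {l} (fst p), snd p)) ps @ map (\<lambda>p. (cut A (fst p), snd p)) ps)"
      using PM1.tensor_sum_add_left[of ps "\<lambda>p. cut {l} (fst p)" "\<lambda>p. cut A (fst p)" snd] car cut_closed
      unfolding eq by blast
    also have "\<dots> = ten (map (\<lambda>p. (cut {l} (fst p), snd p)) ps)
        \<oplus>\<^bsub>PT\<^esub> ten (map (\<lambda>p. (cut A (fst p), snd p)) ps)"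
      by (rule PM1.tensor_add[OF cut_list cut_list, symmetric])
    also have "\<dots> = ten []"
      using insert x single by (simp add: PM1.tensor_add)
    finally show ?case .
  qed
  \<comment> \<open>Every point lies in one of the level sets, so cutting along all of them changes
    nothing.\<close>
  moreover have "map (\<lambda>p. (cut (\<rho> ` topspace X) (fst p), snd p)) ps = ps"
  proof (rule map_idI)
    fix p assume "p \<in> set ps"
    then have "cut (\<rho> ` topspace X) (fst p) = fst p"
      using car cut_closed by (intro M0.C_fin_ext[where X = X]) (auto simp: cut_app)
    then show "(cut (\<rho> ` topspace X) (fst p), snd p) = p"
      by simp
  qed
  ultimately show ?thesis
    using fin by fastforce
qed

lemma alg_inj: "inj_on alg (carrier PT)"
proof (rule inj_onI)
  fix S S' assume S: "S \<in> carrier PT" "S' \<in> carrier PT" "alg S = alg S'"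
  \<comment> \<open>The vanishing criterion concerns a single presentation, so it is applied to one
    of the difference.\<close>
  let ?D = "S \<ominus>\<^bsub>PT\<^esub> S'"
  have D: "?D \<in> carrier PT"
    using S by simp
  have alg_car: "alg U \<in> carrier W" if "U \<in> carrier PT" for U
    using alg_linear that by (auto simp: R_linear_def)
  have alg_add: "alg (U \<oplus>\<^bsub>PT\<^esub> V) = alg U \<oplus>\<^bsub>W\<^esub> alg V"
    if "U \<in> carrier PT" "V \<in> carrier PT" for U V
    using alg_linear that by (auto simp: R_linear_def)
  have "?D \<oplus>\<^bsub>PT\<^esub> S' = S"
    using S by (simp add: T.M.minus_eq T.M.a_assoc T.M.l_neg)
  then have "alg ?D \<oplus>\<^bsub>W\<^esub> alg S' = alg S'"
    using alg_add[OF D S(2)] S(3) by simp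
  then have algD: "alg ?D = \<zero>\<^bsub>W\<^esub>"
    using alg_car[OF D] alg_car[OF S(2)] by simp
  obtain ps where ps: "set ps \<subseteq> carrier P \<times> carrier M1" "?D = ten ps"
    using D by (rule PM1.tensor_cases)
  have "ten0 (eval_at x ps) = ten0 []" if x: "x \<in> topspace X" for x
  proof -
    have "tc (ten0 (eval_at x ps)) = tc (\<zero>\<^bsub>T0\<^esub>)"
      using algD ps x alg_app[OF ps(1) x] by (simp add: CT.C_fin_zero_app tc_hom(3))
    then show ?thesis
      using tc_inj M0M1.tensor_sum_closed eval_at_subset[OF ps(1) x] T0.M.zero_closed by (simp add: M0M1.tensor_zero)
  qed
  then have "?D = \<zero>\<^bsub>PT\<^esub>"
    using tensor_sum_eq_zeroI[OF ps(1)] ps(2) by (simp add: PM1.tensor_zero)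
  then show "S = S'"
    using S by (simp add: T.M.minus_eq_zero_iff)
qed

text \<open>Injectivity in the form used for norm estimates: a list with the right values presents
  \<open>S\<close> itself, so its weight bounds the norm of \<open>S\<close>.\<close>

lemma alg_eqI:
  assumes "set ps \<subseteq> carrier P \<times> carrier M1" "S \<in> carrier PT"
    and "\<And>x. x \<in> topspace X \<Longrightarrow> alg S x = tc (ten0 (eval_at x ps))"
  shows "S = ten ps"
proof -
  have "alg S = alg (ten ps)"
    by (rule CT.C_fin_ext[where X = X])
      (use assms alg_linear alg_tensor_sum(2) in \<open>auto simp: R_linear_def alg_app\<close>)
  then show ?thesis
    using alg_inj assms PM1.tensor_sum_closed by (auto simp: inj_on_def)
qed

end

section \<open>Surjectivity and estimates for the inverse\<close>

context C_fin_tensor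
begin

text \<open>A presentation over \<open>M0\<close> of each of the finitely many values of \<open>g\<close> is spread out
  over the corresponding level set of \<open>g\<close>.\<close>

lemma spread_presentations:
  assumes g: "locally_constant X g" "finite (g ` topspace X)"
    and qs: "\<And>v. v \<in> g ` topspace X \<Longrightarrow> set (qs v) \<subseteq> carrier M0 \<times> carrier M1"
  obtains ps where "set ps \<subseteq> carrier P \<times> carrier M1"
    "\<And>x. x \<in> topspace X \<Longrightarrow> ten0 (eval_at x ps) = ten0 (qs (g x))"
    "\<And>p. p \<in> set ps \<Longrightarrow> \<exists>v\<in>g ` topspace X. \<exists>q\<in>set (qs v). pair_norm P M1 p \<le> pair_norm M0 M1 q"
proof -
  define ind where "ind v m = (\<lambda>x\<in>topspace X. if g x = v then m else \<zero>\<^bsub>M0\<^esub>)" for v m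
  have ind_closed: "ind v m \<in> carrier P" if "m \<in> carrier M0" for v m
    unfolding ind_def using g(1) that by (rule single_value_closed)
  define part where "part v = map (\<lambda>(m, y). (ind v m, y)) (qs v)" for v
  have part_subset: "set (part v) \<subseteq> carrier P \<times> carrier M1" if "v \<in> g ` topspace X" for v
    using qs[OF that] ind_closed by (auto simp: part_def)
  obtain vs where vs: "set vs = g ` topspace X" "distinct vs"
    using finite_distinct_list[OF g(2)] by blast
  \<comment> \<open>On its level set the part returns the chosen presentation; elsewhere all left
    factors are 0.\<close>
  have part_eval: "ten0 (eval_at x (part v)) = ten0 (if g x = v then qs v else [])"
    if v: "v \<in> g ` topspace X" and x: "x \<in> topspace X" for x v
  proof (cases "g x = v")
    case True
    then have "eval_at x (part v) = qs v"
      using x by (auto simp: eval_at_def part_def ind_def intro!: map_idI)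
    then show ?thesis
      using True by simp
  next
    case False
    then have "ten0 (eval_at x (part v)) = ten0 []"
      using x qs[OF v] by (intro M0M1.tensor_sum_zero) (auto simp: eval_at_def part_def ind_def)
    then show ?thesis
      using False by simp
  qed
  \<comment> \<open>Distinctness matters: a repeated value would contribute its presentation
    twice.\<close>
  have concat_eval: "ten0 (eval_at x (concat (map part us))) =
      ten0 (if g x \<in> set us then qs (g x) else [])"
    if us: "distinct us" "set us \<subseteq> g ` topspace X" and x: "x \<in> topspace X" for us x
    using us
  proof (induction us)
    case (Cons v us)
    have v: "v \<in> g ` topspace X" and us: "set us \<subseteq> g ` topspace X" "distinct us" "v \<notin> set us"
      using Cons.prems by auto
    have c: "set (eval_at x (part v)) \<subseteq> carrier M0 \<times> carrier M1"
      by (rule eval_at_subset[OF part_subset[OF v] x])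
    have "set (concat (map part us)) \<subseteq> carrier P \<times> carrier M1"
      using part_subset us(1) by fastforce
    then have d: "set (eval_at x (concat (map part us))) \<subseteq> carrier M0 \<times> carrier M1"
      using x by (rule eval_at_subset)
    have e: "set (if g x = v then qs v else []) \<subseteq> carrier M0 \<times> carrier M1"
      "set (if g x \<in> set us then qs (g x) else []) \<subseteq> carrier M0 \<times> carrier M1"
      using qs x by auto
    have "ten0 (eval_at x (concat (map part (v # us)))) =
        ten0 (eval_at x (part v)) \<oplus>\<^bsub>T0\<^esub> ten0 (eval_at x (concat (map part us)))"
      using M0M1.tensor_add[OF c d, of C] by (simp add: eval_at_def)
    also have "\<dots> = ten0 ((if g x = v then qs v else []) @ (if g x \<in> set us then qs (g x) else []))"
      using M0M1.tensor_add[OF e, of C] Cons.IH us part_eval[OF v x] by simp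
    finally show ?case
      using us(3) by auto
  qed (simp add: eval_at_def)
  show thesis
  proof (rule that)
    show "set (concat (map part vs)) \<subseteq> carrier P \<times> carrier M1"
      using part_subset vs(1) by fastforce
    show "ten0 (eval_at x (concat (map part vs))) = ten0 (qs (g x))"
      if x: "x \<in> topspace X" for x
      using concat_eval[OF vs(2) _ x] vs(1) x by simp
    fix p assume "p \<in> set (concat (map part vs))"
    then obtain v m y where v: "v \<in> g ` topspace X" and q: "(m, y) \<in> set (qs v)" and p: "p = (ind v m, y)"
      using vs(1) by (auto simp: part_def)
    have my: "m \<in> carrier M0" "y \<in> carrier M1"
      using qs[OF v] q by auto
    \<comment> \<open>Extension by zero does not enlarge the norm, so each term weighs no more than
      the term it comes from.\<close>
    have "mod_norm P (ind v m) \<le> mod_norm M0 m"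
      by (rule M0.C_fin_norm_le) (use my in \<open>auto simp: ind_def M0.norm_nonneg\<close>)
    then have "pair_norm P M1 p \<le> pair_norm M0 M1 (m, y)"
      using my by (simp add: p pair_norm_def mult_right_mono M1.norm_nonneg)
    then show "\<exists>v\<in>g ` topspace X. \<exists>q\<in>set (qs v). pair_norm P M1 p \<le> pair_norm M0 M1 q"
      using v q by blast
  qed
qed

text \<open>Completion adds no elements, so \<open>w\<close> can be pulled back pointwise to the
  algebraic tensor product; the inverse of \<open>tc\<close> preserves local constancy and
  finiteness as any function does.\<close>

lemma W_valuesE:
  assumes "w \<in> carrier W"
  obtains u where "locally_constant X u" "finite (u ` topspace X)"
    "\<And>x. x \<in> topspace X \<Longrightarrow> u x \<in> carrier T0 \<and> w x = tc (u x)"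
proof -
  define u where "u = (\<lambda>x. inv_into (carrier T0) tc (w x))"
  show thesis
  proof (rule that)
    show "locally_constant X u"
      unfolding u_def by (rule locally_constant_compose) (use assms in \<open>auto simp: CT.C_fin_carrier_iff\<close>)
    have "u ` topspace X = inv_into (carrier T0) tc ` w ` topspace X"
      by (auto simp: u_def)
    then show "finite (u ` topspace X)"
      using assms by (simp add: CT.C_fin_carrier_iff)
    fix x assume x: "x \<in> topspace X"
    then have "w x \<in> tc ` carrier T0"
      using CT.C_fin_app[OF assms x] T0.to_completion_bij by (simp add: bij_betw_def completed_tensor_def)
    then show "u x \<in> carrier T0 \<and> w x = tc (u x)"
      unfolding u_def by (simp add: inv_into_into f_inv_into_f)
  qed
qed

lemma alg_surj: "alg ` carrier PT = carrier W"
proof (intro equalityI subsetI)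
  fix w assume w: "w \<in> carrier W"
  obtain u where u: "locally_constant X u" "finite (u ` topspace X)"
    "\<And>x. x \<in> topspace X \<Longrightarrow> u x \<in> carrier T0 \<and> w x = tc (u x)"
    by (rule W_valuesE[OF w], rule that)
  have "\<exists>qs. set qs \<subseteq> carrier M0 \<times> carrier M1 \<and> v = ten0 qs" if "v \<in> u ` topspace X" for v
  proof -
    have "v \<in> carrier T0"
      using that u(3) by blast
    then show ?thesis
      by (auto simp: M0M1.tensor_carrier)
  qed
  then have "\<exists>qs. \<forall>v\<in>u ` topspace X. set (qs v) \<subseteq> carrier M0 \<times> carrier M1 \<and> v = ten0 (qs v)"
    by (intro bchoice ballI)
  then obtain qs where "\<forall>v\<in>u ` topspace X. set (qs v) \<subseteq> carrier M0 \<times> carrier M1 \<and> v = ten0 (qs v)" ..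
  then have qs: "\<And>v. v \<in> u ` topspace X \<Longrightarrow> set (qs v) \<subseteq> carrier M0 \<times> carrier M1"
    "\<And>v. v \<in> u ` topspace X \<Longrightarrow> v = ten0 (qs v)"
    by blast+
  obtain ps where ps: "set ps \<subseteq> carrier P \<times> carrier M1"
    "\<And>x. x \<in> topspace X \<Longrightarrow> ten0 (eval_at x ps) = ten0 (qs (u x))"
    by (rule spread_presentations[OF u(1,2) qs(1)], assumption, rule that)
  have "w = alg (ten ps)"
    by (rule CT.C_fin_ext[where X = X]) (use w ps u(3) qs(2) alg_tensor_sum(2) in \<open>simp_all add: alg_app flip: qs(2)\<close>)
  then show "w \<in> alg ` carrier PT"
    using ps(1) PM1.tensor_sum_closed by blast
qed (use alg_linear in \<open>auto simp: R_linear_def\<close>)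

lemma alg_bij: "bij_betw alg (carrier PT) (carrier W)"
  using alg_inj alg_surj by (simp add: bij_betw_def)

lemma aggregate_nA_le:
  "0 \<le> c \<Longrightarrow> (\<And>t. t \<in> set ts \<Longrightarrow> t \<le> c) \<Longrightarrow> aggregate Ab_nA ts \<le> c"
  by simp

text \<open>For the inequality beyond \<open>alg_norm_le\<close>, each value of \<open>alg S\<close>
  is presented optimally up to \<open>e\<close>. Every term of the spread presentation descends from
  a single value, so it weighs at most the norm of that value plus \<open>e\<close>.\<close>

lemma alg_isometric:
  assumes nA: "C = Ab_nA" and S: "S \<in> carrier PT"
  shows "mod_norm W (alg S) = mod_norm PT S"
proof (rule antisym[OF alg_norm_le[OF S] field_le_epsilon])
  fix e :: real assume e: "e > 0"
  have w: "alg S \<in> carrier W"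
    using S alg_surj by blast
  obtain u where u: "locally_constant X u" "finite (u ` topspace X)"
    "\<And>x. x \<in> topspace X \<Longrightarrow> u x \<in> carrier T0 \<and> alg S x = tc (u x)"
    by (rule W_valuesE[OF w], rule that)
  have "\<exists>qs. set qs \<subseteq> carrier M0 \<times> carrier M1 \<and> v = ten0 qs \<and>
      aggregate C (map (pair_norm M0 M1) qs) < mod_norm T0 v + e" if "v \<in> u ` topspace X" for v
  proof -
    have "v \<in> carrier T0"
      using that u(3) by blast
    then show ?thesis
      using e by (rule M0M1.tensor_norm_approx) blast
  qed
  then have "\<exists>qs. \<forall>v\<in>u ` topspace X. set (qs v) \<subseteq> carrier M0 \<times> carrier M1 \<and> v = ten0 (qs v) \<and>
      aggregate C (map (pair_norm M0 M1) (qs v)) < mod_norm T0 v + e"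
    by (intro bchoice ballI)
  then obtain qs where "\<forall>v\<in>u ` topspace X. set (qs v) \<subseteq> carrier M0 \<times> carrier M1 \<and> v = ten0 (qs v) \<and>
      aggregate C (map (pair_norm M0 M1) (qs v)) < mod_norm T0 v + e" ..
  then have qs: "\<And>v. v \<in> u ` topspace X \<Longrightarrow> set (qs v) \<subseteq> carrier M0 \<times> carrier M1"
    "\<And>v. v \<in> u ` topspace X \<Longrightarrow> v = ten0 (qs v)"
    "\<And>v. v \<in> u ` topspace X \<Longrightarrow> aggregate C (map (pair_norm M0 M1) (qs v)) < mod_norm T0 v + e"
    by blast+
  obtain ps where ps: "set ps \<subseteq> carrier P \<times> carrier M1"
    "\<And>x. x \<in> topspace X \<Longrightarrow> ten0 (eval_at x ps) = ten0 (qs (u x))"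
    "\<And>p. p \<in> set ps \<Longrightarrow> \<exists>v\<in>u ` topspace X. \<exists>q\<in>set (qs v). pair_norm P M1 p \<le> pair_norm M0 M1 q"
    by (rule spread_presentations[OF u(1,2) qs(1)], assumption, rule that)
  have "S = ten ps"
    by (rule alg_eqI[OF ps(1) S]) (use u(3) ps(2) in \<open>simp add: qs(2)[symmetric]\<close>)
  then have "mod_norm PT S \<le> aggregate C (map (pair_norm P M1) ps)"
    using PM1.tensor_norm_le[OF ps(1)] by simp
  also have "\<dots> \<le> mod_norm W (alg S) + e"
    unfolding nA
  proof (rule aggregate_nA_le)
    show "0 \<le> mod_norm (C_fin X (completed_tensor Ab_nA R M0 M1)) (alg_nat_map Ab_nA R X M0 M1 S) + e"
      using CT.C_fin_norm_nonneg[OF w] e by (simp add: nA)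
    fix t assume "t \<in> set (map (pair_norm P M1) ps)"
    then obtain p where p: "p \<in> set ps" "t = pair_norm P M1 p"
      by auto
    obtain x q where x: "x \<in> topspace X" and q: "q \<in> set (qs (u x))" "t \<le> pair_norm M0 M1 q"
      using ps(3)[OF p(1)] unfolding p(2) by blast
    have qsx: "set (qs (u x)) \<subseteq> carrier M0 \<times> carrier M1"
      using qs(1) x by blast
    have "pair_norm M0 M1 q \<le> aggregate C (map (pair_norm M0 M1) (qs (u x)))"
      using q(1) qsx by (intro aggregate_ge_member) (auto intro!: M0M1.pair_norm_nonneg)
    also have "\<dots> \<le> mod_norm T0 (u x) + e"
      using qs(3)[of "u x"] x by simp
    also have "mod_norm T0 (u x) = mod_norm CT (alg S x)"
      using u(3)[OF x] by (simp add: tc_norm)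
    also have "\<dots> \<le> mod_norm W (alg S)"
      by (rule CT.C_fin_norm_ge[OF w x])
    finally show "t \<le> mod_norm (C_fin X (completed_tensor Ab_nA R M0 M1)) (alg_nat_map Ab_nA R X M0 M1 S) + e"
      using q(2) by (simp add: nA)
  qed
  finally show "mod_norm PT S \<le> mod_norm W (alg S) + e" .
qed

text \<open>With generators \<open>ss\<close> of \<open>M1\<close>, the terms of a presentation can be collected into one term for each
  generator, so that their number no longer depends on the presented element.\<close>

lemma collect_generators:
  assumes ss: "set ss \<subseteq> carrier M1"
    and gen: "\<And>y. y \<in> carrier M1 \<Longrightarrow> \<exists>r. (\<forall>s\<in>set ss. r s \<in> carrier R \<and>
        ring_norm R (r s) * mod_norm M1 s \<le> K * mod_norm M1 y) \<and>
        y = foldr (\<lambda>s v. r s \<odot>\<^bsub>M1\<^esub> s \<oplus>\<^bsub>M1\<^esub> v) ss \<zero>\<^bsub>M1\<^esub>"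
    and K0: "K0 \<ge> 0" "\<And>a x. a \<in> carrier R \<Longrightarrow> x \<in> carrier M0 \<Longrightarrow>
        mod_norm M0 (a \<odot>\<^bsub>M0\<^esub> x) \<le> K0 * ring_norm R a * mod_norm M0 x"
    and ps: "set ps \<subseteq> carrier M0 \<times> carrier M1"
  shows "\<exists>c. (\<forall>s\<in>set ss. c s \<in> carrier M0 \<and>
      mod_norm M0 (c s) * mod_norm M1 s \<le> K0 * K * sum_list (map (pair_norm M0 M1) ps)) \<and>
      ten0 ps = ten0 (map (\<lambda>s. (c s, s)) ss)"
  using ps
proof (induction ps)
  case Nil
  have "ten0 (map (\<lambda>s. (\<zero>\<^bsub>M0\<^esub>, s)) ss) = ten0 []"
    by (rule M0M1.tensor_sum_zero) (use ss in auto)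
  then show ?case
    by (intro exI[of _ "\<lambda>_. \<zero>\<^bsub>M0\<^esub>"]) simp
next
  case (Cons p ps)
  obtain x y where p: "p = (x, y)" by fastforce
  have xy: "x \<in> carrier M0" "y \<in> carrier M1" and ps: "set ps \<subseteq> carrier M0 \<times> carrier M1"
    using Cons.prems by (auto simp: p)
  obtain c where c: "\<And>s. s \<in> set ss \<Longrightarrow> c s \<in> carrier M0"
    "\<And>s. s \<in> set ss \<Longrightarrow> mod_norm M0 (c s) * mod_norm M1 s \<le> K0 * K * sum_list (map (pair_norm M0 M1) ps)"
    "ten0 ps = ten0 (map (\<lambda>s. (c s, s)) ss)"
    using Cons.IH[OF ps] by blast
  obtain r where r: "\<And>s. s \<in> set ss \<Longrightarrow> r s \<in> carrier R"
    "\<And>s. s \<in> set ss \<Longrightarrow> ring_norm R (r s) * mod_norm M1 s \<le> K * mod_norm M1 y"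
    "y = foldr (\<lambda>s v. r s \<odot>\<^bsub>M1\<^esub> s \<oplus>\<^bsub>M1\<^esub> v) ss \<zero>\<^bsub>M1\<^esub>"
    using gen[OF xy(2)] by blast
  \<comment> \<open>Expands \<open>y\<close> along the generators and moves the scalars to the left
    factor, turning one term into one term per generator.\<close>
  have fold: "foldr (\<lambda>s v. r s \<odot>\<^bsub>M1\<^esub> s \<oplus>\<^bsub>M1\<^esub> v) us \<zero>\<^bsub>M1\<^esub> \<in> carrier M1 \<and>
      ten0 [(x, foldr (\<lambda>s v. r s \<odot>\<^bsub>M1\<^esub> s \<oplus>\<^bsub>M1\<^esub> v) us \<zero>\<^bsub>M1\<^esub>)] =
      ten0 (map (\<lambda>s. (r s \<odot>\<^bsub>M0\<^esub> x, s)) us)" if "set us \<subseteq> set ss" for us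
    using that
  proof (induction us)
    case Nil
    then show ?case
      using M0M1.tensor_sum_zero[of "[(x, \<zero>\<^bsub>M1\<^esub>)]"] xy by simp
  next
    case (Cons s us)
    let ?v = "foldr (\<lambda>s v. r s \<odot>\<^bsub>M1\<^esub> s \<oplus>\<^bsub>M1\<^esub> v) us \<zero>\<^bsub>M1\<^esub>"
    have s: "s \<in> carrier M1" "r s \<in> carrier R" "?v \<in> carrier M1"
      using Cons r(1) ss by auto
    have us: "set (map (\<lambda>s. (r s \<odot>\<^bsub>M0\<^esub> x, s)) us) \<subseteq> carrier M0 \<times> carrier M1"
      using Cons.prems r(1) ss xy by auto
    have "ten0 [(x, r s \<odot>\<^bsub>M1\<^esub> s \<oplus>\<^bsub>M1\<^esub> ?v)] =
        ten0 [(r s \<odot>\<^bsub>M0\<^esub> x, s)] \<oplus>\<^bsub>T0\<^esub> ten0 [(x, ?v)]"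
      using M0M1.pure_tensor_balanced[of C, unfolded balanced_def] s xy by simp
    also have "\<dots> = ten0 ([(r s \<odot>\<^bsub>M0\<^esub> x, s)] @ map (\<lambda>s. (r s \<odot>\<^bsub>M0\<^esub> x, s)) us)"
      using Cons s xy M0M1.tensor_add[OF _ us, of "[(r s \<odot>\<^bsub>M0\<^esub> x, s)]" C] by simp
    finally show ?case
      using s by simp
  qed
  \<comment> \<open>The new term adds \<open>r s\<close> times \<open>x\<close> to the coefficient
    of \<open>s\<close>. What is estimated is the coefficient norm times the norm of
    \<open>s\<close>, as a generator of norm 0 leaves its coefficient uncontrolled.\<close>
  let ?d = "\<lambda>s. r s \<odot>\<^bsub>M0\<^esub> x \<oplus>\<^bsub>M0\<^esub> c s"
  have l: "set (map (\<lambda>s. (r s \<odot>\<^bsub>M0\<^esub> x, s)) ss) \<subseteq> carrier M0 \<times> carrier M1"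
    "set (map (\<lambda>s. (c s, s)) ss) \<subseteq> carrier M0 \<times> carrier M1"
    using r(1) c(1) ss xy by auto
  have "ten0 (p # ps) = ten0 [(x, y)] \<oplus>\<^bsub>T0\<^esub> ten0 ps"
    using M0M1.tensor_add[of "[(x, y)]" ps C] xy ps by (simp add: p)
  also have "\<dots> = ten0 (map (\<lambda>s. (r s \<odot>\<^bsub>M0\<^esub> x, s)) ss) \<oplus>\<^bsub>T0\<^esub>
      ten0 (map (\<lambda>s. (c s, s)) ss)"
    using fold[of ss] r(3) c(3) by simp
  also have "\<dots> = ten0 (map (\<lambda>s. (?d s, s)) ss)"
    using M0M1.tensor_add[OF l, of C] M0M1.tensor_sum_add_left[of ss "\<lambda>s. r s \<odot>\<^bsub>M0\<^esub> x" c "\<lambda>s. s"]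
      r(1) c(1) ss xy by auto
  finally have eq: "ten0 (p # ps) = ten0 (map (\<lambda>s. (?d s, s)) ss)" .
  have "mod_norm M0 (?d s) * mod_norm M1 s \<le> K0 * K * sum_list (map (pair_norm M0 M1) (p # ps))"
    if s: "s \<in> set ss" for s
  proof -
    have s1: "0 \<le> mod_norm M1 s"
      using s ss M1.norm_nonneg by blast
    have "mod_norm M0 (?d s) * mod_norm M1 s \<le>
        (mod_norm M0 (r s \<odot>\<^bsub>M0\<^esub> x) + mod_norm M0 (c s)) * mod_norm M1 s"
      using M0.norm_triangle[of "r s \<odot>\<^bsub>M0\<^esub> x" "c s"] r(1)[OF s] c(1)[OF s] xy s1
      by (intro mult_right_mono) auto
    also have "\<dots> \<le> K0 * ring_norm R (r s) * mod_norm M0 x * mod_norm M1 s + mod_norm M0 (c s) * mod_norm M1 s"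
      using mult_right_mono[OF K0(2)[OF r(1)[OF s] xy(1)] s1] by (simp add: distrib_right)
    \<comment> \<open>Regrouped because the expansion controls only the product of the norms of
      \<open>r s\<close> and \<open>s\<close>.\<close>
    also have "K0 * ring_norm R (r s) * mod_norm M0 x * mod_norm M1 s =
        (K0 * mod_norm M0 x) * (ring_norm R (r s) * mod_norm M1 s)"
      by simp
    also have "\<dots> \<le> (K0 * mod_norm M0 x) * (K * mod_norm M1 y)"
      using r(2)[OF s] K0(1) xy by (intro mult_left_mono) (auto simp: M0.norm_nonneg)
    finally show ?thesis
      using c(2)[OF s] by (simp add: p pair_norm_def algebra_simps)
  qed
  then show ?case
    using eq r(1) c(1) xy by (intro exI[of _ ?d]) auto
qed

text \<open>At every point the same generators occur, so the coefficients of a given generator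
  assemble to one function. The constant is the number of generators times
  \<open>2 * K0 * K\<close>, where \<open>K0\<close> comes from the scalar multiplication on
  \<open>M0\<close> and \<open>K\<close> from the expansion along generators.\<close>

lemma alg_bounded_below:
  assumes A: "C = Ab_A" and ss: "set ss \<subseteq> carrier M1"
    and gen: "\<And>y. y \<in> carrier M1 \<Longrightarrow> \<exists>r. (\<forall>s\<in>set ss. r s \<in> carrier R \<and>
        ring_norm R (r s) * mod_norm M1 s \<le> K * mod_norm M1 y) \<and>
        y = foldr (\<lambda>s v. r s \<odot>\<^bsub>M1\<^esub> s \<oplus>\<^bsub>M1\<^esub> v) ss \<zero>\<^bsub>M1\<^esub>"
    and K: "K \<ge> 0"
  shows "\<exists>K'. \<forall>S\<in>carrier PT. mod_norm PT S \<le> K' * mod_norm W (alg S)"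
proof -
  obtain K0 where K0: "K0 \<ge> 0" "\<And>a x. a \<in> carrier R \<Longrightarrow> x \<in> carrier M0 \<Longrightarrow>
      mod_norm M0 (a \<odot>\<^bsub>M0\<^esub> x) \<le> K0 * ring_norm R a * mod_norm M0 x"
    using M0.norm_smult_le by blast
  have coeffs: "\<exists>c. (\<forall>s\<in>set ss. c s \<in> carrier M0 \<and>
      mod_norm M0 (c s) * mod_norm M1 s \<le> 2 * K0 * K * mod_norm T0 t) \<and>
      t = ten0 (map (\<lambda>s. (c s, s)) ss)" if t: "t \<in> carrier T0" for t
  \<comment> \<open>At 0 no positive slack proportional to the norm exists, and zero coefficients do
    instead.\<close>
  proof (cases "t = \<zero>\<^bsub>T0\<^esub>")
    case True
    have "ten0 (map (\<lambda>s. (\<zero>\<^bsub>M0\<^esub>, s)) ss) = ten0 []"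
      by (rule M0M1.tensor_sum_zero) (use ss in auto)
    then show ?thesis
      using True by (intro exI[of _ "\<lambda>_. \<zero>\<^bsub>M0\<^esub>"]) (simp add: M0M1.tensor_zero[of C, symmetric])
  next
    case False
    then have "mod_norm T0 t > 0"
      using T0.norm_nonneg[OF t] T0.norm_eq_0_iff[OF t] by linarith
    \<comment> \<open>The norm of \<open>t\<close> itself serves as slack; this is the origin of the
      factor 2.\<close>
    with t obtain ps where ps: "set ps \<subseteq> carrier M0 \<times> carrier M1" "t = ten0 ps"
      "aggregate C (map (pair_norm M0 M1) ps) < mod_norm T0 t + mod_norm T0 t"
      by (rule M0M1.tensor_norm_approx)
    obtain c where c: "\<forall>s\<in>set ss. c s \<in> carrier M0 \<and>
      mod_norm M0 (c s) * mod_norm M1 s \<le> K0 * K * sum_list (map (pair_norm M0 M1) ps)"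
      "ten0 ps = ten0 (map (\<lambda>s. (c s, s)) ss)"
      using collect_generators[OF ss gen K0 ps(1)] by blast
    have "K0 * K * sum_list (map (pair_norm M0 M1) ps) \<le> K0 * K * (2 * mod_norm T0 t)"
      using ps(3) K0(1) K by (intro mult_left_mono) (auto simp: A)
    then show ?thesis
      using c ps(2) by (intro exI[of _ c]) force
  qed
  have "mod_norm PT S \<le> real (length ss) * (2 * K0 * K) * mod_norm W (alg S)"
    if S: "S \<in> carrier PT" for S
  proof -
    have w: "alg S \<in> carrier W"
      using S alg_surj by blast
    obtain u where u: "locally_constant X u" "finite (u ` topspace X)"
      "\<And>x. x \<in> topspace X \<Longrightarrow> u x \<in> carrier T0 \<and> alg S x = tc (u x)"
      by (rule W_valuesE[OF w], rule that)
    have "\<exists>c. \<forall>t\<in>carrier T0. (\<forall>s\<in>set ss. c t s \<in> carrier M0 \<and>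
        mod_norm M0 (c t s) * mod_norm M1 s \<le> 2 * K0 * K * mod_norm T0 t) \<and>
        t = ten0 (map (\<lambda>s. (c t s, s)) ss)"
      using coeffs by (intro bchoice ballI)
    then obtain c where "\<forall>t\<in>carrier T0. (\<forall>s\<in>set ss. c t s \<in> carrier M0 \<and>
        mod_norm M0 (c t s) * mod_norm M1 s \<le> 2 * K0 * K * mod_norm T0 t) \<and>
        t = ten0 (map (\<lambda>s. (c t s, s)) ss)" ..
    then have c: "\<And>t s. t \<in> carrier T0 \<Longrightarrow> s \<in> set ss \<Longrightarrow> c t s \<in> carrier M0"
      "\<And>t s. t \<in> carrier T0 \<Longrightarrow> s \<in> set ss \<Longrightarrow>
        mod_norm M0 (c t s) * mod_norm M1 s \<le> 2 * K0 * K * mod_norm T0 t"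
      "\<And>t. t \<in> carrier T0 \<Longrightarrow> t = ten0 (map (\<lambda>s. (c t s, s)) ss)"
      by blast+
    \<comment> \<open>The coefficients were chosen once for each tensor, so \<open>F s\<close> is a
      composition with \<open>u\<close> and inherits local constancy and finite image.\<close>
    define F where "F s = (\<lambda>x\<in>topspace X. c (u x) s)" for s
    have F: "F s \<in> carrier P" if "s \<in> set ss" for s
      unfolding F_def by (rule M0.C_fin_restrictI[OF u(1,2)]) (use c(1) u(3) that in blast)
    let ?ps = "map (\<lambda>s. (F s, s)) ss"
    have ps: "set ?ps \<subseteq> carrier P \<times> carrier M1"
      using F ss by auto
    have "S = ten ?ps"
    proof (rule alg_eqI[OF ps S])
      fix x assume x: "x \<in> topspace X"
      then have "eval_at x ?ps = map (\<lambda>s. (c (u x) s, s)) ss"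
        by (simp add: eval_at_def F_def)
      then show "alg S x = tc (ten0 (eval_at x ?ps))"
        using u(3)[OF x] c(3) by simp
    qed
    then have "mod_norm PT S \<le> aggregate C (map (pair_norm P M1) ?ps)"
      using PM1.tensor_norm_le[OF ps] by simp
    also have "\<dots> = (\<Sum>s\<leftarrow>ss. mod_norm P (F s) * mod_norm M1 s)"
      by (simp add: A comp_def pair_norm_def)
    also have "\<dots> \<le> (\<Sum>s\<leftarrow>ss. 2 * K0 * K * mod_norm W (alg S))"
    proof (rule sum_list_mono)
      fix s assume s: "s \<in> set ss"
      have bound: "0 \<le> 2 * K0 * K * mod_norm W (alg S)"
        using K0(1) K CT.C_fin_norm_nonneg[OF w] by simp
      show "mod_norm P (F s) * mod_norm M1 s \<le> 2 * K0 * K * mod_norm W (alg S)"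
      proof (cases "mod_norm M1 s = 0")
        case False
        then have pos: "mod_norm M1 s > 0"
          using M1.norm_nonneg[of s] s ss by force
        have "mod_norm P (F s) \<le> 2 * K0 * K * mod_norm W (alg S) / mod_norm M1 s"
        proof (rule M0.C_fin_norm_le)
          show "0 \<le> 2 * K0 * K * mod_norm W (alg S) / mod_norm M1 s"
            using bound pos by simp
          fix x assume x: "x \<in> topspace X"
          have "mod_norm M0 (c (u x) s) * mod_norm M1 s \<le> 2 * K0 * K * mod_norm T0 (u x)"
            using c(2) u(3)[OF x] s by blast
          also have "mod_norm T0 (u x) = mod_norm CT (alg S x)"
            using u(3)[OF x] by (simp add: tc_norm)
          also have "2 * K0 * K * \<dots> \<le> 2 * K0 * K * mod_norm W (alg S)"
            using CT.C_fin_norm_ge[OF w x] K0(1) K by (intro mult_left_mono) auto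
          finally show "mod_norm M0 (F s x) \<le> 2 * K0 * K * mod_norm W (alg S) / mod_norm M1 s"
            using x pos by (simp add: F_def pos_le_divide_eq)
        qed
        then show ?thesis
          using pos by (simp add: pos_le_divide_eq)
      qed (use bound in simp)
    qed
    also have "\<dots> = real (length ss) * (2 * K0 * K) * mod_norm W (alg S)"
      by (simp add: sum_list_triv)
    finally show ?thesis .
  qed
  then show ?thesis
    by blast
qed

end

section \<open>Extension to completions\<close>

locale bounded_linear_isolated =
  fixes C :: base_category and R :: "'r normed_ring"
    and V :: "('r, 'm) normed_module" and W :: "('r, 'n) normed_module" and f :: "'m \<Rightarrow> 'n"
  assumes isolated_source: "isolated_normed_module C R V" and isolated_target: "isolated_normed_module C R W"
    and linear: "R_linear R V W f"
    and bounded: "\<exists>K. \<forall>x\<in>carrier V. mod_norm W (f x) \<le> K * mod_norm V x"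
begin

sublocale V: isolated_normed_module C R V by (rule isolated_source)
sublocale W: isolated_normed_module C R W by (rule isolated_target)
sublocale CV: isolated_normed_module C R "completion V" by (rule V.completion_isolated_normed)

lemma extend_to_completion:
  assumes "x \<in> carrier V"
  shows "completion_extend W f (to_completion V x) = f x"
proof -
  obtain K where "\<And>x. x \<in> carrier V \<Longrightarrow> mod_norm W (f x) \<le> K * mod_norm V x"
    using bounded by blast
  from completion_extend_to_completion[OF isolated_source isolated_target linear this assms] show ?thesis .
qed

lemma completion_carrier: "carrier (completion V) = to_completion V ` carrier V"
  using V.to_completion_bij by (simp add: bij_betw_def)

lemma extend_Mod_hom: "Mod_hom C R (completion V) W (completion_extend W f)"
proof -
  have "R_linear R (completion V) W (completion_extend W f)"
    using linear
    by (auto simp: R_linear_def completion_carrier extend_to_completion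
        V.to_completion_add[symmetric] V.to_completion_smult[symmetric])
  moreover obtain K where "\<forall>x\<in>carrier V. mod_norm W (f x) \<le> K * mod_norm V x"
    using bounded ..
  then have "\<forall>z\<in>carrier (completion V). mod_norm W (completion_extend W f z) \<le> K * mod_norm (completion V) z"
    by (simp add: completion_carrier extend_to_completion V.to_completion_norm)
  ultimately show ?thesis
    unfolding Mod_hom_def using CV.banach W.banach by blast
qed

text \<open>The extension composed with the bijection \<open>to_completion\<close> is
  \<open>f\<close>, so bijectivity passes between the two.\<close>

lemma extend_bij:
  assumes "bij_betw f (carrier V) (carrier W)"
  shows "bij_betw (completion_extend W f) (carrier (completion V)) (carrier W)"
proof -
  have "bij_betw (completion_extend W f \<circ> to_completion V) (carrier V) (carrier W)"
    using assms by (rule bij_betw_cong[THEN iffD1, rotated]) (simp add: extend_to_completion)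
  then show ?thesis
    using bij_betw_comp_iff[OF V.to_completion_bij] by blast
qed

lemma extend_inv:
  assumes "bij_betw f (carrier V) (carrier W)" "x \<in> carrier V"
  shows "inv_into (carrier (completion V)) (completion_extend W f) (f x) = to_completion V x"
  using inv_into_f_f[of "completion_extend W f" "carrier (completion V)" "to_completion V x"]
    extend_bij[OF assms(1)] assms(2)
  by (simp add: bij_betw_def completion_carrier extend_to_completion)

text \<open>Boundedness of the inverse is the only condition left, and it can be tested on
  \<open>V\<close> because \<open>to_completion\<close> preserves norms. As an equivalence it serves
  both the positive results and the counterexample.\<close>

lemma extend_Mod_iso_iff:
  assumes "bij_betw f (carrier V) (carrier W)"
  shows "Mod_iso C R (completion V) W (completion_extend W f) \<longleftrightarrow>
    (\<exists>K. \<forall>x\<in>carrier V. mod_norm V x \<le> K * mod_norm W (f x))"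
proof -
  have W: "carrier W = f ` carrier V"
    using assms by (simp add: bij_betw_def)
  show ?thesis
    unfolding Mod_iso_def
    using extend_bij[OF assms]
    by (simp add: extend_Mod_hom W extend_inv[OF assms] V.to_completion_norm)
qed

lemma extend_isometric:
  assumes "\<And>x. x \<in> carrier V \<Longrightarrow> mod_norm W (f x) = mod_norm V x"
  shows "isometric (completion V) W (completion_extend W f)"
  by (simp add: isometric_def completion_carrier extend_to_completion V.to_completion_norm assms)

end

section \<open>Free modules\<close>

text \<open>The multiplicative constant is made positive because the lower bound on the diagonal is
  divided by it.\<close>

lemma banach_ring_props:
  assumes "banach_ring C R"
  shows "ring_norm R \<zero>\<^bsub>R\<^esub> = 0"
    and "a \<in> carrier R \<Longrightarrow> 0 \<le> ring_norm R a"
    and "a \<in> carrier R \<Longrightarrow> ring_norm R (\<ominus>\<^bsub>R\<^esub> a) = ring_norm R a"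
    and "a \<in> carrier R \<Longrightarrow> b \<in> carrier R \<Longrightarrow> ring_norm R (a \<oplus>\<^bsub>R\<^esub> b) \<le> aggregate C [ring_norm R a, ring_norm R b]"
    and "\<exists>K>0. \<forall>a\<in>carrier R. \<forall>b\<in>carrier R. ring_norm R (a \<otimes>\<^bsub>R\<^esub> b) \<le> K * ring_norm R a * ring_norm R b"
proof -
  have g: "banach_abelian_group C R (ring_norm R)"
    using assms by (simp add: banach_ring_def)
  note props = complete_norm_props[OF g]
  show "ring_norm R \<zero>\<^bsub>R\<^esub> = 0"
    and nonneg: "a \<in> carrier R \<Longrightarrow> 0 \<le> ring_norm R a"
    and "a \<in> carrier R \<Longrightarrow> ring_norm R (\<ominus>\<^bsub>R\<^esub> a) = ring_norm R a"
    and "a \<in> carrier R \<Longrightarrow> b \<in> carrier R \<Longrightarrow> ring_norm R (a \<oplus>\<^bsub>R\<^esub> b) \<le> aggregate C [ring_norm R a, ring_norm R b]"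
    for a b
    by (rule props; assumption)+
  obtain K where K: "\<And>a b. a \<in> carrier R \<Longrightarrow> b \<in> carrier R \<Longrightarrow>
      ring_norm R (a \<otimes>\<^bsub>R\<^esub> b) \<le> K * ring_norm R a * ring_norm R b"
    using assms unfolding banach_ring_def by blast
  have "ring_norm R (a \<otimes>\<^bsub>R\<^esub> b) \<le> max K 1 * ring_norm R a * ring_norm R b"
    if "a \<in> carrier R" "b \<in> carrier R" for a b
    using K[OF that] nonneg[OF that(1)] nonneg[OF that(2)] mult_right_mono[of K "max K 1" "ring_norm R a * ring_norm R b"]
    by (simp add: mult.assoc)
  then show "\<exists>K>0. \<forall>a\<in>carrier R. \<forall>b\<in>carrier R. ring_norm R (a \<otimes>\<^bsub>R\<^esub> b) \<le> K * ring_norm R a * ring_norm R b"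
    by (intro exI[of _ "max K 1"]) auto
qed

lemma regular_module_simps [simp]:
  "carrier (regular_module R) = carrier R"
  "\<zero>\<^bsub>regular_module R\<^esub> = \<zero>\<^bsub>R\<^esub>"
  "a \<oplus>\<^bsub>regular_module R\<^esub> b = a \<oplus>\<^bsub>R\<^esub> b"
  "a \<odot>\<^bsub>regular_module R\<^esub> b = a \<otimes>\<^bsub>R\<^esub> b"
  "mod_norm (regular_module R) = ring_norm R"
  by (simp_all add: regular_module_def)

lemma regular_module_isolated_normed:
  assumes R: "banach_ring C R" and iso: "isolated_at_zero R (ring_norm R)"
  shows "isolated_normed_module C R (regular_module R)"
proof -
  interpret R: cring R
    using R by (simp add: banach_ring_def)
  note props = banach_ring_props[OF R]
  interpret M: abelian_group "regular_module R"
  proof (rule abelian_groupI)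
    fix a assume "a \<in> carrier (regular_module R)"
    then show "\<exists>b\<in>carrier (regular_module R). b \<oplus>\<^bsub>regular_module R\<^esub> a = \<zero>\<^bsub>regular_module R\<^esub>"
      by (intro bexI[of _ "\<ominus>\<^bsub>R\<^esub> a"]) (auto simp: R.l_neg)
  qed (auto simp: R.a_ac)
  have minus: "\<ominus>\<^bsub>regular_module R\<^esub> a = \<ominus>\<^bsub>R\<^esub> a" if "a \<in> carrier R" for a
    using that by (intro M.minus_equality) (auto simp: R.l_neg)
  interpret M: module R "regular_module R"
    by (rule moduleI) (auto simp: R.is_cring M.abelian_group_axioms R.l_distr R.r_distr R.m_assoc)
  obtain K where K: "K > 0" "\<forall>a\<in>carrier R. \<forall>b\<in>carrier R. ring_norm R (a \<otimes>\<^bsub>R\<^esub> b) \<le> K * ring_norm R a * ring_norm R b"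
    using props(5) by blast
  show ?thesis
  proof
    show "\<exists>K\<ge>0. \<forall>a\<in>carrier R. \<forall>x\<in>carrier (regular_module R). mod_norm (regular_module R) (a \<odot>\<^bsub>regular_module R\<^esub> x)
        \<le> K * ring_norm R a * mod_norm (regular_module R) x"
      using K by (intro exI[of _ K]) auto
    show "\<exists>\<delta>>0. \<forall>x\<in>carrier (regular_module R). x \<noteq> \<zero>\<^bsub>regular_module R\<^esub> \<longrightarrow> \<delta> \<le> mod_norm (regular_module R) x"
      using isolated_ball[OF _ iso R.abelian_group_axioms] R
      by (simp add: banach_ring_def banach_abelian_group_def)
    show "mod_norm (regular_module R) (\<ominus>\<^bsub>regular_module R\<^esub> x) = mod_norm (regular_module R) x"
      if "x \<in> carrier (regular_module R)" for x
      using that by (simp add: minus props(3))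
  qed (use props(1,2,4) in auto)
qed

text \<open>Fixed to the Archimedean norm: under \<open>Ab_nA\<close> the isometry already yields
  the isomorphism, and the counterexample is Archimedean.\<close>

locale weighted_set =
  fixes R :: "'r normed_ring" and S :: "'s set" and w :: "'s \<Rightarrow> real"
  assumes banach_R: "banach_ring Ab_A R" and weight_nonneg: "s \<in> S \<Longrightarrow> 0 \<le> w s"
begin

abbreviation "V \<equiv> free_module Ab_A S w R"

lemma cring_R: "cring R"
  using banach_R by (simp add: banach_ring_def)

sublocale R: cring R by (rule cring_R)

lemmas R_props = banach_ring_props[OF banach_R]

lemma free_carrier: "r \<in> carrier V \<longleftrightarrow> r \<in> S \<rightarrow>\<^sub>E carrier R \<and> finite (support R S r)"
  by (simp add: free_module_def)

lemma free_app: "r \<in> carrier V \<Longrightarrow> s \<in> S \<Longrightarrow> r s \<in> carrier R"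
  by (auto simp: free_carrier)

lemma free_ext: "r \<in> carrier V \<Longrightarrow> r' \<in> carrier V \<Longrightarrow> (\<And>s. s \<in> S \<Longrightarrow> r s = r' s) \<Longrightarrow> r = r'"
  unfolding free_carrier by (auto intro: PiE_ext)

lemma free_apps:
  "s \<in> S \<Longrightarrow> \<zero>\<^bsub>V\<^esub> s = \<zero>\<^bsub>R\<^esub>"
  "s \<in> S \<Longrightarrow> (r \<oplus>\<^bsub>V\<^esub> r') s = r s \<oplus>\<^bsub>R\<^esub> r' s"
  "s \<in> S \<Longrightarrow> (a \<odot>\<^bsub>V\<^esub> r) s = a \<otimes>\<^bsub>R\<^esub> r s"
  by (simp_all add: free_module_def)

lemma free_restrictI:
  assumes "finite A" "\<And>s. s \<in> S \<Longrightarrow> h s \<in> carrier R" "\<And>s. s \<in> S \<Longrightarrow> s \<notin> A \<Longrightarrow> h s = \<zero>\<^bsub>R\<^esub>"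
  shows "(\<lambda>s\<in>S. h s) \<in> carrier V"
proof -
  have "support R S (\<lambda>s\<in>S. h s) \<subseteq> A"
    using assms(3) by (auto simp: support_def)
  then show ?thesis
    using assms(1,2) finite_subset by (auto simp: free_carrier)
qed

lemma free_zero_closed: "\<zero>\<^bsub>V\<^esub> \<in> carrier V"
  using free_restrictI[of "{}" "\<lambda>_. \<zero>\<^bsub>R\<^esub>"] by (simp add: free_module_def)

lemma free_add_closed:
  assumes "r \<in> carrier V" "r' \<in> carrier V"
  shows "r \<oplus>\<^bsub>V\<^esub> r' \<in> carrier V"
proof -
  have "(\<lambda>s\<in>S. r s \<oplus>\<^bsub>R\<^esub> r' s) \<in> carrier V"
    by (rule free_restrictI[of "support R S r \<union> support R S r'"])
      (use assms in \<open>auto simp: free_carrier support_def\<close>)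
  then show ?thesis
    by (simp add: free_module_def)
qed

lemma free_smult_closed:
  assumes "a \<in> carrier R" "r \<in> carrier V"
  shows "a \<odot>\<^bsub>V\<^esub> r \<in> carrier V"
proof -
  have "(\<lambda>s\<in>S. a \<otimes>\<^bsub>R\<^esub> r s) \<in> carrier V"
    by (rule free_restrictI[of "support R S r"]) (use assms in \<open>auto simp: free_carrier support_def\<close>)
  then show ?thesis
    by (simp add: free_module_def)
qed

lemma free_minus_closed:
  assumes "r \<in> carrier V"
  shows "(\<lambda>s\<in>S. \<ominus>\<^bsub>R\<^esub> r s) \<in> carrier V"
  by (rule free_restrictI[of "support R S r"]) (use assms in \<open>auto simp: free_carrier support_def\<close>)

lemmas free_closed = free_zero_closed free_add_closed free_smult_closed

lemma free_abelian_group: "abelian_group V"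
proof (rule abelian_groupI)
  fix r assume r: "r \<in> carrier V"
  show "\<exists>r'\<in>carrier V. r' \<oplus>\<^bsub>V\<^esub> r = \<zero>\<^bsub>V\<^esub>"
    by (intro bexI[of _ "\<lambda>s\<in>S. \<ominus>\<^bsub>R\<^esub> r s"] free_ext)
      (use r in \<open>auto simp: free_closed free_minus_closed free_apps free_app[OF r] R.l_neg\<close>)
qed (auto simp: free_closed free_apps free_app R.a_ac intro!: free_ext)

lemma free_a_inv:
  assumes "r \<in> carrier V"
  shows "\<ominus>\<^bsub>V\<^esub> r = (\<lambda>s\<in>S. \<ominus>\<^bsub>R\<^esub> r s)"
proof -
  interpret V: abelian_group V
    by (rule free_abelian_group)
  show ?thesis
    by (rule V.minus_equality, rule free_ext)
      (use assms in \<open>auto simp: free_closed free_minus_closed free_apps free_app[OF assms] R.l_neg\<close>)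
qed

lemma free_module: "Module.module R V"
  by (rule moduleI)
    (auto simp: R.is_cring free_abelian_group free_closed free_apps free_app
      R.l_distr R.r_distr R.m_assoc intro!: free_ext)

text \<open>Families with different supports, such as two summands and their sum, can thus be
  compared term by term over a common index set.\<close>

lemma free_norm_eq:
  assumes "finite A" "support R S r \<subseteq> A" "A \<subseteq> S"
  shows "mod_norm V r = (\<Sum>s\<in>A. ring_norm R (r s) * w s)"
proof -
  have "(\<Sum>s\<in>support R S r. ring_norm R (r s) * w s) = (\<Sum>s\<in>A. ring_norm R (r s) * w s)"
    by (rule sum.mono_neutral_left) (use assms R_props(1) in \<open>auto simp: support_def\<close>)
  then show ?thesis
    by (simp add: free_module_def)
qed

lemma free_norm_support: "mod_norm V r = (\<Sum>s\<in>support R S r. ring_norm R (r s) * w s)"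
  by (simp add: free_module_def)

lemma term_nonneg: "r \<in> carrier V \<Longrightarrow> s \<in> S \<Longrightarrow> 0 \<le> ring_norm R (r s) * w s"
  by (intro mult_nonneg_nonneg R_props(2) weight_nonneg free_app)

lemma free_norm_ge:
  assumes r: "r \<in> carrier V" and A: "finite A" "A \<subseteq> S"
  shows "(\<Sum>s\<in>A. ring_norm R (r s) * w s) \<le> mod_norm V r"
proof -
  have B: "finite (support R S r \<union> A)" "support R S r \<union> A \<subseteq> S"
    using r A by (auto simp: free_carrier support_def)
  have "(\<Sum>s\<in>A. ring_norm R (r s) * w s) \<le> (\<Sum>s\<in>support R S r \<union> A. ring_norm R (r s) * w s)"
    by (rule sum_mono2) (use B term_nonneg[OF r] in auto)
  then show ?thesis
    using free_norm_eq[OF B(1) _ B(2)] by simp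
qed

lemma free_seminormed: "seminormed_module Ab_A R V"
proof -
  interpret V: module R V
    by (rule free_module)
  have sup: "support R S r \<subseteq> S" for r
    by (auto simp: support_def)
  have fin: "finite (support R S r)" if "r \<in> carrier V" for r
    using that by (simp add: free_carrier)
  obtain K where K: "K > 0" "\<forall>a\<in>carrier R. \<forall>b\<in>carrier R. ring_norm R (a \<otimes>\<^bsub>R\<^esub> b) \<le> K * ring_norm R a * ring_norm R b"
    using R_props(5) by blast
  show ?thesis
  proof
    show "0 \<le> ring_norm R a" if "a \<in> carrier R" for a
      using that by (rule R_props(2))
    show "mod_norm V \<zero>\<^bsub>V\<^esub> = 0"
      by (simp add: free_norm_support support_def free_apps R_props(1))
    show "0 \<le> mod_norm V r" if "r \<in> carrier V" for r
      using free_norm_ge[OF that, of "{}"] by simp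
    show "mod_norm V (\<ominus>\<^bsub>V\<^esub> r) = mod_norm V r" if r: "r \<in> carrier V" for r
    proof -
      have "support R S (\<ominus>\<^bsub>V\<^esub> r) \<subseteq> support R S r"
        using r by (auto simp: support_def free_a_inv)
      then show ?thesis
        using free_norm_eq[OF fin[OF r] _ sup, of "\<ominus>\<^bsub>V\<^esub> r"] free_app[OF r]
        by (simp add: free_norm_support[of r] free_a_inv[OF r] R_props(3) support_def)
    qed
    show "mod_norm V (r \<oplus>\<^bsub>V\<^esub> r') \<le> aggregate Ab_A [mod_norm V r, mod_norm V r']"
      if r: "r \<in> carrier V" and r': "r' \<in> carrier V" for r r'
    proof -
      let ?A = "support R S r \<union> support R S r'"
      have A: "finite ?A" "?A \<subseteq> S"
        using fin[OF r] fin[OF r'] sup by auto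
      have "support R S (r \<oplus>\<^bsub>V\<^esub> r') \<subseteq> ?A"
        by (auto simp: support_def free_apps)
      then have "mod_norm V (r \<oplus>\<^bsub>V\<^esub> r') = (\<Sum>s\<in>?A. ring_norm R (r s \<oplus>\<^bsub>R\<^esub> r' s) * w s)"
        using free_norm_eq[OF A(1) _ A(2), of "r \<oplus>\<^bsub>V\<^esub> r'"] A(2) by (auto simp: free_apps intro!: sum.cong)
      also have "\<dots> \<le> (\<Sum>s\<in>?A. ring_norm R (r s) * w s + ring_norm R (r' s) * w s)"
      proof (rule sum_mono)
        fix s assume "s \<in> ?A"
        then have s: "s \<in> S"
          using A(2) by blast
        show "ring_norm R (r s \<oplus>\<^bsub>R\<^esub> r' s) * w s \<le> ring_norm R (r s) * w s + ring_norm R (r' s) * w s"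
          using mult_right_mono[OF R_props(4)[OF free_app[OF r s] free_app[OF r' s]] weight_nonneg[OF s]]
          by (simp add: distrib_right)
      qed
      also have "\<dots> = mod_norm V r + mod_norm V r'"
        using free_norm_eq[OF A(1) _ A(2), of r] free_norm_eq[OF A(1) _ A(2), of r'] by (simp add: sum.distrib)
      finally show ?thesis
        by simp
    qed
    have "mod_norm V (a \<odot>\<^bsub>V\<^esub> r) \<le> K * ring_norm R a * mod_norm V r"
      if a: "a \<in> carrier R" and r: "r \<in> carrier V" for a r
    proof -
      have "support R S (a \<odot>\<^bsub>V\<^esub> r) \<subseteq> support R S r"
        using a by (auto simp: support_def free_apps)
      then have "mod_norm V (a \<odot>\<^bsub>V\<^esub> r) = (\<Sum>s\<in>support R S r. ring_norm R (a \<otimes>\<^bsub>R\<^esub> r s) * w s)"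
        using free_norm_eq[OF fin[OF r] _ sup, of "a \<odot>\<^bsub>V\<^esub> r"] by (simp add: free_apps support_def)
      also have "\<dots> \<le> (\<Sum>s\<in>support R S r. K * ring_norm R a * (ring_norm R (r s) * w s))"
      proof (rule sum_mono)
        fix s assume "s \<in> support R S r"
        then have s: "s \<in> S"
          using sup by blast
        show "ring_norm R (a \<otimes>\<^bsub>R\<^esub> r s) * w s \<le> K * ring_norm R a * (ring_norm R (r s) * w s)"
          using mult_right_mono[OF K(2)[rule_format, OF a free_app[OF r s]] weight_nonneg[OF s]]
          by (simp add: mult.assoc)
      qed
      also have "\<dots> = K * ring_norm R a * mod_norm V r"
        by (simp add: sum_distrib_left free_norm_support)
      finally show ?thesis .
    qed
    then show "\<exists>K\<ge>0. \<forall>a\<in>carrier R. \<forall>r\<in>carrier V. mod_norm V (a \<odot>\<^bsub>V\<^esub> r) \<le> K * ring_norm R a * mod_norm V r"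
      using K(1) by (meson less_imp_le)
  qed
qed

text \<open>Weights of at least 1 let a single nonzero coordinate contribute at least the gap of
  \<open>R\<close>.\<close>

lemma free_isolated_normed:
  assumes iso: "isolated_at_zero R (ring_norm R)" and w: "\<And>s. s \<in> S \<Longrightarrow> 1 \<le> w s"
  shows "isolated_normed_module Ab_A R V"
proof -
  interpret V: seminormed_module Ab_A R V
    by (rule free_seminormed)
  obtain \<delta> where \<delta>: "\<delta> > 0" "\<forall>x\<in>carrier R. x \<noteq> \<zero>\<^bsub>R\<^esub> \<longrightarrow> \<delta> \<le> ring_norm R x"
    using isolated_ball[OF _ iso R.abelian_group_axioms] banach_R
    unfolding banach_ring_def banach_abelian_group_def by blast
  have "\<delta> \<le> mod_norm V r" if r: "r \<in> carrier V" "r \<noteq> \<zero>\<^bsub>V\<^esub>" for r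
  proof -
    obtain s where s: "s \<in> S" "r s \<noteq> \<zero>\<^bsub>R\<^esub>"
      using free_ext[OF r(1) free_zero_closed] r(2) by (auto simp: free_apps)
    then have "\<delta> * 1 \<le> ring_norm R (r s) * w s"
      using \<delta> free_app[OF r(1)] w by (intro mult_mono) auto
    also have "\<dots> \<le> mod_norm V r"
      using free_norm_ge[OF r(1), of "{s}"] s(1) by simp
    finally show ?thesis
      by simp
  qed
  then show ?thesis
    using \<delta>(1) by unfold_locales blast
qed

end

lemma (in abelian_group) finsum_eq_foldr:
  assumes "distinct ss" "\<And>s. s \<in> set ss \<Longrightarrow> h s \<in> carrier G"
  shows "finsum G h (set ss) = foldr (\<lambda>s v. h s \<oplus> v) ss \<zero>"
  using assms by (induction ss) auto

text \<open>A preimage of \<open>y\<close> in the completion is the class of a Cauchy sequence of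
  finite families. Their images are eventually equal to \<open>y\<close> because \<open>M\<close> is
  discrete, and their norms tend to that of the class; a late member is therefore an actual
  expansion of \<open>y\<close> with controlled coefficients.\<close>

lemma strict_epi_generators:
  assumes R: "banach_ring Ab_A R" and M: "isolated_normed_module Ab_A R M"
    and S: "set ss \<subseteq> carrier M" "distinct ss"
    and epi: "strict_epi Ab_A R (ell Ab_A (set ss) (mod_norm M) R) M (ell_nat_map R (set ss) M)"
  shows "\<exists>K\<ge>0. \<forall>y\<in>carrier M. \<exists>r. (\<forall>s\<in>set ss. r s \<in> carrier R \<and>
        ring_norm R (r s) * mod_norm M s \<le> K * mod_norm M y) \<and>
        y = foldr (\<lambda>s v. r s \<odot>\<^bsub>M\<^esub> s \<oplus>\<^bsub>M\<^esub> v) ss \<zero>\<^bsub>M\<^esub>"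
proof -
  interpret M: isolated_normed_module Ab_A R M by fact
  interpret weighted_set R "set ss" "mod_norm M"
    by unfold_locales (use R S M.norm_nonneg in auto)
  interpret V: seminormed_module Ab_A R V
    by (rule free_seminormed)
  define f where "f r = (\<Oplus>\<^bsub>M\<^esub>s\<in>support R (set ss) r. r s \<odot>\<^bsub>M\<^esub> s)" for r
  \<comment> \<open>Over the support the norm can be estimated, over all of \<open>ss\<close> the
    sum is additive in \<open>r\<close>; both forms are used.\<close>
  have f_eq: "f r = (\<Oplus>\<^bsub>M\<^esub>s\<in>set ss. r s \<odot>\<^bsub>M\<^esub> s)" if r: "r \<in> carrier V" for r
    unfolding f_def
    by (rule M.M.add.finprod_mono_neutral_cong_left)
      (use S free_app[OF r] in \<open>auto simp: support_def subset_iff\<close>)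
  have smult_closed: "r s \<odot>\<^bsub>M\<^esub> s \<in> carrier M" if "r \<in> carrier V" "s \<in> set ss" for r s
    using free_app[OF that] S(1) that(2) by auto
  have f_closed: "f r \<in> carrier M" if "r \<in> carrier V" for r
    unfolding f_eq[OF that] using smult_closed[OF that] by (intro M.M.finsum_closed) auto
  have f_add: "f (r \<oplus>\<^bsub>V\<^esub> r') = f r \<oplus>\<^bsub>M\<^esub> f r'" if r: "r \<in> carrier V" and r': "r' \<in> carrier V" for r r'
  proof -
    have "(\<Oplus>\<^bsub>M\<^esub>s\<in>set ss. (r \<oplus>\<^bsub>V\<^esub> r') s \<odot>\<^bsub>M\<^esub> s) = (\<Oplus>\<^bsub>M\<^esub>s\<in>set ss. r s \<odot>\<^bsub>M\<^esub> s \<oplus>\<^bsub>M\<^esub> r' s \<odot>\<^bsub>M\<^esub> s)"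
      using smult_closed r r' S(1) free_app
      by (intro M.M.finsum_cong') (auto simp: free_apps M.smult_l_distr)
    also have "\<dots> = (\<Oplus>\<^bsub>M\<^esub>s\<in>set ss. r s \<odot>\<^bsub>M\<^esub> s) \<oplus>\<^bsub>M\<^esub> (\<Oplus>\<^bsub>M\<^esub>s\<in>set ss. r' s \<odot>\<^bsub>M\<^esub> s)"
      using smult_closed r r' by (intro M.M.finsum_addf) auto
    finally show ?thesis
      using r r' free_add_closed by (simp add: f_eq)
  qed
  obtain K where K: "K \<ge> 0" "\<And>a x. a \<in> carrier R \<Longrightarrow> x \<in> carrier M \<Longrightarrow>
      mod_norm M (a \<odot>\<^bsub>M\<^esub> x) \<le> K * ring_norm R a * mod_norm M x"
    using M.norm_smult_le by blast
  have finsum_le: "mod_norm M (\<Oplus>\<^bsub>M\<^esub>s\<in>A. r s \<odot>\<^bsub>M\<^esub> s) \<le> (\<Sum>s\<in>A. K * (ring_norm R (r s) * mod_norm M s))"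
    if "finite A" "A \<subseteq> set ss" and r: "r \<in> carrier V" for A r
    using that(1,2)
  proof (induction A rule: finite_induct)
    case (insert s A)
    have car: "r s \<odot>\<^bsub>M\<^esub> s \<in> carrier M" "(\<lambda>s. r s \<odot>\<^bsub>M\<^esub> s) \<in> A \<rightarrow> carrier M"
      using insert.prems smult_closed[OF r] by auto
    have "mod_norm M (r s \<odot>\<^bsub>M\<^esub> s \<oplus>\<^bsub>M\<^esub> (\<Oplus>\<^bsub>M\<^esub>s\<in>A. r s \<odot>\<^bsub>M\<^esub> s)) \<le>
        mod_norm M (r s \<odot>\<^bsub>M\<^esub> s) + mod_norm M (\<Oplus>\<^bsub>M\<^esub>s\<in>A. r s \<odot>\<^bsub>M\<^esub> s)"
      using car by (intro M.norm_triangle M.M.finsum_closed) auto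
    also have "mod_norm M (r s \<odot>\<^bsub>M\<^esub> s) \<le> K * (ring_norm R (r s) * mod_norm M s)"
      using K(2)[of "r s" s] free_app[OF r] insert.prems S(1) by (auto simp: mult.assoc)
    finally show ?case
      using insert car by (simp add: M.M.finsum_insert)
  qed simp
  have f_bounded: "mod_norm M (f r) \<le> K * mod_norm V r" if r: "r \<in> carrier V" for r
  proof -
    have "support R (set ss) r \<subseteq> set ss"
      by (auto simp: support_def)
    then show ?thesis
      using finsum_le[of "support R (set ss) r" r] r
      by (simp add: f_def free_norm_support sum_distrib_left finite_subset)
  qed
  obtain K1 where K1: "K1 > 0" "\<forall>y\<in>carrier M. \<exists>x\<in>carrier (completion V).
      completion_extend M f x = y \<and> mod_norm (completion V) x \<le> K1 * mod_norm M y"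
    using epi unfolding strict_epi_def ell_def ell_nat_map_def f_def[symmetric, abs_def] by blast
  have lift: "\<exists>r\<in>carrier V. f r = y \<and> mod_norm V r \<le> (K1 + 1) * mod_norm M y" if y: "y \<in> carrier M" for y
  \<comment> \<open>Raising \<open>K1\<close> to \<open>K1 + 1\<close> makes the bound strict, hence
    valid for late terms of the sequence. This gains nothing at \<open>y = 0\<close>, where the zero
    family is taken.\<close>
  proof (cases "y = \<zero>\<^bsub>M\<^esub>")
    case True
    have "support R (set ss) \<zero>\<^bsub>V\<^esub> = {}"
      by (simp add: support_def free_apps)
    then have "f \<zero>\<^bsub>V\<^esub> = \<zero>\<^bsub>M\<^esub>" "mod_norm V \<zero>\<^bsub>V\<^esub> = 0"
      by (simp_all add: f_def)
    then show ?thesis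
      using True by (intro bexI[of _ "\<zero>\<^bsub>V\<^esub>"]) (auto simp: free_zero_closed)
  next
    case False
    then have pos: "mod_norm M y > 0"
      using M.norm_nonneg[OF y] M.norm_eq_0_iff[OF y] by linarith
    obtain x where x: "x \<in> carrier (completion V)" "completion_extend M f x = y"
      "mod_norm (completion V) x \<le> K1 * mod_norm M y"
      using K1(2) y by blast
    then obtain t where t: "t \<in> cauchy_seqs V" "x = cauchy_class V t"
      by (auto simp: completion_def)
    have "\<forall>\<^sub>F n in sequentially. f (t n) = y"
      using completion_extend_eventually[OF V.seminormed_module_axioms M f_closed f_add f_bounded t(1)] x(2) t(2)
      by simp
    moreover have "mod_norm (completion V) x < (K1 + 1) * mod_norm M y"
      using x(3) pos by (simp add: distrib_right)
    then have "\<forall>\<^sub>F n in sequentially. mod_norm V (t n) < (K1 + 1) * mod_norm M y"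
      using V.completion_norm_tendsto[OF t(1)] unfolding t(2) by (metis order_tendstoD(2))
    ultimately have "\<forall>\<^sub>F n in sequentially. f (t n) = y \<and> mod_norm V (t n) < (K1 + 1) * mod_norm M y"
      by (rule eventually_conj)
    then obtain n where "f (t n) = y" "mod_norm V (t n) < (K1 + 1) * mod_norm M y"
      by (metis (mono_tags, lifting) eventually_happens' sequentially_bot)
    then show ?thesis
      using t(1) by (intro bexI[of _ "t n"]) (auto simp: cauchy_seqs_def)
  qed
  show ?thesis
  proof (intro exI[of _ "K1 + 1"] conjI ballI)
    fix y assume "y \<in> carrier M"
    then obtain r where r: "r \<in> carrier V" "f r = y" "mod_norm V r \<le> (K1 + 1) * mod_norm M y"
      using lift by blast
    have "ring_norm R (r s) * mod_norm M s \<le> (K1 + 1) * mod_norm M y" if "s \<in> set ss" for s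
      using free_norm_ge[OF r(1), of "{s}"] that r(3) by simp
    moreover have "y = foldr (\<lambda>s v. r s \<odot>\<^bsub>M\<^esub> s \<oplus>\<^bsub>M\<^esub> v) ss \<zero>\<^bsub>M\<^esub>"
      using M.M.finsum_eq_foldr[OF S(2), of "\<lambda>s. r s \<odot>\<^bsub>M\<^esub> s"] smult_closed[OF r(1)] r(2) by (simp add: f_eq[OF r(1)])
    ultimately show "\<exists>r. (\<forall>s\<in>set ss. r s \<in> carrier R \<and> ring_norm R (r s) * mod_norm M s \<le> (K1 + 1) * mod_norm M y) \<and>
        y = foldr (\<lambda>s v. r s \<odot>\<^bsub>M\<^esub> s \<oplus>\<^bsub>M\<^esub> v) ss \<zero>\<^bsub>M\<^esub>"
      using free_app[OF r(1)] by blast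
  qed (use K1(1) in simp)
qed

section \<open>The diagonal\<close>

text \<open>The tensors \<open>\<Sum>\<^sub>k\<^sub><\<^sub>n \<delta>\<^sub>k \<otimes> e\<^sub>k\<close> have images of bounded norm, because at each point at most one
  \<open>\<delta>\<^sub>k\<close> is nonzero. On the other hand \<open>f \<otimes> g \<mapsto> f(j) g\<^sub>j\<close> is balanced for every \<open>j\<close>, and summing the
  norms of these functionals over \<open>j < n\<close> gives a lower bound of order \<open>n\<close> for the norm of the tensors.\<close>

lemma diagonal_unbounded:
  fixes R :: "'r normed_ring"
  assumes R: "banach_ring Ab_A R" and iso: "isolated_at_zero R (ring_norm R)"
    and nontrivial: "carrier R \<noteq> {\<zero>\<^bsub>R\<^esub>}"
  defines "Z \<equiv> discrete_topology (UNIV :: int set)"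
    and "L \<equiv> ell Ab_A (UNIV :: int set) (\<lambda>_. 1) R"
  shows "\<not> (\<exists>K. \<forall>T\<in>carrier (tensor Ab_A R (C_fin Z (regular_module R)) L).
    mod_norm (tensor Ab_A R (C_fin Z (regular_module R)) L) T \<le>
      K * mod_norm (C_fin Z (completed_tensor Ab_A R (regular_module R) L))
        (alg_nat_map Ab_A R Z (regular_module R) L T))"
    (is "\<not> (\<exists>K. ?bounded K)")
proof
  assume "\<exists>K. ?bounded K"
  then obtain K where K: "\<And>T. T \<in> carrier (tensor Ab_A R (C_fin Z (regular_module R)) L) \<Longrightarrow>
    mod_norm (tensor Ab_A R (C_fin Z (regular_module R)) L) T \<le>
      K * mod_norm (C_fin Z (completed_tensor Ab_A R (regular_module R) L))
        (alg_nat_map Ab_A R Z (regular_module R) L T)"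
    by blast
  interpret weighted_set R "UNIV :: int set" "\<lambda>_. 1"
    by unfold_locales (use R in auto)
  interpret V: isolated_normed_module Ab_A R V
    by (rule free_isolated_normed[OF iso]) simp
  have L: "L = completion V"
    by (simp add: L_def ell_def)
  interpret D: C_fin_tensor Ab_A R Z "regular_module R" L
    unfolding C_fin_tensor_def L
    using regular_module_isolated_normed[OF R iso] V.completion_isolated_normed by blast
  let ?tc = "to_completion V"
  \<comment> \<open>Since the completion adds nothing, the coordinates of an element of
    \<open>L\<close> are those of its unique preimage in \<open>V\<close>.\<close>
  define coord where "coord = inv_into (carrier V) ?tc"
  have coord_tc: "coord (?tc r) = r" if "r \<in> carrier V" for r
    using V.to_completion_bij that by (simp add: coord_def bij_betw_def inv_into_f_f)
  have L_cases: "\<exists>r\<in>carrier V. g = ?tc r" if "g \<in> carrier L" for g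
    using V.to_completion_bij that by (auto simp: bij_betw_def L)
  have tc_L: "?tc r \<in> carrier L" if "r \<in> carrier V" for r
    using V.to_completion_bij that by (auto simp: bij_betw_def L)
  have coord_closed: "coord g \<in> carrier V" if "g \<in> carrier L" for g
    using L_cases[OF that] coord_tc by auto
  have coord_add: "coord (g \<oplus>\<^bsub>L\<^esub> h) s = coord g s \<oplus>\<^bsub>R\<^esub> coord h s"
    if "g \<in> carrier L" "h \<in> carrier L" for g h s
    using L_cases[OF that(1)] L_cases[OF that(2)]
    by (auto simp: L V.to_completion_add[symmetric] coord_tc free_add_closed free_apps)
  have coord_smult: "coord (a \<odot>\<^bsub>L\<^esub> g) s = a \<otimes>\<^bsub>R\<^esub> coord g s"
    if "a \<in> carrier R" "g \<in> carrier L" for a g s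
    using L_cases[OF that(2)] that(1)
    by (auto simp: L V.to_completion_smult[symmetric] coord_tc free_smult_closed free_apps)
  have coord_norm: "mod_norm V (coord g) = mod_norm L g" if "g \<in> carrier L" for g
    using L_cases[OF that] by (auto simp: L coord_tc V.to_completion_norm)
  have P_app: "f j \<in> carrier R" if "f \<in> carrier D.P" for f j
    using D.M0.C_fin_app[OF that, of j] by (simp add: Z_def)
  let ?B = "\<lambda>j f g. f j \<otimes>\<^bsub>R\<^esub> coord g j"
  have B: "balanced R D.P L R (?B j)" for j
    unfolding balanced_def
  proof (intro conjI ballI)
    have j: "j \<in> topspace Z"
      by (simp add: Z_def)
    note apps = D.M0.C_fin_add_app[OF j] D.M0.C_fin_smult_app[OF j]
    fix f g assume f: "f \<in> carrier D.P" and g: "g \<in> carrier L"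
    have car: "f j \<in> carrier R" "coord g j \<in> carrier R"
      using P_app[OF f] free_app[OF coord_closed[OF g]] by auto
    then show "?B j f g \<in> carrier R"
      by simp
    show "?B j (f \<oplus>\<^bsub>D.P\<^esub> f') g = ?B j f g \<oplus>\<^bsub>R\<^esub> ?B j f' g"
      if "f' \<in> carrier D.P" for f'
      using P_app[OF that, of j] car by (simp add: apps R.l_distr)
    show "?B j f (g \<oplus>\<^bsub>L\<^esub> g') = ?B j f g \<oplus>\<^bsub>R\<^esub> ?B j f g'" if "g' \<in> carrier L" for g'
      using free_app[OF coord_closed[OF that], of j] car g that by (simp add: coord_add R.r_distr)
    show "?B j (a \<odot>\<^bsub>D.P\<^esub> f) g = ?B j f (a \<odot>\<^bsub>L\<^esub> g)" if "a \<in> carrier R" for a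
      using car that g by (simp add: apps coord_smult R.m_ac)
  qed
  \<comment> \<open>One function plays two roles: the indicator of \<open>k\<close> in the space of
    maps and the basis vector of \<open>k\<close> in the free module.\<close>
  define \<delta> where "\<delta> k x = (if x = k then \<one>\<^bsub>R\<^esub> else \<zero>\<^bsub>R\<^esub>)" for k x :: int
  have \<delta>_P: "\<delta> k \<in> carrier D.P" for k
  proof -
    have "locally_constant Z (\<lambda>x. x)"
      by (rule locally_constantI) (auto simp: Z_def intro: exI[of _ "{_}"])
    then have "(\<lambda>x\<in>topspace Z. if x = k then \<one>\<^bsub>R\<^esub> else \<zero>\<^bsub>regular_module R\<^esub>) \<in> carrier D.P"
      by (rule D.single_value_closed) simp
    also have "(\<lambda>x\<in>topspace Z. if x = k then \<one>\<^bsub>R\<^esub> else \<zero>\<^bsub>regular_module R\<^esub>) = \<delta> k"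
      by (rule ext) (simp add: Z_def \<delta>_def)
    finally show ?thesis .
  qed
  have \<delta>_V: "\<delta> k \<in> carrier V" for k
  proof -
    have "restrict (\<delta> k) UNIV \<in> carrier V"
      by (rule free_restrictI[of "{k}"]) (auto simp: \<delta>_def)
    then show ?thesis
      by (simp add: restrict_def)
  qed
  have supp: "support R UNIV (\<delta> k) \<subseteq> {k}" for k
    by (auto simp: support_def \<delta>_def)
  define u where "u = ring_norm R \<one>\<^bsub>R\<^esub>"
  have "\<one>\<^bsub>R\<^esub> \<noteq> \<zero>\<^bsub>R\<^esub>"
    using nontrivial R.one_zeroD by blast
  then have u: "u > 0"
    using D.M0.norm_eq_0_iff[of "\<one>\<^bsub>R\<^esub>"] D.M0.norm_nonneg[of "\<one>\<^bsub>R\<^esub>"] by (simp add: u_def less_le)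
  have e_norm: "mod_norm L (?tc (\<delta> k)) = u" for k
    using free_norm_eq[OF _ supp, of k] \<delta>_V by (simp add: L V.to_completion_norm \<delta>_def u_def)
  define ts where "ts n = map (\<lambda>k. (\<delta> (int k), ?tc (\<delta> (int k)))) [0..<n]" for n
  have ts: "set (ts n) \<subseteq> carrier D.P \<times> carrier L" for n
    using \<delta>_P \<delta>_V tc_L by (auto simp: ts_def)
  let ?T = "\<lambda>n. D.ten (ts n)"
  have upper: "mod_norm D.W
      (D.alg (?T n)) \<le> u * u" for n
  proof (rule D.CT.C_fin_norm_le)
    show "0 \<le> u * u"
      using u by simp
    fix x assume x: "x \<in> topspace Z"
    have "mod_norm D.CT (D.alg (?T n) x)
        = mod_norm D.T0 (D.ten0 (eval_at x (ts n)))"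
      using D.alg_app[OF ts x] D.tc_norm D.M0M1.tensor_sum_closed[OF D.eval_at_subset[OF ts x]] by simp
    also have "\<dots> \<le> aggregate Ab_A (map (pair_norm (regular_module R) L) (eval_at x (ts n)))"
      by (rule D.M0M1.tensor_norm_le[OF D.eval_at_subset[OF ts x]])
    also have "\<dots> = (\<Sum>k\<leftarrow>[0..<n]. ring_norm R (\<delta> (int k) x) * u)"
      by (simp add: eval_at_def ts_def pair_norm_def comp_def e_norm)
    also have "\<dots> = (\<Sum>k\<in>{0..<n}. ring_norm R (\<delta> (int k) x) * u)"
      by (simp only: interv_sum_list_conv_sum_set_nat set_upt)
    \<comment> \<open>At \<open>x\<close> only the index \<open>k = x\<close> survives. The guard is
      needed because \<open>nat\<close> sends negative integers to 0.\<close>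
    also have "\<dots> = (\<Sum>k\<in>{0..<n}. if k = nat x \<and> 0 \<le> x then u * u else 0)"
      by (rule sum.cong) (auto simp: \<delta>_def u_def R_props(1))
    also have "\<dots> \<le> u * u"
      using u by (cases "0 \<le> x") simp_all
    finally show "mod_norm D.CT
      (D.alg (?T n) x) \<le> u * u" .
  qed
  obtain K' where K': "K' > 0" "\<And>a b. a \<in> carrier R \<Longrightarrow> b \<in> carrier R \<Longrightarrow>
      ring_norm R (a \<otimes>\<^bsub>R\<^esub> b) \<le> K' * ring_norm R a * ring_norm R b"
    using R_props(5) by blast
  let ?eval = "\<lambda>j ps. foldr (\<lambda>(f, g) v. ?B j f g \<oplus>\<^bsub>R\<^esub> v) ps \<zero>\<^bsub>R\<^esub>"
  have eval_ts: "?eval (int j) (ts n) = \<one>\<^bsub>R\<^esub>" if j: "j < n" for j n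
  proof -
    \<comment> \<open>The two values of \<open>\<delta>\<close> at \<open>j\<close> multiply to 1
      for \<open>k = j\<close> and to 0 otherwise; distinctness prevents counting the index
      \<open>j\<close> twice.\<close>
    have "foldr (\<lambda>(f, g) v. ?B (int j) f g \<oplus>\<^bsub>R\<^esub> v) (map (\<lambda>k. (\<delta> (int k), ?tc (\<delta> (int k)))) ks) \<zero>\<^bsub>R\<^esub> =
        (if j \<in> set ks then \<one>\<^bsub>R\<^esub> else \<zero>\<^bsub>R\<^esub>)" if "distinct ks" for ks
      using that by (induction ks) (auto simp: coord_tc \<delta>_V \<delta>_def)
    then show ?thesis
      using j by (simp add: ts_def)
  qed
  \<comment> \<open>On one term \<open>(f, g)\<close> the factor \<open>f j\<close> is bounded by
    the supremum norm for all \<open>j\<close> alike, so summation over \<open>j\<close> falls on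
    the coordinates of \<open>g\<close> alone. Membership in \<open>R\<close> is carried along for
    the triangle inequality.\<close>
  have eval_le: "?eval j ps \<in> carrier R \<and> (\<Sum>j\<in>{0..<n}. ring_norm R (?eval (int j) ps)) \<le>
      K' * sum_list (map (pair_norm D.P L) ps)"
    if "set ps \<subseteq> carrier D.P \<times> carrier L" for n ps j
    using that
  proof (induction ps arbitrary: j)
    case Nil
    then show ?case
      by (simp add: R_props(1))
  next
    case (Cons p ps)
    obtain f g where p: "p = (f, g)" by fastforce
    have f: "f \<in> carrier D.P" and g: "g \<in> carrier L"
      and ps: "set ps \<subseteq> carrier D.P \<times> carrier L"
      using Cons.prems by (auto simp: p)
    have car: "f j \<in> carrier R" "coord g j \<in> carrier R" "?eval j ps \<in> carrier R" for j
      using P_app[OF f] free_app[OF coord_closed[OF g]] Cons.IH[OF ps] by auto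
    have f_nonneg: "0 \<le> mod_norm D.P f"
      by (rule D.P.norm_nonneg[OF f])
    have "ring_norm R (?eval (int j) (p # ps)) \<le>
        K' * mod_norm D.P f * ring_norm R (coord g (int j)) + ring_norm R (?eval (int j) ps)" for j
    proof -
      have "ring_norm R (?eval (int j) (p # ps)) \<le> ring_norm R (?B (int j) f g) + ring_norm R (?eval (int j) ps)"
        using R_props(4)[of "?B (int j) f g" "?eval (int j) ps"] car by (simp add: p)
      also have "ring_norm R (?B (int j) f g) \<le> K' * ring_norm R (f (int j)) * ring_norm R (coord g (int j))"
        by (rule K'(2)[OF car(1,2)])
      also have "\<dots> \<le> K' * mod_norm D.P f * ring_norm R (coord g (int j))"
        using D.M0.C_fin_norm_ge[OF f, of "int j"] K'(1) R_props(2)[OF car(2)]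
        by (intro mult_right_mono mult_left_mono) (auto simp: Z_def)
      finally show ?thesis
        by simp
    qed
    then have "(\<Sum>j\<in>{0..<n}. ring_norm R (?eval (int j) (p # ps))) \<le>
        (\<Sum>j\<in>{0..<n}. K' * mod_norm D.P f * ring_norm R (coord g (int j)) +
          ring_norm R (?eval (int j) ps))"
      by (rule sum_mono)
    also have "\<dots> = K' * mod_norm D.P f * (\<Sum>j\<in>{0..<n}. ring_norm R (coord g (int j))) +
        (\<Sum>j\<in>{0..<n}. ring_norm R (?eval (int j) ps))"
      by (simp add: sum.distrib sum_distrib_left)
    \<comment> \<open>The coordinates below \<open>n\<close> form part of the sum that is the norm
      of \<open>g\<close>; the factor 1 is the constant weight.\<close>
    also have "(\<Sum>j\<in>{0..<n}. ring_norm R (coord g (int j))) = (\<Sum>s\<in>int ` {0..<n}. ring_norm R (coord g s) * 1)"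
      by (subst sum.reindex) (auto simp: inj_on_def)
    also have "\<dots> \<le> mod_norm L g"
      using free_norm_ge[OF coord_closed[OF g], of "int ` {0..<n}"] coord_norm[OF g] by simp
    finally have "(\<Sum>j\<in>{0..<n}. ring_norm R (?eval (int j) (p # ps))) \<le>
        K' * mod_norm D.P f * mod_norm L g + (\<Sum>j\<in>{0..<n}. ring_norm R (?eval (int j) ps))"
      using K'(1) f_nonneg by (simp add: mult_left_mono)
    also have "\<dots> \<le> K' * mod_norm D.P f * mod_norm L g +
        K' * sum_list (map (pair_norm D.P L) ps)"
      using Cons.IH[OF ps] by simp
    finally show ?case
      using car by (simp add: p pair_norm_def distrib_left mult.assoc)
  qed
  have lower: "real n * u / K' \<le> mod_norm D.PT (?T n)" for n
  proof (rule D.PM1.tensor_norm_ge[OF D.PM1.tensor_sum_closed[OF ts]])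
    fix ps assume ps: "set ps \<subseteq> carrier D.P \<times> carrier L"
      "?T n = D.ten ps"
    have "?eval (int j) ps = \<one>\<^bsub>R\<^esub>" if "j < n" for j
      using D.PM1.tensor_sum_eqD[OF R.abelian_group_axioms B ts ps, of "int j"] eval_ts[OF that] by simp
    then have "real n * u = (\<Sum>j\<in>{0..<n}. ring_norm R (?eval (int j) ps))"
      by (simp add: u_def)
    also have "\<dots> \<le> K' * sum_list (map (pair_norm D.P L) ps)"
      using eval_le[OF ps(1)] by blast
    finally show "real n * u / K' \<le> aggregate Ab_A (map (pair_norm D.P L) ps)"
      using K'(1) by (simp add: pos_divide_le_eq mult.commute)
  qed
  have "real n * u / K' \<le> max K 0 * (u * u)" for n
  proof -
    have nonneg: "0 \<le> mod_norm D.W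
      (D.alg (?T n))"
      by (rule D.W.norm_nonneg[OF D.alg_tensor_sum(2)[OF ts]])
    have "real n * u / K' \<le> K * mod_norm D.W
      (D.alg (?T n))"
      using lower K[OF D.PM1.tensor_sum_closed[OF ts]] by (rule order_trans)
    \<comment> \<open>\<open>K\<close> may be negative, and the upper estimate can be inserted only
      behind a nonnegative factor.\<close>
    also have "\<dots> \<le> max K 0 * mod_norm D.W
      (D.alg (?T n))"
      using nonneg by (intro mult_right_mono) auto
    also have "\<dots> \<le> max K 0 * (u * u)"
      using upper by (intro mult_left_mono) auto
    finally show ?thesis .
  qed
  \<comment> \<open>Cancelling the positive \<open>u\<close> leaves a bound on all natural numbers
    at once.\<close>
  then have "real n \<le> max K 0 * u * K'" for n
    using u K'(1) by (simp add: field_simps)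
  then show False
    using reals_Archimedean2[of "max K 0 * u * K'"] by (meson not_less)
qed

section \<open>The completed natural map\<close>

context C_fin_tensor
begin

sublocale A: bounded_linear_isolated C R "tensor C R (C_fin X M0) M1" "C_fin X (completed_tensor C R M0 M1)"
  "alg_nat_map C R X M0 M1"
proof unfold_locales
  show "R_linear R (tensor C R P M1) W alg"
    by (rule alg_linear)
  show "\<exists>K. \<forall>x\<in>carrier (tensor C R P M1). mod_norm W (alg x) \<le> K * mod_norm (tensor C R P M1) x"
    using alg_norm_le by (intro exI[of _ 1]) simp
qed

lemma A_map_eq: "A_map C R X M0 M1 = completion_extend W alg"
  by (simp add: A_map_def)

lemma A_Mod_hom: "Mod_hom C R (completed_tensor C R P M1) W (A_map C R X M0 M1)"
  unfolding A_map_eq completed_tensor_def[of C R P M1] by (rule A.extend_Mod_hom)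

text \<open>Translates the isomorphism question into the uniform inequality on the algebraic tensor
  product.\<close>

lemma A_Mod_iso_iff:
  "Mod_iso C R (completed_tensor C R P M1) W (A_map C R X M0 M1) \<longleftrightarrow>
    (\<exists>K. \<forall>S\<in>carrier PT. mod_norm PT S \<le> K * mod_norm W (alg S))"
  unfolding A_map_eq completed_tensor_def[of C R P M1] by (rule A.extend_Mod_iso_iff[OF alg_bij])

lemma A_isometric_iso:
  assumes "C = Ab_nA"
  shows "Mod_iso C R (completed_tensor C R P M1) W (A_map C R X M0 M1)"
    and "isometric (completed_tensor C R P M1) W (A_map C R X M0 M1)"
proof -
  show "Mod_iso C R (completed_tensor C R P M1) W (A_map C R X M0 M1)"
    unfolding A_Mod_iso_iff using alg_isometric[OF assms] by (intro exI[of _ 1]) simp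
  show "isometric (completed_tensor C R P M1) W (A_map C R X M0 M1)"
    unfolding A_map_eq completed_tensor_def[of C R P M1] by (rule A.extend_isometric[OF alg_isometric[OF assms]])
qed

text \<open>The isometry covers \<open>Ab_nA\<close>. Under \<open>Ab_A\<close> the finite set is
  listed without repetition, so that sums over it become sums along the list.\<close>

lemma A_iso_of_finite_generators:
  assumes R: "banach_ring C R" and S: "S \<subseteq> carrier M1" "finite S"
    and epi: "strict_epi C R (ell C S (mod_norm M1) R) M1 (ell_nat_map R S M1)"
  shows "Mod_iso C R (completed_tensor C R P M1) W (A_map C R X M0 M1)"
proof (cases C)
  case Ab_A
  obtain ss where ss: "set ss = S" "distinct ss"
    using finite_distinct_list[OF S(2)] by blast
  obtain K where K: "K \<ge> 0" "\<forall>y\<in>carrier M1. \<exists>r. (\<forall>s\<in>set ss. r s \<in> carrier R \<and>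
        ring_norm R (r s) * mod_norm M1 s \<le> K * mod_norm M1 y) \<and>
        y = foldr (\<lambda>s v. r s \<odot>\<^bsub>M1\<^esub> s \<oplus>\<^bsub>M1\<^esub> v) ss \<zero>\<^bsub>M1\<^esub>"
    using strict_epi_generators[of R M1 ss] R isolated_M1 S(1) epi ss unfolding Ab_A by blast
  show ?thesis
    unfolding A_Mod_iso_iff
    by (rule alg_bounded_below[OF Ab_A _ _ K(1), of ss]) (use ss S(1) K(2) in auto)
next
  case Ab_nA
  then show ?thesis
    by (rule A_isometric_iso)
qed

end

theorem theorem7p11:
  fixes C :: base_category
    and R :: "'r normed_ring"
    and X :: "'x topology"
    and M0 :: "('r, 'm) normed_module"
    and M1 :: "('r, 'n) normed_module"
  assumes "banach_ring C R"
    and "banach_module C R M0" and "isolated_module M0"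
    and "banach_module C R M1" and "isolated_module M1"
  shows
    "Mod_hom C R (completed_tensor C R (C_fin X M0) M1) (C_fin X (completed_tensor C R M0 M1))
       (A_map C R X M0 M1)
     \<and>
     (R_linear R (tensor C R (C_fin X M0) M1) (C_fin X (completed_tensor C R M0 M1))
        (alg_nat_map C R X M0 M1) \<and>
      bij_betw (alg_nat_map C R X M0 M1)
        (carrier (tensor C R (C_fin X M0) M1)) (carrier (C_fin X (completed_tensor C R M0 M1))))
     \<and>
     (C = Ab_nA \<longrightarrow>
        Mod_iso C R (completed_tensor C R (C_fin X M0) M1) (C_fin X (completed_tensor C R M0 M1))
          (A_map C R X M0 M1) \<and>
        isometric (completed_tensor C R (C_fin X M0) M1) (C_fin X (completed_tensor C R M0 M1))
          (A_map C R X M0 M1))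
     \<and>
     (isolated_at_zero R (ring_norm R) \<and>
      (\<exists>S \<subseteq> carrier M1. finite S \<and>
         strict_epi C R (ell C S (mod_norm M1) R) M1 (ell_nat_map R S M1)) \<longrightarrow>
        Mod_iso C R (completed_tensor C R (C_fin X M0) M1) (C_fin X (completed_tensor C R M0 M1))
          (A_map C R X M0 M1) \<and>
        isolated_module (completed_tensor C R (C_fin X M0) M1) \<and>
        isolated_module (C_fin X (completed_tensor C R M0 M1)))
     \<and>
     (C = Ab_A \<and> carrier R \<noteq> {\<zero>\<^bsub>R\<^esub>} \<and> isolated_at_zero R (ring_norm R) \<longrightarrow>
        (let Z = discrete_topology (UNIV :: int set);
             R1 = regular_module R;
             L = ell C (UNIV :: int set) (\<lambda>_. 1) R
         in Mod_hom C R (completed_tensor C R (C_fin Z R1) L) (C_fin Z (completed_tensor C R R1 L))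
              (A_map C R Z R1 L) \<and>
            \<not> Mod_iso C R (completed_tensor C R (C_fin Z R1) L)
              (C_fin Z (completed_tensor C R R1 L)) (A_map C R Z R1 L)))"
proof -
  interpret C_fin_tensor C R X M0 M1
    by (rule C_fin_tensor.intro; rule isolated_normed_moduleI; fact)
  have iso: "isolated_module (completed_tensor C R (C_fin X M0) M1)"
    unfolding completed_tensor_def by (rule A.CV.isolated)
  \<comment> \<open>A second instance of the locale, with modules of other types. The variables and
    their defining equations mirror the \<open>let\<close> of the goal.\<close>
  have diagonal: "Mod_hom C R (completed_tensor C R (C_fin Z R1) L) (C_fin Z (completed_tensor C R R1 L)) (A_map C R Z R1 L) \<and>
      \<not> Mod_iso C R (completed_tensor C R (C_fin Z R1) L) (C_fin Z (completed_tensor C R R1 L)) (A_map C R Z R1 L)"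
    if C: "C = Ab_A" and R: "carrier R \<noteq> {\<zero>\<^bsub>R\<^esub>}" "isolated_at_zero R (ring_norm R)"
      and defs: "Z = discrete_topology (UNIV :: int set)" "R1 = regular_module R"
        "L = ell C (UNIV :: int set) (\<lambda>_. 1) R" for Z R1 L
  proof -
    interpret w: weighted_set R "UNIV :: int set" "\<lambda>_. 1"
      by unfold_locales (use assms(1) C in auto)
    interpret V: isolated_normed_module Ab_A R "free_module Ab_A (UNIV :: int set) (\<lambda>_. 1) R"
      by (rule w.free_isolated_normed[OF R(2)]) simp
    interpret D: C_fin_tensor C R Z R1 L
      unfolding C_fin_tensor_def defs ell_def C
      using regular_module_isolated_normed R(2) assms(1) C V.completion_isolated_normed by blast
    show ?thesis
      using D.A_Mod_hom D.A_Mod_iso_iff diagonal_unbounded[OF _ R(2,1)] assms(1) by (simp add: C defs)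
  qed
  show ?thesis
    unfolding Let_def
    using A_Mod_hom alg_linear alg_bij A_isometric_iso A_iso_of_finite_generators[OF assms(1)]
      iso W.isolated diagonal by blast
qed

end
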